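(* (i) In dimension $n=4$ for jets of order $\kappa=4$, the algebra $UE_4^4$ of jet polynomials ${\sf P}(j^4f_1,j^4f_2,j^4f_3,j^4f_4)$ invariant by reparametrization and under the unipotent action is generated by the $16$ mutually independent bi-invariants $$W^{10},f_1',\Lambda^3,\Lambda^5,\Lambda^7,D^6,D^8,N^{10},M^8,E^{10},L^{12},Q^{14},R^{15},U^{17},V^{19},X^{21}.$$ (ii) The ideal of relations between the restrictions of these bi-invariants to $\{f_1'=0\}$ does not involve $W^{10}$, and for the lexicographic ordering with $$\Lambda^3>\Lambda^5>\Lambda^7>D^6>D^8>N^{10}>M^8>E^{10}>L^{12}>Q^{14}>R^{15}>U^{17}>V^{19}>X^{21}$$ its reduced Gröbner basis (up to normalization of leading coefficients) consists of the following $41$ polynomials, which all vanish after setting $f_1'=0$ (the first monomial written in each one is its leading term): (1) $3\Lambda^3\Lambda^7-5\Lambda^5\Lambda^5$; (2) $\Lambda^3D^8-2\Lambda^5D^6$; (3) $5\Lambda^3N^{10}-\Lambda^7D^6$; (4) $3\Lambda^3L^{12}-5\Lambda^5E^{10}$; (5) $3\Lambda^3Q^{14}+5\Lambda^7E^{10}$; (6) $3\Lambda^3R^{15}+4D^8E^{10}$; (7) $3\Lambda^3U^{17}-36D^6D^6M^8-5E^{10}E^{10}$; (8) $3\Lambda^3V^{19}-5E^{10}L^{12}-6D^6D^8M^8$; (9) $3\Lambda^3X^{21}+5L^{12}L^{12}+M^8D^8D^8$; (10) $5\Lambda^5D^8-6\Lambda^7D^6$; (11) $10\Lambda^5N^{10}-\Lambda^7D^8$;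 (12) $\Lambda^5L^{12}-\Lambda^7E^{10}$; (13) $\Lambda^5Q^{14}+\Lambda^7L^{12}$; (14) $\Lambda^5R^{15}+8N^{10}E^{10}$; (15) $\Lambda^5U^{17}-E^{10}L^{12}-6D^6D^8M^8$; (16) $\Lambda^5V^{19}-M^8D^8D^8-L^{12}L^{12}$; (17) $\Lambda^5X^{21}-L^{12}Q^{14}+2D^8N^{10}M^8$; (18) $\Lambda^7R^{15}+8N^{10}L^{12}$; (19) $\Lambda^7U^{17}-L^{12}L^{12}-5M^8D^8D^8$; (20) $\Lambda^7V^{19}+L^{12}Q^{14}-10D^8M^8N^{10}$; (21) $\Lambda^7X^{21}+20N^{10}N^{10}M^8+Q^{14}Q^{14}$; (22) $6D^6M^8R^{15}+L^{12}U^{17}-E^{10}V^{19}$; (23) $5D^8M^8R^{15}-Q^{14}U^{17}-L^{12}V^{19}$; (24) $10N^{10}M^8R^{15}-Q^{14}V^{19}+L^{12}X^{21}$; (25) $5M^8R^{15}R^{15}+V^{19}V^{19}+U^{17}X^{21}$; (26) $12D^6N^{10}-D^8D^8$; (27) $6D^6L^{12}-5D^8E^{10}$; (28) $3D^6Q^{14}+25N^{10}E^{10}$; (29) $6D^6V^{19}+5E^{10}R^{15}-D^8U^{17}$; (30) $3D^6X^{21}-3L^{12}R^{15}+N^{10}U^{17}$; (31) $D^8L^{12}-10N^{10}E^{10}$; (32) $D^8Q^{14}+10N^{10}L^{12}$; (33) $D^8V^{19}-2N^{10}U^{17}+L^{12}R^{15}$; (34) $D^8X^{21}+Q^{14}R^{15}+2N^{10}V^{19}$;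 (35) $10N^{10}E^{10}V^{19}-2N^{10}L^{12}U^{17}+L^{12}L^{12}R^{15}$; (36) $10N^{10}L^{12}V^{19}+2N^{10}Q^{14}U^{17}-L^{12}Q^{14}R^{15}$; (37) $10N^{10}L^{12}X^{21}-Q^{14}Q^{14}R^{15}-2N^{10}Q^{14}V^{19}$; (38) $2N^{10}U^{17}X^{21}-L^{12}R^{15}X^{21}+Q^{14}R^{15}V^{19}+2N^{10}V^{19}V^{19}$; (39) $E^{10}Q^{14}+L^{12}L^{12}$; (40) $5E^{10}X^{21}+Q^{14}U^{17}+6L^{12}V^{19}$; (41) $5L^{12}L^{12}X^{21}-6L^{12}Q^{14}V^{19}-Q^{14}Q^{14}U^{17}$. (iii) Any bi-invariant of weight $m$ in $UE_4^4$ can be written uniquely in the finite polynomial form $$\sum_{o,p}(f_1')^o(W^{10})^p\sum{\sf coeff}_{a,\dots,n,o,p}\,(\Lambda^3)^a(\Lambda^5)^b(\Lambda^7)^c(D^6)^d(D^8)^e(N^{10})^f(M^8)^g(E^{10})^h(L^{12})^i(Q^{14})^j(R^{15})^k(U^{17})^l(V^{19})^{m'}(X^{21})^n,$$ where the inner sum is over $(a,b,\dots,l,m',n)\in\mathbb{N}^{14}\setminus(\square_1\cup\dots\cup\square_{41})$ with $3a+5b+7c+6d+8e+10f+8g+10h+12i+14j+15k+17l+19m'+21n=m-o-10p$, the coefficients are subject to no restriction, and $\square_s=\alpha^s+\mathbb{N}^{14}$ with $\alpha^s$ the exponent of the leading term of the $s$-th polynomial above. (iv) In dimension $n=3$ for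 jets of the same order $\kappa=4$, the algebra $UE_4^3$ is generated by the same list with $W^{10}$ removed, the ideal of relations between the restrictions to $\{f_1'=0\}$ being exactly the same, and with the entirely similar unique normal form (the one above with $p=0$) for a general bi-invariant of weight $m$.
   Context: $\mathbb{C}[j^4f]$ is the polynomial ring in $f_i^{(\lambda)}$, $1\le i\le n$, $1\le\lambda\le4$ (jet coordinates of germs $f:(\mathbb{C},0)\to\mathbb{C}^n$). ${\sf P}$ is invariant by reparametrization of weight $m$ if ${\sf P}(j^4(f\circ\phi))=(\phi')^m{\sf P}((j^4f)\circ\phi)$ for all local biholomorphisms $\phi$ of $(\mathbb{C},0)$. It is a bi-invariant if moreover it is unchanged under $f_i^{(\lambda)}\mapsto f_i^{(\lambda)}+\sum_{j<i}u_{ij}f_j^{(\lambda)}$ (all $\lambda$ simultaneously) for all $u_{ij}\in\mathbb{C}$; $UE_4^n$ is the algebra of bi-invariants. A list is mutually independent if no member is a polynomial in the others. Restriction to $\{f_1'=0\}$ means setting the single variable $f_1'$ equal to $0$; the relations considered are polynomial relations between the restrictions of the listed bi-invariants other than $f_1'$. Upper indices are weights. With ${\sf D}=\sum_{k,\lambda}f_k^{(\lambda+1)}\partial/\partial f_k^{(\lambda)}$ and $[{\sf P},{\sf Q}]=q\,{\sf D}{\sf P}\cdot{\sf Q}-p\,{\sf P}\cdot{\sf D}{\sf Q}$ for invariants of weights $p,q$, put $\Lambda_{1,i}^3=[f_i',f_1']=f_1'f_i''-f_1''f_i'$, $\Lambda_{1,i}^5=[\Lambda_{1,i}^3,f_1']$,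 $\Lambda_{1,i}^7=[\Lambda_{1,i}^5,f_1']$. Then (all the quotients are polynomials): $\Lambda^3=\Lambda_{1,2}^3$, $\Lambda^5=\Lambda_{1,2}^5$, $\Lambda^7=\Lambda_{1,2}^7$; $D^6=\det(f_j^{(\lambda)})_{1\le\lambda,j\le3}$, $D^8=[D^6,f_1']$, $N^{10}=(\Lambda_{1,2}^5\Lambda_{1,3}^7-\Lambda_{1,3}^5\Lambda_{1,2}^7)/(f_1')^2$; $W^{10}=\det(f_j^{(\lambda)})_{1\le\lambda,j\le4}$; $M^8=(3\Lambda^3\Lambda^7-5\Lambda^5\Lambda^5)/(f_1')^2$; $E^{10}=(3\Lambda^3D^8-6\Lambda^5D^6)/f_1'$; $L^{12}=(5\Lambda^3N^{10}-\Lambda^7D^6)/f_1'$; $Q^{14}=(\Lambda^7D^8-10\Lambda^5N^{10})/f_1'$; $R^{15}=(D^8D^8-12D^6N^{10})/f_1'$; $U^{17}=(4D^8E^{10}+3\Lambda^3R^{15})/f_1'$; $V^{19}=(8N^{10}E^{10}+\Lambda^5R^{15})/f_1'$; $X^{21}=(4D^8Q^{14}-5\Lambda^7R^{15})/f_1'$. *)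

theory Defs
  imports
    "HOL-Analysis.Complex_Analysis_Basics"
    "HOL-Library.Poly_Mapping"
    "Jordan_Normal_Form.Determinant"
begin

section \<open>Multivariate polynomials\<close>

type_synonym 'v monom = "'v \<Rightarrow>\<^sub>0 nat"
type_synonym 'v mpoly = "'v monom \<Rightarrow>\<^sub>0 complex"

definition Const :: "complex \<Rightarrow> 'v mpoly" where
  "Const c = Poly_Mapping.single 0 c"

definition Var :: "'v \<Rightarrow> 'v mpoly" where
  "Var v = Poly_Mapping.single (Poly_Mapping.single v 1) 1"

definition vars :: "'v mpoly \<Rightarrow> 'v set" where
  "vars p = (\<Union>t\<in>Poly_Mapping.keys p. Poly_Mapping.keys t)"

definition polys :: "'v set \<Rightarrow> 'v mpoly set" where
  "polys X = {p. vars p \<subseteq> X}"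

text \<open>The ring homomorphism extending \<open>h\<close> on coefficients and \<open>g\<close> on variables.\<close>

definition peval :: "(complex \<Rightarrow> 'a::comm_ring_1) \<Rightarrow> ('v \<Rightarrow> 'a) \<Rightarrow> 'v mpoly \<Rightarrow> 'a" where
  "peval h g p = (\<Sum>t\<in>Poly_Mapping.keys p.
     h (Poly_Mapping.lookup p t) * (\<Prod>v\<in>Poly_Mapping.keys t. g v ^ Poly_Mapping.lookup t v))"

abbreviation pvalue :: "('v \<Rightarrow> complex) \<Rightarrow> 'v mpoly \<Rightarrow> complex" where
  "pvalue \<equiv> peval (\<lambda>c. c)"

abbreviation psubst :: "('v \<Rightarrow> 'w mpoly) \<Rightarrow> 'v mpoly \<Rightarrow> 'w mpoly" where
  "psubst \<equiv> peval Const"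

text \<open>The subalgebra generated by the polynomials \<open>g v\<close>, \<open>v \<in> X\<close>.\<close>

definition generated_algebra :: "('v \<Rightarrow> 'w mpoly) \<Rightarrow> 'v set \<Rightarrow> 'w mpoly set" where
  "generated_algebra g X = psubst g ` polys X"

definition mutually_independent :: "('v \<Rightarrow> 'w mpoly) \<Rightarrow> bool" where
  "mutually_independent g \<longleftrightarrow> (\<forall>v. g v \<notin> generated_algebra g (UNIV - {v}))"

text \<open>Terms of \<open>p\<close> free of \<open>v\<close> contribute \<open>0\<close>, so the truncated subtraction is harmless.\<close>

definition partial_deriv :: "'v \<Rightarrow> 'v mpoly \<Rightarrow> 'v mpoly" where
  "partial_deriv v p = (\<Sum>t\<in>Poly_Mapping.keys p.
     Poly_Mapping.single (t - Poly_Mapping.single v 1)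
       (of_nat (Poly_Mapping.lookup t v) * Poly_Mapping.lookup p t))"

definition exact_quotient :: "'v mpoly \<Rightarrow> 'v mpoly \<Rightarrow> 'v mpoly" where
  "exact_quotient p d = (THE r. p = d * r)"


section \<open>Ideals and reduced Groebner bases in \<open>\<complex>[X]\<close>\<close>

definition ideal_generated :: "'v set \<Rightarrow> 'v mpoly set \<Rightarrow> 'v mpoly set" where
  "ideal_generated X G =
     {(\<Sum>g\<in>F. q g * g) | F q. finite F \<and> F \<subseteq> G \<and> (\<forall>g\<in>F. q g \<in> polys X)}"

text \<open>The strict lexicographic order on monomials in the variables of the list \<open>vs\<close>, which is
  ordered from the largest variable to the smallest one.\<close>

definition lex_less :: "'v list \<Rightarrow> 'v monom \<Rightarrow> 'v monom \<Rightarrow> bool" where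
  "lex_less vs s t \<longleftrightarrow> (\<exists>i<length vs.
     Poly_Mapping.lookup s (vs ! i) < Poly_Mapping.lookup t (vs ! i) \<and>
     (\<forall>j<i. Poly_Mapping.lookup s (vs ! j) = Poly_Mapping.lookup t (vs ! j)))"

definition lead_monom :: "('v monom \<Rightarrow> 'v monom \<Rightarrow> bool) \<Rightarrow> 'v mpoly \<Rightarrow> 'v monom" where
  "lead_monom lt p =
     (THE t. t \<in> Poly_Mapping.keys p \<and> (\<forall>s\<in>Poly_Mapping.keys p. s \<noteq> t \<longrightarrow> lt s t))"

definition lead_coef :: "('v monom \<Rightarrow> 'v monom \<Rightarrow> bool) \<Rightarrow> 'v mpoly \<Rightarrow> complex" where
  "lead_coef lt p = Poly_Mapping.lookup p (lead_monom lt p)"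

definition lead_term :: "('v monom \<Rightarrow> 'v monom \<Rightarrow> bool) \<Rightarrow> 'v mpoly \<Rightarrow> 'v mpoly" where
  "lead_term lt p = Poly_Mapping.single (lead_monom lt p) (lead_coef lt p)"

definition normalize_lead :: "('v monom \<Rightarrow> 'v monom \<Rightarrow> bool) \<Rightarrow> 'v mpoly \<Rightarrow> 'v mpoly" where
  "normalize_lead lt p = Const (inverse (lead_coef lt p)) * p"

definition groebner_basis ::
  "'v set \<Rightarrow> ('v monom \<Rightarrow> 'v monom \<Rightarrow> bool) \<Rightarrow> 'v mpoly set \<Rightarrow> 'v mpoly set \<Rightarrow> bool" where
  "groebner_basis X lt I G \<longleftrightarrow> finite G \<and> G \<subseteq> I \<and>
     ideal_generated X (lead_term lt ` (G - {0})) =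
     ideal_generated X (lead_term lt ` (I - {0}))"

definition reduced_groebner_basis ::
  "'v set \<Rightarrow> ('v monom \<Rightarrow> 'v monom \<Rightarrow> bool) \<Rightarrow> 'v mpoly set \<Rightarrow> 'v mpoly set \<Rightarrow> bool" where
  "reduced_groebner_basis X lt I G \<longleftrightarrow> groebner_basis X lt I G \<and>
     (\<forall>g\<in>G. g \<noteq> 0 \<and> lead_coef lt g = 1 \<and>
       (\<forall>t\<in>Poly_Mapping.keys g.
          Poly_Mapping.single t 1 \<notin> ideal_generated X (lead_term lt ` (G - {g}))))"


section \<open>Jet polynomials and bi-invariants\<close>

text \<open>The pair \<open>(i, l)\<close> is the jet coordinate \<open>f\<^sub>i\<^sup>(\<^sup>l\<^sup>)\<close>. All jet polynomials live in one ring with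
  infinitely many variables, \<open>jet_ring n\<close> being \<open>\<complex>[j\<^sup>4f]\<close> in dimension \<open>n\<close>.\<close>

type_synonym jet_poly = "(nat \<times> nat) mpoly"

abbreviation jet :: "nat \<Rightarrow> nat \<Rightarrow> jet_poly" where
  "jet i l \<equiv> Var (i, l)"

definition jet_ring :: "nat \<Rightarrow> jet_poly set" where
  "jet_ring n = polys ({1..n} \<times> {1..4})"

definition jet_at :: "(nat \<Rightarrow> complex \<Rightarrow> complex) \<Rightarrow> complex \<Rightarrow> nat \<times> nat \<Rightarrow> complex" where
  "jet_at f z = (\<lambda>(i, l). (deriv ^^ l) (f i) z)"

definition local_biholomorphism :: "(complex \<Rightarrow> complex) \<Rightarrow> bool" where
  "local_biholomorphism \<phi> \<longleftrightarrow> \<phi> analytic_on {0} \<and> \<phi> 0 = 0 \<and>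
     (\<exists>\<psi>. \<psi> analytic_on {0} \<and> \<psi> 0 = 0 \<and>
        (\<forall>\<^sub>F z in nhds 0. \<psi> (\<phi> z) = z) \<and> (\<forall>\<^sub>F z in nhds 0. \<phi> (\<psi> z) = z))"

text \<open>Equality of germs at \<open>0\<close> is equality in a neighbourhood of \<open>0\<close>.\<close>

definition reparam_invariant :: "nat \<Rightarrow> nat \<Rightarrow> jet_poly \<Rightarrow> bool" where
  "reparam_invariant n m P \<longleftrightarrow>
     (\<forall>f \<phi>. (\<forall>i\<in>{1..n}. f i analytic_on {0}) \<and> local_biholomorphism \<phi> \<longrightarrow>
        (\<forall>\<^sub>F z in nhds 0. pvalue (jet_at (\<lambda>i. f i \<circ> \<phi>) z) P =
           deriv \<phi> z ^ m * pvalue (jet_at f (\<phi> z)) P))"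

definition unipotent_invariant :: "jet_poly \<Rightarrow> bool" where
  "unipotent_invariant P \<longleftrightarrow> (\<forall>u :: nat \<Rightarrow> nat \<Rightarrow> complex.
     psubst (\<lambda>(i, l). jet i l + (\<Sum>j\<in>{1..<i}. Const (u i j) * jet j l)) P = P)"

definition bi_invariants :: "nat \<Rightarrow> nat \<Rightarrow> jet_poly set" where
  "bi_invariants n m =
     {P \<in> jet_ring n. reparam_invariant n m P \<and> unipotent_invariant P}"

text \<open>The algebra \<open>UE\<^sub>4\<^sup>n\<close> is graded: its elements are the sums of bi-invariants of various weights.\<close>

definition UE :: "nat \<Rightarrow> jet_poly set" where
  "UE n = {(\<Sum>m\<in>M. P m) | M P. finite M \<and> (\<forall>m\<in>M. P m \<in> bi_invariants n m)}"

text \<open>Restriction to \<open>{f\<^sub>1' = 0}\<close>.\<close>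

definition restrict :: "jet_poly \<Rightarrow> jet_poly" where
  "restrict P = psubst (\<lambda>v. if v = (1, 1) then 0 else Var v) P"


section \<open>The sixteen bi-invariants\<close>

text \<open>In \<open>\<Sum>\<^sub>k\<^sub>,\<^sub>\<lambda>\<close> only the variables occurring in \<open>P\<close> contribute, whence no dependence on \<open>n\<close>.\<close>

definition total_deriv :: "jet_poly \<Rightarrow> jet_poly" where
  "total_deriv P = (\<Sum>(k, l)\<in>vars P. jet k (l + 1) * partial_deriv (k, l) P)"

text \<open>\<open>bracket p P q Q\<close> is \<open>[P, Q]\<close> for invariants \<open>P\<close>, \<open>Q\<close> of weights \<open>p\<close>, \<open>q\<close>.\<close>

definition bracket :: "nat \<Rightarrow> jet_poly \<Rightarrow> nat \<Rightarrow> jet_poly \<Rightarrow> jet_poly" where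
  "bracket p P q Q = of_nat q * total_deriv P * Q - of_nat p * P * total_deriv Q"

definition Lambda3 :: "nat \<Rightarrow> jet_poly" where
  "Lambda3 i = bracket 1 (jet i 1) 1 (jet 1 1)"

definition Lambda5 :: "nat \<Rightarrow> jet_poly" where
  "Lambda5 i = bracket 3 (Lambda3 i) 1 (jet 1 1)"

definition Lambda7 :: "nat \<Rightarrow> jet_poly" where
  "Lambda7 i = bracket 5 (Lambda5 i) 1 (jet 1 1)"

text \<open>Rows and columns of the matrices are indexed from \<open>0\<close>.\<close>

definition wronskian :: "nat \<Rightarrow> jet_poly" where
  "wronskian k = Determinant.det (Matrix.mat k k (\<lambda>(l, j). jet (j + 1) (l + 1)))"

definition poly_D6 :: jet_poly where
  "poly_D6 = wronskian 3"

definition poly_D8 :: jet_poly where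
  "poly_D8 = bracket 6 poly_D6 1 (jet 1 1)"

definition poly_N10 :: jet_poly where
  "poly_N10 = exact_quotient (Lambda5 2 * Lambda7 3 - Lambda5 3 * Lambda7 2) ((jet 1 1)^2)"

definition poly_M8 :: jet_poly where
  "poly_M8 = exact_quotient (3 * Lambda3 2 * Lambda7 2 - 5 * Lambda5 2 * Lambda5 2) ((jet 1 1)^2)"

definition poly_E10 :: jet_poly where
  "poly_E10 = exact_quotient (3 * Lambda3 2 * poly_D8 - 6 * Lambda5 2 * poly_D6) (jet 1 1)"

definition poly_L12 :: jet_poly where
  "poly_L12 = exact_quotient (5 * Lambda3 2 * poly_N10 - Lambda7 2 * poly_D6) (jet 1 1)"

definition poly_Q14 :: jet_poly where
  "poly_Q14 = exact_quotient (Lambda7 2 * poly_D8 - 10 * Lambda5 2 * poly_N10) (jet 1 1)"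

definition poly_R15 :: jet_poly where
  "poly_R15 = exact_quotient (poly_D8 * poly_D8 - 12 * poly_D6 * poly_N10) (jet 1 1)"

definition poly_U17 :: jet_poly where
  "poly_U17 = exact_quotient (4 * poly_D8 * poly_E10 + 3 * Lambda3 2 * poly_R15) (jet 1 1)"

definition poly_V19 :: jet_poly where
  "poly_V19 = exact_quotient (8 * poly_N10 * poly_E10 + Lambda5 2 * poly_R15) (jet 1 1)"

definition poly_X21 :: jet_poly where
  "poly_X21 = exact_quotient (4 * poly_D8 * poly_Q14 - 5 * Lambda7 2 * poly_R15) (jet 1 1)"

text \<open>Formal variables standing for the sixteen bi-invariants; \<open>F1\<close> stands for \<open>f\<^sub>1'\<close>.\<close>

datatype gen = W10 | F1 | L3 | L5 | L7 | D6 | D8 | N10 | M8 | E10 | L12 | Q14 | R15 | U17 | V19 | X21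

primrec bi_inv :: "gen \<Rightarrow> jet_poly" where
  "bi_inv W10 = wronskian 4"
| "bi_inv F1 = jet 1 1"
| "bi_inv L3 = Lambda3 2"
| "bi_inv L5 = Lambda5 2"
| "bi_inv L7 = Lambda7 2"
| "bi_inv D6 = poly_D6"
| "bi_inv D8 = poly_D8"
| "bi_inv N10 = poly_N10"
| "bi_inv M8 = poly_M8"
| "bi_inv E10 = poly_E10"
| "bi_inv L12 = poly_L12"
| "bi_inv Q14 = poly_Q14"
| "bi_inv R15 = poly_R15"
| "bi_inv U17 = poly_U17"
| "bi_inv V19 = poly_V19"
| "bi_inv X21 = poly_X21"

primrec weight :: "gen \<Rightarrow> nat" where
  "weight W10 = 10"
| "weight F1 = 1"
| "weight L3 = 3"
| "weight L5 = 5"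
| "weight L7 = 7"
| "weight D6 = 6"
| "weight D8 = 8"
| "weight N10 = 10"
| "weight M8 = 8"
| "weight E10 = 10"
| "weight L12 = 12"
| "weight Q14 = 14"
| "weight R15 = 15"
| "weight U17 = 17"
| "weight V19 = 19"
| "weight X21 = 21"

definition gens14 :: "gen list" where
  "gens14 = [L3, L5, L7, D6, D8, N10, M8, E10, L12, Q14, R15, U17, V19, X21]"

abbreviation lex14 :: "gen monom \<Rightarrow> gen monom \<Rightarrow> bool" where
  "lex14 \<equiv> lex_less gens14"

text \<open>The ideal of \<open>\<complex>[X]\<close> of relations between the restrictions of the bi-invariants in \<open>X\<close>.\<close>

definition relation_ideal :: "gen set \<Rightarrow> gen mpoly set" where
  "relation_ideal X = {p \<in> polys X. psubst (\<lambda>v. restrict (bi_inv v)) p = 0}"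


section \<open>The forty-one relations\<close>

text \<open>Each relation is written as a list of terms, a term consisting of its coefficient and the list
  of its variables repeated according to their exponents.\<close>

definition relations :: "(int \<times> gen list) list list" where
  "relations = [
     [(3, [L3, L7]), (-5, [L5, L5])],
     [(1, [L3, D8]), (-2, [L5, D6])],
     [(5, [L3, N10]), (-1, [L7, D6])],
     [(3, [L3, L12]), (-5, [L5, E10])],
     [(3, [L3, Q14]), (5, [L7, E10])],
     [(3, [L3, R15]), (4, [D8, E10])],
     [(3, [L3, U17]), (-36, [D6, D6, M8]), (-5, [E10, E10])],
     [(3, [L3, V19]), (-5, [E10, L12]), (-6, [D6, D8, M8])],
     [(3, [L3, X21]), (5, [L12, L12]), (1, [M8, D8, D8])],
     [(5, [L5, D8]), (-6, [L7, D6])],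
     [(10, [L5, N10]), (-1, [L7, D8])],
     [(1, [L5, L12]), (-1, [L7, E10])],
     [(1, [L5, Q14]), (1, [L7, L12])],
     [(1, [L5, R15]), (8, [N10, E10])],
     [(1, [L5, U17]), (-1, [E10, L12]), (-6, [D6, D8, M8])],
     [(1, [L5, V19]), (-1, [M8, D8, D8]), (-1, [L12, L12])],
     [(1, [L5, X21]), (-1, [L12, Q14]), (2, [D8, N10, M8])],
     [(1, [L7, R15]), (8, [N10, L12])],
     [(1, [L7, U17]), (-1, [L12, L12]), (-5, [M8, D8, D8])],
     [(1, [L7, V19]), (1, [L12, Q14]), (-10, [D8, M8, N10])],
     [(1, [L7, X21]), (20, [N10, N10, M8]), (1, [Q14, Q14])],
     [(6, [D6, M8, R15]), (1, [L12, U17]), (-1, [E10, V19])],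
     [(5, [D8, M8, R15]), (-1, [Q14, U17]), (-1, [L12, V19])],
     [(10, [N10, M8, R15]), (-1, [Q14, V19]), (1, [L12, X21])],
     [(5, [M8, R15, R15]), (1, [V19, V19]), (1, [U17, X21])],
     [(12, [D6, N10]), (-1, [D8, D8])],
     [(6, [D6, L12]), (-5, [D8, E10])],
     [(3, [D6, Q14]), (25, [N10, E10])],
     [(6, [D6, V19]), (5, [E10, R15]), (-1, [D8, U17])],
     [(3, [D6, X21]), (-3, [L12, R15]), (1, [N10, U17])],
     [(1, [D8, L12]), (-10, [N10, E10])],
     [(1, [D8, Q14]), (10, [N10, L12])],
     [(1, [D8, V19]), (-2, [N10, U17]), (1, [L12, R15])],
     [(1, [D8, X21]), (1, [Q14, R15]), (2, [N10, V19])],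
     [(10, [N10, E10, V19]), (-2, [N10, L12, U17]), (1, [L12, L12, R15])],
     [(10, [N10, L12, V19]), (2, [N10, Q14, U17]), (-1, [L12, Q14, R15])],
     [(10, [N10, L12, X21]), (-1, [Q14, Q14, R15]), (-2, [N10, Q14, V19])],
     [(2, [N10, U17, X21]), (-1, [L12, R15, X21]), (1, [Q14, R15, V19]), (2, [N10, V19, V19])],
     [(1, [E10, Q14]), (1, [L12, L12])],
     [(5, [E10, X21]), (1, [Q14, U17]), (6, [L12, V19])],
     [(5, [L12, L12, X21]), (-6, [L12, Q14, V19]), (-1, [Q14, Q14, U17])]]"

definition relation_poly :: "(int \<times> gen list) list \<Rightarrow> gen mpoly" where
  "relation_poly r = (\<Sum>(c, vs)\<leftarrow>r. of_int c * (\<Prod>v\<leftarrow>vs. Var v))"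

definition first_monom :: "(int \<times> gen list) list \<Rightarrow> gen monom" where
  "first_monom r = (\<Sum>v\<leftarrow>snd (hd r). Poly_Mapping.single v 1)"


section \<open>Normal forms\<close>

text \<open>\<open>\<nat>\<^sup>1\<^sup>4\<close> is the set of the exponents of monomials in the variables \<open>gens14\<close>.\<close>

definition exponents14 :: "gen monom set" where
  "exponents14 = {\<beta>. Poly_Mapping.keys \<beta> \<subseteq> set gens14}"

definition box :: "(int \<times> gen list) list \<Rightarrow> gen monom set" where
  "box r = {lead_monom lex14 (relation_poly r) + \<gamma> | \<gamma>. \<gamma> \<in> exponents14}"

definition weighted_degree :: "gen monom \<Rightarrow> nat" where
  "weighted_degree \<beta> = (\<Sum>v\<in>Poly_Mapping.keys \<beta>. weight v * Poly_Mapping.lookup \<beta> v)"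

definition normal_exponents :: "nat \<Rightarrow> gen monom set" where
  "normal_exponents m =
     {Poly_Mapping.single F1 a + Poly_Mapping.single W10 p + \<beta> | a p \<beta>.
        \<beta> \<in> exponents14 - (\<Union>r\<in>set relations. box r) \<and> weighted_degree \<beta> + a + 10 * p = m}"

definition normal_exponents_without_W10 :: "nat \<Rightarrow> gen monom set" where
  "normal_exponents_without_W10 m = {t \<in> normal_exponents m. Poly_Mapping.lookup t W10 = 0}"

text \<open>Every bi-invariant of weight \<open>m\<close> has a unique expression with exponents in \<open>S m\<close>, and all
  coefficients are allowed in such expressions.\<close>

definition unique_normal_form :: "nat \<Rightarrow> (nat \<Rightarrow> gen monom set) \<Rightarrow> bool" where
  "unique_normal_form n S \<longleftrightarrow> (\<forall>m.
     (\<forall>P\<in>bi_invariants n m. \<exists>!c. Poly_Mapping.keys c \<subseteq> S m \<and> P = psubst bi_inv c) \<and>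
     (\<forall>c. Poly_Mapping.keys c \<subseteq> S m \<longrightarrow> psubst bi_inv c \<in> bi_invariants n m))"

end

(*
  A bi-invariant P of weight m is determined by its values at the jets for which the second to fourth
  derivatives of f_1 vanish and f_2, f_3, f_4 are triangular, since reparametrizations and unipotent
  transformations move a generic jet to this section. There P is a polynomial; normalizing a generic
  jet, clearing denominators, and dividing by the third, then by the second diagonal coordinate shows
  that (f_1')^k P is a polynomial in the sixteen generators for some k.

  Division by f_1' takes place in the algebra generated by the sixteen bi-invariants. Each of the 41
  relations, evaluated at the bi-invariants, is f_1' times a polynomial in them; so it can be used as a
  reduction rule, and every polynomial in the generators reduces to a combination of normal monomials.
  The normal monomials without f_1' remain linearly independent on the hyperplane f_1' = 0: at suitable
  points the generators are monomials in torus coordinates times s, s + 5, s + 25, s + 125 (for M, U, V,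
  X), and inside one multidegree the normal monomials are separated by the degree in s and the order of
  vanishing at s = -25. Hence a normal form that vanishes for f_1' = 0 is divisible by f_1'. The same
  independence yields uniqueness and the Groebner basis property, without any S-polynomials.
*)
theory Submission
  imports Defs "HOL-Complex_Analysis.Conformal_Mappings"
begin

section \<open>Evaluation of multivariate polynomials\<close>

text \<open>The crux is that a quotient by \<open>f\<^sub>1'\<close> of an element of the generated
  algebra is again in the algebra. The divisions by the coordinates (3,3) and (2,2) pose the same
  problem in miniature, so one locale, \<open>normal_division\<close>, serves three times: with no
  rule, with one Pluecker rule, with the 41 relations.

  The lexicographic order alone does not control the rewriting: the multiples of
  \<open>f\<^sub>1'\<close> that complete relations 39 and 41 contain \<open>M8\<close> and are
  lexicographically larger than the leading terms. Termination is therefore measured by a separate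
  additive weight, \<open>reduction_weight\<close>, and the lexicographic information is carried
  along in the preorder \<open>gen_order\<close>.

  The restricted algebra is not toric, since relations 7 to 9 have three terms. Once
  \<open>M8\<close> is s/36 times a torus monomial, these relations make \<open>U17\<close>,
  \<open>V19\<close>, \<open>X21\<close> proportional to s + 5, s + 25, s + 125. Normal monomials
  such as \<open>V19^2\<close> and \<open>U17 * X21\<close> agree in all torus degrees and in the
  degree in s; only the root s = -25 tells them apart.\<close>

abbreviation (input) keys :: "('a \<Rightarrow>\<^sub>0 'b::zero) \<Rightarrow> 'a set" where "keys \<equiv> Poly_Mapping.keys"
abbreviation (input) lookup :: "('a \<Rightarrow>\<^sub>0 'b::zero) \<Rightarrow> 'a \<Rightarrow> 'b" where "lookup \<equiv> Poly_Mapping.lookup"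
abbreviation (input) single :: "'a \<Rightarrow> 'b::zero \<Rightarrow> 'a \<Rightarrow>\<^sub>0 'b" where "single \<equiv> Poly_Mapping.single"

definition mono_eval :: "('v \<Rightarrow> 'a::comm_ring_1) \<Rightarrow> 'v Defs.monom \<Rightarrow> 'a" where
  "mono_eval g t = (\<Prod>v\<in>keys t. g v ^ lookup t v)"

lemma mono_eval_superset:
  assumes "finite S" "keys t \<subseteq> S"
  shows "mono_eval g t = (\<Prod>v\<in>S. g v ^ lookup t v)"
  unfolding mono_eval_def
  by (rule prod.mono_neutral_left) (use assms in \<open>auto simp: in_keys_iff\<close>)

lemma mono_eval_0 [simp]: "mono_eval g 0 = 1"
  by (simp add: mono_eval_def)

lemma mono_eval_single [simp]: "mono_eval g (single v n) = g v ^ n"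
  by (cases "n = 0") (simp_all add: mono_eval_def)

lemma mono_eval_add: "mono_eval g (s + t) = mono_eval g s * mono_eval g t"
proof -
  let ?S = "keys s \<union> keys t"
  have "keys (s + t) \<subseteq> ?S" by (rule Poly_Mapping.keys_add)
  then show ?thesis
    by (simp add: mono_eval_superset[of ?S] lookup_add power_add prod.distrib)
qed

lemma mono_eval_neq_0:
  fixes g :: "'v \<Rightarrow> complex"
  assumes "\<And>v. g v \<noteq> 0"
  shows "mono_eval g t \<noteq> 0"
  using assms by (simp add: mono_eval_def)

lemma mpoly_sum_monomials:
  "(\<Sum>t\<in>keys p. single t (lookup p t)) = p"
proof (rule poly_mapping_eqI)
  fix k
  show "lookup (\<Sum>t\<in>keys p. single t (lookup p t)) k
      = lookup p k"
    by (cases "k \<in> keys p")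
       (auto simp: lookup_sum lookup_single when_def sum.delta in_keys_iff)
qed

text \<open>\<open>peval\<close> occurs with three coefficient maps: the identity (values),
  \<open>Const\<close> (substitution of polynomials) and constant univariate polynomials (Kronecker
  substitution). The homomorphism laws are proved once for all three.\<close>

locale coeff_hom =
  fixes h :: "complex \<Rightarrow> 'a::comm_ring_1"
  assumes h_0: "h 0 = 0" and h_1: "h 1 = 1"
    and h_add: "h (a + b) = h a + h b" and h_mult: "h (a * b) = h a * h b"
begin

lemma peval_superset:
  assumes "finite S" "keys p \<subseteq> S"
  shows "peval h g p = (\<Sum>t\<in>S. h (lookup p t) * mono_eval g t)"
  unfolding peval_def mono_eval_def
  by (rule sum.mono_neutral_left) (use assms in \<open>auto simp: in_keys_iff h_0\<close>)

lemma peval_0: "peval h g 0 = 0"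
  by (simp add: peval_def)

lemma peval_single: "peval h g (single t c) = h c * mono_eval g t"
  by (cases "c = 0") (simp_all add: peval_def mono_eval_def h_0)

lemma peval_1: "peval h g 1 = 1"
  using peval_single[of g 0 1] by (simp add: h_1)

lemma peval_Const: "peval h g (Const c) = h c"
  by (simp add: Const_def peval_single)

lemma peval_Var: "peval h g (Var v) = g v"
  by (simp add: Var_def peval_single h_1)

lemma peval_add: "peval h g (p + q) = peval h g p + peval h g q"
proof -
  let ?S = "keys p \<union> keys q"
  have "keys (p + q) \<subseteq> ?S" by (rule Poly_Mapping.keys_add)
  then show ?thesis
    by (simp add: peval_superset[of ?S] lookup_add h_add distrib_right sum.distrib)
qed

lemma peval_sum: "peval h g (\<Sum>i\<in>I. p i) = (\<Sum>i\<in>I. peval h g (p i))"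
  by (induction I rule: infinite_finite_induct) (simp_all add: peval_0 peval_add)

lemma peval_mult: "peval h g (p * q) = peval h g p * peval h g q"
proof -
  let ?m = "\<lambda>p t. single t (lookup p t)"
  have "peval h g (p * q) =
      peval h g ((\<Sum>s\<in>keys p. ?m p s) * (\<Sum>t\<in>keys q. ?m q t))"
    by (simp add: mpoly_sum_monomials)
  also have "\<dots> = (\<Sum>s\<in>keys p. peval h g (?m p s)) * (\<Sum>t\<in>keys q. peval h g (?m q t))"
    by (simp add: sum_product mult_single peval_sum peval_single h_mult mono_eval_add mult_ac)
  also have "\<dots> = peval h g p * peval h g q"
    by (simp flip: peval_sum add: mpoly_sum_monomials)
  finally show ?thesis .
qed

lemma peval_uminus: "peval h g (- p) = - peval h g p"
  using peval_add[of g p "- p"] by (simp add: peval_0 eq_neg_iff_add_eq_0 add.commute)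

lemma peval_diff: "peval h g (p - q) = peval h g p - peval h g q"
  using peval_add[of g p "- q"] by (simp add: peval_uminus)

lemma peval_power: "peval h g (p ^ n) = peval h g p ^ n"
  by (induction n) (simp_all add: peval_1 peval_mult)

lemma peval_prod: "peval h g (\<Prod>i\<in>I. p i) = (\<Prod>i\<in>I. peval h g (p i))"
  by (induction I rule: infinite_finite_induct) (simp_all add: peval_1 peval_mult)

lemma peval_sum_list: "peval h g (\<Sum>i\<leftarrow>xs. p i) = (\<Sum>i\<leftarrow>xs. peval h g (p i))"
  by (induction xs) (simp_all add: peval_0 peval_add)

lemma peval_prod_list: "peval h g (\<Prod>i\<leftarrow>xs. p i) = (\<Prod>i\<leftarrow>xs. peval h g (p i))"
  by (induction xs) (simp_all add: peval_1 peval_mult)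

lemma peval_of_nat: "peval h g (of_nat n) = of_nat n"
  by (induction n) (simp_all add: peval_0 peval_1 peval_add)

lemma peval_of_int: "peval h g (of_int n) = of_int n"
  by (cases n) (simp_all add: peval_of_nat peval_diff peval_uminus peval_1)

lemma peval_numeral: "peval h g (numeral n) = numeral n"
  using peval_of_nat[of g "numeral n"] by simp

lemmas peval_simps [simp] = peval_0 peval_1 peval_Const peval_Var peval_add peval_sum peval_mult
  peval_uminus peval_diff peval_power peval_prod peval_sum_list peval_prod_list peval_of_nat
  peval_of_int peval_numeral

lemma peval_cong: "(\<And>v. v \<in> vars p \<Longrightarrow> f v = g v) \<Longrightarrow> peval h f p = peval h g p"
proof -
  assume fg: "\<And>v. v \<in> vars p \<Longrightarrow> f v = g v"
  have "(\<Prod>v\<in>keys t. f v ^ lookup t v) =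
      (\<Prod>v\<in>keys t. g v ^ lookup t v)" if "t \<in> keys p" for t
  proof (rule prod.cong)
    fix v assume "v \<in> keys t"
    then have "v \<in> vars p" using that by (auto simp: vars_def)
    then show "f v ^ lookup t v = g v ^ lookup t v" by (simp add: fg)
  qed simp
  then show ?thesis by (simp add: peval_def)
qed

end

interpretation pv: coeff_hom "\<lambda>c::complex. c"
  by unfold_locales simp_all

lemma Const_0 [simp]: "Const 0 = 0" and Const_1 [simp]: "Const 1 = 1"
  by (simp_all add: Const_def)

lemma Const_add: "Const (a + b) = Const a + Const b"
  by (simp add: Const_def single_add)

lemma Const_mult: "Const (a * b) = Const a * Const b"
  by (simp add: Const_def mult_single)

interpretation ps: coeff_hom "Const :: complex \<Rightarrow> 'v mpoly"
  by unfold_locales (simp_all add: Const_add Const_mult)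

interpretation pp: coeff_hom "\<lambda>c::complex. [:c:]"
  by unfold_locales simp_all

lemma pvalue_mono_eval: "pvalue x (mono_eval g t) = mono_eval (\<lambda>v. pvalue x (g v)) t"
  by (simp add: mono_eval_def)

lemma pvalue_psubst: "pvalue x (psubst g p) = pvalue (\<lambda>v. pvalue x (g v)) p"
proof -
  have "pvalue x (psubst g p) = (\<Sum>t\<in>keys p. lookup p t * mono_eval (\<lambda>v. pvalue x (g v)) t)"
    by (simp add: ps.peval_superset[of "keys p"] pvalue_mono_eval)
  then show ?thesis
    by (simp add: pv.peval_superset[of "keys p"])
qed

lemma finite_vars [simp]: "finite (vars p)"
  by (simp add: vars_def)

section \<open>Polynomials and polynomial functions\<close>

text \<open>Kronecker substitution: sending the variable \<open>v\<close> to a suitable power of a single unknown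
  separates the monomials of bounded exponents.\<close>

lemma kronecker_weights:
  assumes "finite V"
  shows "\<exists>w :: 'v \<Rightarrow> nat. \<forall>s t. (\<forall>v\<in>V. s v < B \<and> t v < B) \<longrightarrow>
    (\<Sum>v\<in>V. w v * s v) = (\<Sum>v\<in>V. w v * t v) \<longrightarrow> (\<forall>v\<in>V. s v = (t v :: nat))"
  using assms
proof (induction V)
  case empty
  then show ?case by simp
next
  case (insert u V)
  then obtain w where w: "\<forall>s t. (\<forall>v\<in>V. s v < B \<and> t v < B) \<longrightarrow>
    (\<Sum>v\<in>V. w v * s v) = (\<Sum>v\<in>V. w v * t v) \<longrightarrow> (\<forall>v\<in>V. s v = (t v :: nat))" by blast
  \<comment> \<open>Positional notation in base \<open>B\<close>: the new variable is the lowest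
    digit, the old sum holds the others.\<close>
  let ?w = "\<lambda>v. if v = u then 1 else B * w v"
  have sum: "(\<Sum>v\<in>insert u V. ?w v * s v) = s u + B * (\<Sum>v\<in>V. w v * s v)" for s
  proof -
    have "(\<Sum>v\<in>V. ?w v * s v) = (\<Sum>v\<in>V. B * (w v * s v))"
      by (rule sum.cong) (use insert in auto)
    then show ?thesis using insert by (simp add: sum_distrib_left)
  qed
  show ?case
  proof (intro exI[of _ ?w] allI impI)
    fix s t :: "'v \<Rightarrow> nat"
    assume lt: "\<forall>v\<in>insert u V. s v < B \<and> t v < B"
      and eq: "(\<Sum>v\<in>insert u V. ?w v * s v) = (\<Sum>v\<in>insert u V. ?w v * t v)"
    have digits: "a + B * m = b + B * n \<longleftrightarrow> a = b \<and> m = n" if "a < B" "b < B" for a b m n :: nat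
    proof
      assume eq: "a + B * m = b + B * n"
      have "a = (a + B * m) mod B" using that by simp
      also have "\<dots> = b" unfolding eq using that by simp
      finally show "a = b \<and> m = n" using eq that by simp
    qed simp
    have "s u = t u" "(\<Sum>v\<in>V. w v * s v) = (\<Sum>v\<in>V. w v * t v)"
      using eq lt unfolding sum digits[OF lt[THEN bspec, THEN conjunct1] lt[THEN bspec, THEN conjunct2], OF insertI1 insertI1]
      by simp_all
    moreover have "\<forall>v\<in>V. s v < B \<and> t v < B" using lt by blast
    ultimately have "\<forall>v\<in>V. s v = t v"
      by (intro spec[OF spec[OF w, of s], of t, THEN mp, THEN mp])
    then show "\<forall>v\<in>insert u V. s v = t v" using \<open>s u = t u\<close> by blast
  qed
qed

text \<open>Kronecker substitution sends both polynomials to nonzero univariate ones, which have a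
  common non-root. Taking two at a time yields the absence of zero divisors; nonzero coordinates
  allow identities to be tested on a torus only.\<close>

lemma mpoly_nonzero_pair:
  fixes p q :: "'v mpoly"
  assumes "p \<noteq> 0" "q \<noteq> 0"
  shows "\<exists>x. (\<forall>v. x v \<noteq> 0) \<and> pvalue x p \<noteq> 0 \<and> pvalue x q \<noteq> 0"
proof -
  define V where "V = vars p \<union> vars q"
  define T where "T = keys p \<union> keys q"
  define B where "B = Suc (\<Sum>t\<in>T. \<Sum>v\<in>V. lookup t v)"
  have [simp]: "finite V" "finite T" by (simp_all add: V_def T_def)
  have B: "lookup t v < B" if "t \<in> T" "v \<in> V" for t v
  proof -
    have "lookup t v \<le> (\<Sum>v\<in>V. lookup t v)"
      using that by (intro member_le_sum) auto
    also have "\<dots> \<le> (\<Sum>t\<in>T. \<Sum>v\<in>V. lookup t v)"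
      using that by (intro member_le_sum) auto
    finally show ?thesis by (simp add: B_def)
  qed
  obtain w :: "'v \<Rightarrow> nat" where w: "\<forall>s t. (\<forall>v\<in>V. s v < B \<and> t v < B) \<longrightarrow>
    (\<Sum>v\<in>V. w v * s v) = (\<Sum>v\<in>V. w v * t v) \<longrightarrow> (\<forall>v\<in>V. s v = (t v :: nat))"
    using kronecker_weights[OF \<open>finite V\<close>, of B] by blast
  define N where "N t = (\<Sum>v\<in>V. w v * lookup t v)" for t
  have keysV: "keys t \<subseteq> V" if "t \<in> T" for t
    using that by (auto simp: V_def T_def vars_def)
  have inj: "s = t" if "s \<in> T" "t \<in> T" "N s = N t" for s t
  proof (rule poly_mapping_eqI)
    fix v
    show "lookup s v = lookup t v"
    proof (cases "v \<in> V")
      case True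
      have "\<forall>v\<in>V. lookup s v = lookup t v"
        by (rule spec[OF spec[OF w, of "lookup s"], of "lookup t", THEN mp, THEN mp])
           (use B that in \<open>auto simp: N_def\<close>)
      with True show ?thesis by simp
    next
      case False
      then have "v \<notin> keys s" "v \<notin> keys t" using keysV that by blast+
      then show ?thesis by (simp add: in_keys_iff)
    qed
  qed
  define K where "K r = peval (\<lambda>c::complex. [:c:]) (\<lambda>v. monom 1 (w v)) r" for r :: "'v mpoly"
  have mono: "mono_eval (\<lambda>v. monom (1::complex) (w v)) t = monom 1 (N t)" if "t \<in> T" for t
  proof -
    have "(\<Prod>v\<in>W. monom (1::complex) (w v) ^ lookup t v) =
        monom 1 (\<Sum>v\<in>W. w v * lookup t v)" for W
      by (induction W rule: infinite_finite_induct) (simp_all add: monom_power mult_monom monom_0)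
    then show ?thesis
      by (simp add: mono_eval_superset[OF \<open>finite V\<close> keysV[OF that]] N_def)
  qed
  have K: "coeff (K r) (N t) = lookup r t"
    if "keys r \<subseteq> T" "t \<in> T" for r t
  proof -
    have Kr: "K r = (\<Sum>s\<in>T. smult (lookup r s) (monom 1 (N s)))"
      unfolding K_def by (subst pp.peval_superset[OF \<open>finite T\<close> that(1)]) (simp add: mono)
    have "coeff (K r) (N t) = (\<Sum>s\<in>T. if s = t then lookup r s else 0)"
      unfolding Kr coeff_sum using inj that(2) by (intro sum.cong) auto
    then show ?thesis using that(2) by simp
  qed
  have "K p \<noteq> 0"
  proof -
    obtain t where "t \<in> keys p" using assms(1) by fastforce
    then have "coeff (K p) (N t) \<noteq> 0" using K[of p t] by (auto simp: T_def in_keys_iff)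
    then show ?thesis by auto
  qed
  moreover have "K q \<noteq> 0"
  proof -
    obtain t where "t \<in> keys q" using assms(2) by fastforce
    then have "coeff (K q) (N t) \<noteq> 0" using K[of q t] by (auto simp: T_def in_keys_iff)
    then show ?thesis by auto
  qed
  \<comment> \<open>The factor \<open>monom 1 1\<close> excludes the root 0, so that all coordinates
    \<open>z ^ w v\<close> are nonzero.\<close>
  ultimately have "monom 1 1 * K p * K q \<noteq> 0" by (simp add: monom_eq_0_iff)
  then obtain z where "poly (monom 1 1 * K p * K q) z \<noteq> 0"
    using poly_all_0_iff_0 by blast
  then have z: "z \<noteq> 0" "poly (K p) z \<noteq> 0" "poly (K q) z \<noteq> 0" by (auto simp: poly_monom)
  have val: "poly (K r) z = pvalue (\<lambda>v. z ^ w v) r" for r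
    unfolding K_def peval_def by (simp add: poly_sum poly_prod poly_monom)
  show ?thesis
    by (rule exI[of _ "\<lambda>v. z ^ w v"]) (use z val in auto)
qed

lemma mpoly_zeroI:
  assumes "\<And>x. (\<And>v. x v \<noteq> 0) \<Longrightarrow> pvalue x p = 0"
  shows "p = 0"
  using mpoly_nonzero_pair[of p p] assms by blast

text \<open>With \<open>pvalue_psubst\<close> this turns identities of polynomials into identities
  of complex numbers, the form in which most of them are proved below.\<close>

lemma mpoly_eqI:
  assumes "\<And>x. pvalue x p = pvalue x q"
  shows "p = q"
  using mpoly_zeroI[of "p - q"] assms by simp

lemma mpoly_mult_eq_0: "p * q = 0 \<longleftrightarrow> p = 0 \<or> q = (0 :: 'v mpoly)"
proof
  assume "p * q = 0"
  then have "pvalue x p * pvalue x q = 0" for x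
    using pv.peval_mult[of x p q] by simp
  then show "p = 0 \<or> q = 0"
    using mpoly_nonzero_pair[of p q] by fastforce
qed auto

lemma mpoly_mult_cancel: "d \<noteq> 0 \<Longrightarrow> d * p = d * q \<Longrightarrow> p = (q :: 'v mpoly)"
  using mpoly_mult_eq_0[of d "p - q"] by (simp add: right_diff_distrib)

text \<open>After multiplication by \<open>d\<close> both sides agree everywhere, and
  \<open>d\<close> cancels. This licenses computations with denominators.\<close>

lemma mpoly_dense:
  assumes "d \<noteq> 0" "\<And>x. pvalue x d \<noteq> 0 \<Longrightarrow> pvalue x p = pvalue x q"
  shows "p = q"
proof (rule mpoly_mult_cancel[OF assms(1)], rule mpoly_eqI)
  show "pvalue x (d * p) = pvalue x (d * q)" for x
    using assms(2)[of x] by (cases "pvalue x d = 0") auto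
qed

lemma Var_neq_0 [simp]: "Var v \<noteq> 0"
  unfolding Var_def by (metis lookup_single_eq lookup_zero one_neq_zero)

text \<open>Cancellation makes the quotient unique, so exhibiting a cofactor resolves the definite
  description.\<close>

lemma exact_quotient_eq: "d \<noteq> 0 \<Longrightarrow> p = d * r \<Longrightarrow> exact_quotient p d = r"
  unfolding exact_quotient_def by (rule the_equality) (auto dest: mpoly_mult_cancel)

lemma psubst_Var [simp]: "psubst Var p = p"
  by (rule mpoly_eqI) (simp add: pvalue_psubst)

lemma pvalue_cong_polys:
  "p \<in> polys X \<Longrightarrow> (\<And>v. v \<in> X \<Longrightarrow> x v = y v) \<Longrightarrow> pvalue x p = pvalue y p"
  by (rule pv.peval_cong) (auto simp: polys_def)

text \<open>Substituting 0 for the variables outside \<open>X\<close> changes no value, hence not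
  the polynomial; but it removes every monomial with such a variable.\<close>

lemma polysI:
  assumes "\<And>x y. (\<And>v. v \<in> X \<Longrightarrow> x v = y v) \<Longrightarrow> pvalue x p = pvalue y p"
  shows "p \<in> polys X"
proof -
  let ?g = "\<lambda>v. if v \<in> X then Var v else 0"
  have "p = psubst ?g p"
    by (rule mpoly_eqI) (simp add: pvalue_psubst, rule assms, simp)
  also have "\<dots> = (\<Sum>t\<in>keys p. Const (lookup p t) * mono_eval ?g t)"
    by (simp add: ps.peval_superset[of "keys p"])
  also have "\<dots> = (\<Sum>t\<in>{t\<in>keys p. keys t \<subseteq> X}.
      single t (lookup p t))"
  proof (rule sum.mono_neutral_cong_right)
    show "\<forall>t\<in>keys p - {t \<in> keys p. keys t \<subseteq> X}.
       Const (lookup p t) * mono_eval ?g t = 0"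
    proof
      fix t assume t: "t \<in> keys p - {t \<in> keys p. keys t \<subseteq> X}"
      then obtain v where v: "v \<in> keys t" "v \<notin> X" by auto
      then have "?g v ^ lookup t v = 0" by (simp add: in_keys_iff power_0_left)
      then have "mono_eval ?g t = 0" unfolding mono_eval_def
        by (intro prod_zero) (use v in auto)
      then show "Const (lookup p t) * mono_eval ?g t = 0" by simp
    qed
    show "Const (lookup p t) * mono_eval ?g t = single t (lookup p t)"
      if "t \<in> {t \<in> keys p. keys t \<subseteq> X}" for t
    proof -
      have "mono_eval ?g t = mono_eval Var t"
        unfolding mono_eval_def by (rule prod.cong) (use that in auto)
      also have "\<dots> = single t 1"
        using ps.peval_single[of Var t 1] by simp
      finally show ?thesis by (simp add: Const_def mult_single)
    qed
  qed auto
  finally have p: "p = (\<Sum>t\<in>{t\<in>keys p. keys t \<subseteq> X}.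
      single t (lookup p t))" .
  have "keys p \<subseteq> (\<Union>t\<in>{t\<in>keys p. keys t \<subseteq> X}.
      keys (single t (lookup p t)))"
    by (subst p) (rule Poly_Mapping.keys_sum)
  then show ?thesis by (fastforce simp: polys_def vars_def split: if_splits)
qed

lemma polys_iff:
  "p \<in> polys X \<longleftrightarrow> (\<forall>x y. (\<forall>v\<in>X. x v = y v) \<longrightarrow> pvalue x p = pvalue y p)"
  using polysI[of X p] pvalue_cong_polys[of p X] by blast

lemma polys_UNIV [simp]: "p \<in> polys UNIV"
  by (simp add: polys_def)

lemma polys_mono: "p \<in> polys X \<Longrightarrow> X \<subseteq> Y \<Longrightarrow> p \<in> polys Y"
  by (auto simp: polys_def)

lemma polys_keys: "p \<in> polys X \<longleftrightarrow> (\<forall>t\<in>keys p. keys t \<subseteq> X)"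
  by (auto simp: polys_def vars_def)

lemma Var_polys: "Var v \<in> polys X \<longleftrightarrow> v \<in> X"
  by (simp add: polys_keys Var_def)

lemma polys_closed [simp, intro]:
  shows "0 \<in> polys X" "1 \<in> polys X" "Const c \<in> polys X"
    and "numeral k \<in> polys X" "of_int i \<in> polys X" "of_nat m \<in> polys X"
    and "p \<in> polys X \<Longrightarrow> q \<in> polys X \<Longrightarrow> p + q \<in> polys X"
    and "p \<in> polys X \<Longrightarrow> q \<in> polys X \<Longrightarrow> p - q \<in> polys X"
    and "p \<in> polys X \<Longrightarrow> q \<in> polys X \<Longrightarrow> p * q \<in> polys X"
    and "p \<in> polys X \<Longrightarrow> - p \<in> polys X"
    and "p \<in> polys X \<Longrightarrow> p ^ n \<in> polys X"
    and "v \<in> X \<Longrightarrow> Var v \<in> polys X"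
proof -
  have *: "pvalue x p = pvalue y p" if "p \<in> polys X" "\<forall>v\<in>X. x v = y v" for p and x y :: "'a \<Rightarrow> complex"
    using that by (intro pvalue_cong_polys) auto
  show "0 \<in> polys X" "1 \<in> polys X" "Const c \<in> polys X"
    "numeral k \<in> polys X" "of_int i \<in> polys X" "of_nat m \<in> polys X"
    by (simp_all add: polys_iff)
  show "p + q \<in> polys X" "p - q \<in> polys X" "p * q \<in> polys X"
    if "p \<in> polys X" "q \<in> polys X"
    by (simp_all add: polys_iff[of "_ + _"] polys_iff[of "_ - _"] polys_iff[of "_ * _"])
      (metis * that)+
  show "- p \<in> polys X" "p ^ n \<in> polys X" if "p \<in> polys X"
    by (simp_all add: polys_iff[of "- _"] polys_iff[of "_ ^ _"]) (metis * that)+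
  show "Var v \<in> polys X" if "v \<in> X" using that by (simp add: Var_polys)
qed

lemma sum_polys: "(\<And>i. i \<in> I \<Longrightarrow> p i \<in> polys X) \<Longrightarrow> (\<Sum>i\<in>I. p i) \<in> polys X"
  by (induction I rule: infinite_finite_induct) auto

lemma psubst_polys:
  assumes "p \<in> polys X" "\<And>v. v \<in> X \<Longrightarrow> g v \<in> polys Y"
  shows "psubst g p \<in> polys Y"
  using assms by (intro polysI) (auto simp: pvalue_psubst polys_iff)

lemma single_polys: "single t c \<in> polys X \<longleftrightarrow> c = 0 \<or> keys t \<subseteq> X"
  by (auto simp: polys_keys)

lemma pvalue_restrict: "pvalue x (restrict P) = pvalue (x((1, 1) := 0)) P"
  unfolding restrict_def pvalue_psubst
  by (rule arg_cong[where f="\<lambda>f. pvalue f P"]) (auto simp: fun_eq_iff)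

section \<open>The total derivative\<close>

lemma has_field_derivative_mono_eval:
  fixes x y :: "'v \<Rightarrow> complex"
  assumes "finite V" "keys t \<subseteq> V"
  shows "((\<lambda>\<epsilon>. mono_eval (\<lambda>v. x v + \<epsilon> * y v) t) has_field_derivative
    (\<Sum>v\<in>V. y v * (of_nat (lookup t v) * mono_eval x (t - single v 1)))) (at 0)"
proof -
  have *: "((\<lambda>\<epsilon>. \<Prod>v\<in>V. (x v + \<epsilon> * y v) ^ lookup t v) has_field_derivative
     (\<Sum>v\<in>V. (of_nat (lookup t v) * (x v) ^ (lookup t v - 1) * y v)
        * (\<Prod>u\<in>V - {v}. (x u + 0 * y u) ^ lookup t u))) (at 0)"
    by (rule has_field_derivative_prod) (auto intro!: derivative_eq_intros)
  have step: "of_nat (lookup t v) * (x v) ^ (lookup t v - 1) * y v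
        * (\<Prod>u\<in>V - {v}. (x u + 0 * y u) ^ lookup t u)
      = y v * (of_nat (lookup t v) * mono_eval x (t - single v 1))"
    if "v \<in> V" for v
  proof -
    have "keys (t - single v 1) \<subseteq> V"
      using assms by (auto simp: in_keys_iff lookup_minus)
    then have "mono_eval x (t - single v 1) =
        (\<Prod>u\<in>V. x u ^ lookup (t - single v 1) u)"
      using assms(1) by (rule mono_eval_superset[rotated])
    also have "\<dots> = (x v) ^ (lookup t v - 1) * (\<Prod>u\<in>V - {v}. x u ^ lookup t u)"
      using that assms(1) by (subst prod.remove[of _ v]) (auto simp: lookup_minus lookup_single intro!: prod.cong)
    finally show ?thesis by simp
  qed
  have "(\<Sum>v\<in>V. (of_nat (lookup t v) * (x v) ^ (lookup t v - 1) * y v)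
        * (\<Prod>u\<in>V - {v}. (x u + 0 * y u) ^ lookup t u)) =
      (\<Sum>v\<in>V. y v * (of_nat (lookup t v) * mono_eval x (t - single v 1)))"
    by (rule sum.cong[OF refl]) (rule step)
  with * show ?thesis by (simp only: mono_eval_superset[OF assms])
qed

lemma has_field_derivative_pvalue:
  fixes x y :: "'v \<Rightarrow> complex"
  shows "((\<lambda>\<epsilon>. pvalue (\<lambda>v. x v + \<epsilon> * y v) P) has_field_derivative
    (\<Sum>v\<in>vars P. y v * pvalue x (partial_deriv v P))) (at 0)"
proof -
  have "((\<lambda>\<epsilon>. \<Sum>t\<in>keys P. lookup P t * mono_eval (\<lambda>v. x v + \<epsilon> * y v) t)
    has_field_derivative (\<Sum>t\<in>keys P. lookup P t *
      (\<Sum>v\<in>vars P. y v * (of_nat (lookup t v) * mono_eval x (t - single v 1))))) (at 0)"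
    by (intro DERIV_sum DERIV_cmult has_field_derivative_mono_eval) (auto simp: vars_def)
  moreover have "(\<Sum>t\<in>keys P. lookup P t *
      (\<Sum>v\<in>vars P. y v * (of_nat (lookup t v) * mono_eval x (t - single v 1))))
    = (\<Sum>v\<in>vars P. y v * pvalue x (partial_deriv v P))"
    by (simp add: partial_deriv_def pv.peval_single sum_distrib_left)
       (subst sum.swap, simp add: mult_ac)
  ultimately show ?thesis
    by (simp add: pv.peval_superset[of "keys P"])
qed

text \<open>The total derivative at \<open>x\<close> is the directional derivative of
  \<open>P\<close> along the shifted jet \<open>x (k, l + 1)\<close>. It can thus be found with
  \<open>derivative_eq_intros\<close>, without expanding into monomials.\<close>

lemma pvalue_total_deriv:
  assumes "((\<lambda>\<epsilon>. pvalue (\<lambda>(k, l). x (k, l) + \<epsilon> * x (k, l + 1)) P) has_field_derivative D) (at 0)"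
  shows "pvalue x (total_deriv P) = D"
proof -
  have "((\<lambda>\<epsilon>. pvalue (\<lambda>v. x v + \<epsilon> * (case v of (k, l) \<Rightarrow> x (k, l + 1))) P) has_field_derivative
    (\<Sum>v\<in>vars P. (case v of (k, l) \<Rightarrow> x (k, l + 1)) * pvalue x (partial_deriv v P))) (at 0)"
    by (rule has_field_derivative_pvalue)
  also have "(\<lambda>\<epsilon>. pvalue (\<lambda>v. x v + \<epsilon> * (case v of (k, l) \<Rightarrow> x (k, l + 1))) P)
      = (\<lambda>\<epsilon>. pvalue (\<lambda>(k, l). x (k, l) + \<epsilon> * x (k, l + 1)) P)"
    by (intro ext arg_cong[where f="\<lambda>f. pvalue f P"]) auto
  also have "(\<Sum>v\<in>vars P. (case v of (k, l) \<Rightarrow> x (k, l + 1)) * pvalue x (partial_deriv v P))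
      = pvalue x (total_deriv P)"
    by (auto simp: total_deriv_def intro!: sum.cong)
  finally show ?thesis using assms DERIV_unique by blast
qed

section \<open>Explicit formulas for the sixteen bi-invariants\<close>

text \<open>Minors of the matrix of jets, with the orders of derivation as columns. They are defined
  over any commutative ring: at \<open>Var\<close> they are jet polynomials, at a complex point
  their values.\<close>

definition minor2 :: "(nat \<times> nat \<Rightarrow> 'a::comm_ring_1) \<Rightarrow> nat \<Rightarrow> nat \<Rightarrow> nat \<Rightarrow> 'a" where
  "minor2 x i k l = x (1, k) * x (i, l) - x (1, l) * x (i, k)"

definition minor3 :: "(nat \<times> nat \<Rightarrow> 'a::comm_ring_1) \<Rightarrow> nat \<Rightarrow> nat \<Rightarrow> nat \<Rightarrow> 'a" where
  "minor3 x k l m = x (3, k) * minor2 x 2 l m - x (3, l) * minor2 x 2 k m + x (3, m) * minor2 x 2 k l"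

definition minor4 :: "(nat \<times> nat \<Rightarrow> 'a::comm_ring_1) \<Rightarrow> 'a" where
  "minor4 x = x (4, 4) * minor3 x 1 2 3 - x (4, 3) * minor3 x 1 2 4
     + x (4, 2) * minor3 x 1 3 4 - x (4, 1) * minor3 x 2 3 4"

lemma pvalue_minor [simp]:
  "pvalue x (minor2 Var i k l) = minor2 x i k l"
  "pvalue x (minor3 Var k l m) = minor3 x k l m"
  "pvalue x (minor4 Var) = minor4 x"
  by (simp_all add: minor2_def minor3_def minor4_def)

text \<open>Laplace expansion along the last column, with the cofactors again in the form
  \<open>Matrix.mat\<close>, so that rewriting can iterate it.\<close>

lemma det_mat_Suc:
  fixes f :: "nat \<times> nat \<Rightarrow> 'a::comm_ring_1"
  shows "Determinant.det (Matrix.mat (Suc n) (Suc n) f) =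
    (\<Sum>i<Suc n. f (i, n) * ((-1) ^ (i + n) *
       Determinant.det (Matrix.mat n n (\<lambda>(r, c). f (if r < i then r else Suc r, c)))))"
proof -
  let ?A = "Matrix.mat (Suc n) (Suc n) f"
  have "Determinant.det ?A = (\<Sum>i<Suc n. ?A $$ (i, n) * Determinant.cofactor ?A i n)"
    by (rule laplace_expansion_column) auto
  moreover have "mat_delete ?A i n = Matrix.mat n n (\<lambda>(r, c). f (if r < i then r else Suc r, c))"
    if "i < Suc n" for i
    using that by (intro eq_matI) (auto simp: mat_delete_def)
  ultimately show ?thesis
    by (simp add: Determinant.cofactor_def del: sum.lessThan_Suc)
qed

lemma wronskian_3: "wronskian 3 = minor3 Var 1 2 3"
  by (simp add: wronskian_def minor3_def minor2_def numeral_3_eq_3 numeral_2_eq_2 det_mat_Suc algebra_simps)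

lemma wronskian_4: "wronskian 4 = minor4 Var"
  by (simp add: wronskian_def minor4_def minor3_def minor2_def eval_nat_numeral det_mat_Suc)
     (simp add: algebra_simps)

lemma total_deriv_minor2: "pvalue x (total_deriv (minor2 Var i k l)) = minor2 x i (k + 1) l + minor2 x i k (l + 1)"
  by (rule pvalue_total_deriv)
     (auto simp: minor2_def algebra_simps intro!: derivative_eq_intros)

lemma total_deriv_jet: "pvalue x (total_deriv (jet i l)) = x (i, l + 1)"
  by (rule pvalue_total_deriv) (auto intro!: derivative_eq_intros)

lemma pvalue_Lambda3: "pvalue x (Lambda3 i) = minor2 x i 1 2"
  by (simp add: Lambda3_def bracket_def total_deriv_jet minor2_def eval_nat_numeral algebra_simps)

lemma Lambda3_eq: "Lambda3 i = minor2 Var i 1 2"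
  by (rule mpoly_eqI) (simp add: pvalue_Lambda3)

lemma pvalue_Lambda5: "pvalue x (Lambda5 i) = x (1, 1) * minor2 x i 1 3 - 3 * x (1, 2) * minor2 x i 1 2"
  by (simp add: Lambda5_def bracket_def Lambda3_eq total_deriv_minor2 total_deriv_jet)
     (simp add: minor2_def eval_nat_numeral algebra_simps)

lemma Lambda5_eq: "Lambda5 i = jet 1 1 * minor2 Var i 1 3 - 3 * jet 1 2 * minor2 Var i 1 2"
  by (rule mpoly_eqI) (simp add: pvalue_Lambda5)

lemma total_deriv_Lambda5: "pvalue x (total_deriv (Lambda5 i)) =
   x (1, 1) * (minor2 x i 2 3 + minor2 x i 1 4) - 2 * x (1, 2) * minor2 x i 1 3 - 3 * x (1, 3) * minor2 x i 1 2"
  by (rule pvalue_total_deriv)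
     (auto simp: Lambda5_eq minor2_def eval_nat_numeral algebra_simps intro!: derivative_eq_intros)

lemma pvalue_Lambda7: "pvalue x (Lambda7 i) =
   x (1, 1) ^ 2 * (minor2 x i 1 4 + minor2 x i 2 3) - 7 * x (1, 1) * x (1, 2) * minor2 x i 1 3
   - 3 * x (1, 1) * x (1, 3) * minor2 x i 1 2 + 15 * x (1, 2) ^ 2 * minor2 x i 1 2"
  by (simp add: Lambda7_def bracket_def total_deriv_Lambda5 total_deriv_jet pvalue_Lambda5)
     (simp add: eval_nat_numeral algebra_simps)

lemma pvalue_D6: "pvalue x poly_D6 = minor3 x 1 2 3"
  by (simp add: poly_D6_def wronskian_3)

lemma total_deriv_D6: "pvalue x (total_deriv poly_D6) = minor3 x 1 2 4"
  unfolding poly_D6_def wronskian_3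
  by (rule pvalue_total_deriv)
     (auto simp: minor3_def minor2_def eval_nat_numeral algebra_simps
       intro!: derivative_eq_intros)

lemma pvalue_D8: "pvalue x poly_D8 = x (1, 1) * minor3 x 1 2 4 - 6 * x (1, 2) * minor3 x 1 2 3"
  by (simp add: poly_D8_def bracket_def total_deriv_D6 total_deriv_jet pvalue_D6)
     (simp add: eval_nat_numeral algebra_simps)

text \<open>Expansion of a vanishing 3x3 determinant: its rows are the jet of the first function
  taken twice and that of the second. It supplies the factor \<open>x (1, 1)\<close> in the
  numerators that are not visibly divisible by it.\<close>

lemma minor2_plucker:
  "x (1, 1) * minor2 x 2 2 3 = x (1, 2) * minor2 x 2 1 3 - x (1, 3) * minor2 x 2 1 (2 :: nat)"
  by (simp add: minor2_def algebra_simps)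

context
  fixes x :: "nat \<times> nat \<Rightarrow> 'a::comm_ring_1"
begin

text \<open>The quotients by powers of \<open>f\<^sub>1'\<close>, expanded with the help of \<open>minor2_plucker\<close>.\<close>

definition "val_N10 = x (1, 1) ^ 2 * minor3 x 1 3 4 + 4 * x (1, 1) * x (1, 3) * minor3 x 1 2 3
   - 3 * x (1, 1) * x (1, 2) * minor3 x 1 2 4 + 3 * x (1, 2) ^ 2 * minor3 x 1 2 3"

definition "val_M8 = 3 * minor2 x 2 1 2 * (minor2 x 2 1 4 + 4 * minor2 x 2 2 3) - 5 * minor2 x 2 1 3 ^ 2"

definition "val_E10 = 3 * minor2 x 2 1 2 * minor3 x 1 2 4 - 6 * minor2 x 2 1 3 * minor3 x 1 2 3"

definition "val_L12 =
   5 * minor2 x 2 1 2 * (x (1, 1) * minor3 x 1 3 4 + 4 * x (1, 3) * minor3 x 1 2 3 - 3 * x (1, 2) * minor3 x 1 2 4)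
   - (x (1, 1) * (minor2 x 2 1 4 + 4 * minor2 x 2 2 3) - 10 * x (1, 2) * minor2 x 2 1 3) * minor3 x 1 2 3"

text \<open>Q14 and R15 are split into a multiple of \<open>x (1, 1)\<close> and a rest because of
  the later quotients: in the numerators of U17, V19 and X21 the terms without visible factor
  \<open>x (1, 1)\<close> involve only the rests and the \<open>x (1, 2)\<close> terms, and cancel
  up to a multiple of the right side of \<open>minor2_plucker\<close>. This is the origin of the
  summands with 144 and 720.\<close>

definition "val_Q1 = x (1, 1) * (minor2 x 2 1 4 + 4 * minor2 x 2 2 3) * minor3 x 1 2 4
   - 6 * x (1, 2) * (minor2 x 2 1 4 + 4 * minor2 x 2 2 3) * minor3 x 1 2 3
   + 20 * x (1, 2) * minor2 x 2 1 3 * minor3 x 1 2 4 - 10 * x (1, 1) * minor2 x 2 1 3 * minor3 x 1 3 4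
   - 40 * x (1, 3) * minor2 x 2 1 3 * minor3 x 1 2 3 + 30 * x (1, 2) * minor2 x 2 1 2 * minor3 x 1 3 4"

definition "val_Q0 = 30 * x (1, 2) ^ 2 * minor2 x 2 1 3 * minor3 x 1 2 3
   - 75 * x (1, 2) ^ 2 * minor2 x 2 1 2 * minor3 x 1 2 4
   + 120 * x (1, 2) * x (1, 3) * minor2 x 2 1 2 * minor3 x 1 2 3"

definition "val_Q14 = x (1, 1) * val_Q1 + val_Q0"

definition "val_R1 = minor3 x 1 2 4 ^ 2 - 12 * minor3 x 1 2 3 * minor3 x 1 3 4"

definition "val_R0 = 24 * x (1, 2) * minor3 x 1 2 3 * minor3 x 1 2 4 - 48 * x (1, 3) * minor3 x 1 2 3 ^ 2"

definition "val_R15 = x (1, 1) * val_R1 + val_R0"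

definition "val_U17 = 4 * minor3 x 1 2 4 * val_E10 + 3 * minor2 x 2 1 2 * val_R1
   + 144 * minor3 x 1 2 3 ^ 2 * minor2 x 2 2 3"

definition "val_V19 =
   8 * (x (1, 1) * minor3 x 1 3 4 + 4 * x (1, 3) * minor3 x 1 2 3 - 3 * x (1, 2) * minor3 x 1 2 4) * val_E10
   + minor2 x 2 1 3 * val_R15 - 3 * x (1, 2) * minor2 x 2 1 2 * val_R1
   - 144 * x (1, 2) * minor3 x 1 2 3 ^ 2 * minor2 x 2 2 3"

definition "val_X21 = 4 * minor3 x 1 2 4 * val_Q14 - 24 * x (1, 2) * minor3 x 1 2 3 * val_Q1
   - 5 * (x (1, 1) * (minor2 x 2 1 4 + 4 * minor2 x 2 2 3) - 10 * x (1, 2) * minor2 x 2 1 3) * val_R15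
   - 75 * x (1, 2) ^ 2 * minor2 x 2 1 2 * val_R1 - 720 * x (1, 2) ^ 2 * minor3 x 1 2 3 ^ 2 * minor2 x 2 2 3"

end

lemmas val_defs = val_N10_def val_M8_def val_E10_def val_L12_def val_Q1_def val_Q0_def val_Q14_def
  val_R1_def val_R0_def val_R15_def val_U17_def val_V19_def val_X21_def

lemma pvalue_val [simp]:
  "pvalue x (val_N10 Var) = val_N10 x" "pvalue x (val_M8 Var) = val_M8 x"
  "pvalue x (val_E10 Var) = val_E10 x" "pvalue x (val_L12 Var) = val_L12 x"
  "pvalue x (val_Q1 Var) = val_Q1 x" "pvalue x (val_Q0 Var) = val_Q0 x"
  "pvalue x (val_Q14 Var) = val_Q14 x" "pvalue x (val_R1 Var) = val_R1 x"
  "pvalue x (val_R0 Var) = val_R0 x" "pvalue x (val_R15 Var) = val_R15 x"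
  "pvalue x (val_U17 Var) = val_U17 x" "pvalue x (val_V19 Var) = val_V19 x"
  "pvalue x (val_X21 Var) = val_X21 x"
  by (simp_all add: val_defs)

lemma pvalue_Lambda7_2: "pvalue x (Lambda7 2) =
   x (1, 1) ^ 2 * (minor2 x 2 1 4 + 4 * minor2 x 2 2 3) - 10 * x (1, 1) * x (1, 2) * minor2 x 2 1 3
   + 15 * x (1, 2) ^ 2 * minor2 x 2 1 2"
  using arg_cong[OF minor2_plucker[of x], of "\<lambda>t. 3 * x (1, 1) * t"] unfolding pvalue_Lambda7
  by (simp add: algebra_simps power2_eq_square)

lemma poly_N10_eq: "poly_N10 = val_N10 Var"
  unfolding poly_N10_def
proof (rule exact_quotient_eq)
  show "jet 1 1 ^ 2 \<noteq> 0" by (simp add: power2_eq_square mpoly_mult_eq_0)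
  show "Lambda5 2 * Lambda7 3 - Lambda5 3 * Lambda7 2 = (jet 1 1)\<^sup>2 * val_N10 Var"
    by (rule mpoly_eqI) (simp add: pvalue_Lambda5 pvalue_Lambda7,
      simp add: val_N10_def minor3_def minor2_def algebra_simps power2_eq_square)
qed

lemma poly_M8_eq: "poly_M8 = val_M8 Var"
  unfolding poly_M8_def
proof (rule exact_quotient_eq)
  show "jet 1 1 ^ 2 \<noteq> 0" by (simp add: power2_eq_square mpoly_mult_eq_0)
  show "3 * Lambda3 2 * Lambda7 2 - 5 * Lambda5 2 * Lambda5 2 = (jet 1 1)\<^sup>2 * val_M8 Var"
    by (rule mpoly_eqI) (simp add: pvalue_Lambda3 pvalue_Lambda5 pvalue_Lambda7_2, simp add: val_M8_def algebra_simps power2_eq_square)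
qed

lemma quotient_E10: "3 * Lambda3 2 * poly_D8 - 6 * Lambda5 2 * poly_D6 = jet 1 1 * val_E10 Var"
  by (rule mpoly_eqI)
     (simp add: pvalue_Lambda3 pvalue_Lambda5 pvalue_D6 pvalue_D8, simp add: val_E10_def algebra_simps power2_eq_square)

lemma poly_E10_eq: "poly_E10 = val_E10 Var"
  unfolding poly_E10_def by (rule exact_quotient_eq[OF Var_neq_0 quotient_E10])

lemma quotient_L12: "5 * Lambda3 2 * poly_N10 - Lambda7 2 * poly_D6 = jet 1 1 * val_L12 Var"
  by (rule mpoly_eqI)
     (simp add: pvalue_Lambda3 pvalue_Lambda7_2 pvalue_D6 poly_N10_eq, simp add: val_L12_def val_N10_def algebra_simps power2_eq_square)

lemma poly_L12_eq: "poly_L12 = val_L12 Var"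
  unfolding poly_L12_def by (rule exact_quotient_eq[OF Var_neq_0 quotient_L12])

lemma quotient_Q14: "Lambda7 2 * poly_D8 - 10 * Lambda5 2 * poly_N10 = jet 1 1 * val_Q14 Var"
  by (rule mpoly_eqI)
     (simp add: pvalue_Lambda5 pvalue_Lambda7_2 pvalue_D8 poly_N10_eq,
      simp add: val_Q14_def val_Q1_def val_Q0_def val_N10_def algebra_simps power2_eq_square)

lemma poly_Q14_eq: "poly_Q14 = val_Q14 Var"
  unfolding poly_Q14_def by (rule exact_quotient_eq[OF Var_neq_0 quotient_Q14])

lemma quotient_R15: "poly_D8 * poly_D8 - 12 * poly_D6 * poly_N10 = jet 1 1 * val_R15 Var"
  by (rule mpoly_eqI)
     (simp add: pvalue_D6 pvalue_D8 poly_N10_eq,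
      simp add: val_R15_def val_R1_def val_R0_def val_N10_def algebra_simps power2_eq_square)

lemma poly_R15_eq: "poly_R15 = val_R15 Var"
  unfolding poly_R15_def by (rule exact_quotient_eq[OF Var_neq_0 quotient_R15])

lemma quotient_U17: "4 * poly_D8 * poly_E10 + 3 * Lambda3 2 * poly_R15 = jet 1 1 * val_U17 Var"
proof (rule mpoly_eqI)
  fix x :: "nat \<times> nat \<Rightarrow> complex"
  show "pvalue x (4 * poly_D8 * poly_E10 + 3 * Lambda3 2 * poly_R15) = pvalue x (jet 1 1 * val_U17 Var)"
    using arg_cong[OF minor2_plucker[of x], of "\<lambda>t. 144 * minor3 x 1 2 3 ^ 2 * t"]
    by (simp add: pvalue_D8 pvalue_Lambda3 poly_E10_eq poly_R15_eq del: One_nat_def,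
       simp add: val_E10_def val_U17_def val_R15_def val_R1_def val_R0_def algebra_simps power2_eq_square del: One_nat_def)
qed

lemma poly_U17_eq: "poly_U17 = val_U17 Var"
  unfolding poly_U17_def by (rule exact_quotient_eq[OF Var_neq_0 quotient_U17])

lemma quotient_V19: "8 * poly_N10 * poly_E10 + Lambda5 2 * poly_R15 = jet 1 1 * val_V19 Var"
proof (rule mpoly_eqI)
  fix x :: "nat \<times> nat \<Rightarrow> complex"
  show "pvalue x (8 * poly_N10 * poly_E10 + Lambda5 2 * poly_R15) = pvalue x (jet 1 1 * val_V19 Var)"
    using arg_cong[OF minor2_plucker[of x], of "\<lambda>t. 144 * x (1, 2) * minor3 x 1 2 3 ^ 2 * t"]
    by (simp add: pvalue_Lambda5 poly_N10_eq poly_E10_eq poly_R15_eq del: One_nat_def,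
       simp add: val_E10_def val_V19_def val_R15_def val_R1_def val_R0_def val_N10_def algebra_simps power2_eq_square del: One_nat_def)
qed

lemma poly_V19_eq: "poly_V19 = val_V19 Var"
  unfolding poly_V19_def by (rule exact_quotient_eq[OF Var_neq_0 quotient_V19])

lemma quotient_X21: "4 * poly_D8 * poly_Q14 - 5 * Lambda7 2 * poly_R15 = jet 1 1 * val_X21 Var"
proof (rule mpoly_eqI)
  fix x :: "nat \<times> nat \<Rightarrow> complex"
  show "pvalue x (4 * poly_D8 * poly_Q14 - 5 * Lambda7 2 * poly_R15) = pvalue x (jet 1 1 * val_X21 Var)"
    using arg_cong[OF minor2_plucker[of x], of "\<lambda>t. 720 * x (1, 2) ^ 2 * minor3 x 1 2 3 ^ 2 * t"]
    by (simp add: pvalue_D8 pvalue_Lambda7_2 poly_Q14_eq poly_R15_eq del: One_nat_def,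
       simp add: val_X21_def val_Q14_def val_Q1_def val_Q0_def val_R15_def val_R1_def val_R0_def algebra_simps power2_eq_square del: One_nat_def)
qed

lemma poly_X21_eq: "poly_X21 = val_X21 Var"
  unfolding poly_X21_def by (rule exact_quotient_eq[OF Var_neq_0 quotient_X21])

section \<open>Reparametrizations and unipotent transformations of jets\<close>

text \<open>The action of the jet \<open>(p\<^sub>1, p\<^sub>2, p\<^sub>3, p\<^sub>4)\<close> of a reparametrization, by Faa di Bruno's formula.\<close>

definition reparam :: "(nat \<Rightarrow> 'a::comm_ring_1) \<Rightarrow> (nat \<times> nat \<Rightarrow> 'a) \<Rightarrow> nat \<times> nat \<Rightarrow> 'a" where
  "reparam p x = (\<lambda>(i, l).
     if l = 1 then p 1 * x (i, 1)
     else if l = 2 then p 1 ^ 2 * x (i, 2) + p 2 * x (i, 1)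
     else if l = 3 then p 1 ^ 3 * x (i, 3) + 3 * p 1 * p 2 * x (i, 2) + p 3 * x (i, 1)
     else if l = 4 then p 1 ^ 4 * x (i, 4) + 6 * p 1 ^ 2 * p 2 * x (i, 3)
       + (4 * p 1 * p 3 + 3 * p 2 ^ 2) * x (i, 2) + p 4 * x (i, 1)
     else x (i, l))"

definition unipotent :: "(nat \<Rightarrow> nat \<Rightarrow> 'a::comm_ring_1) \<Rightarrow> (nat \<times> nat \<Rightarrow> 'a) \<Rightarrow> nat \<times> nat \<Rightarrow> 'a" where
  "unipotent u x = (\<lambda>(i, l). x (i, l) + (\<Sum>j\<in>{1..<i}. u i j * x (j, l)))"

lemma pvalue_reparam: "pvalue x (reparam (\<lambda>k. Const (p k)) Var v) = reparam p x v"
  by (cases v) (simp add: reparam_def)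

lemma pvalue_unipotent: "pvalue x (unipotent (\<lambda>i j. Const (u i j)) Var v) = unipotent u x v"
  by (cases v) (simp add: unipotent_def)

text \<open>A transformation that scales \<open>f\<^sub>1'\<close> and the numerator
  \<open>N\<close> also scales the quotient: clear where \<open>f\<^sub>1'\<close> is nonzero, and
  elsewhere by \<open>mpoly_dense\<close>. For this the transformation must itself be a polynomial
  substitution \<open>tp\<close>.\<close>

lemma quotient_transport:
  assumes Q: "N = jet 1 1 * Q"
    and tp: "\<And>x v. pvalue x (tp v) = T x v"
    and T1: "\<And>x. T x (1, 1) = a * x (1, 1)" and "a \<noteq> 0"
    and N: "\<And>x. pvalue (T x) N = a * c * pvalue x N"
  shows "pvalue (T x) Q = c * pvalue x Q"
proof -
  have "psubst tp Q = Const c * Q"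
  proof (rule mpoly_dense[of "jet 1 1"])
    fix x assume "pvalue x (jet 1 1) \<noteq> 0"
    then show "pvalue x (psubst tp Q) = pvalue x (Const c * Q)"
      using N[of x] T1[of x] \<open>a \<noteq> 0\<close> by (simp add: pvalue_psubst tp Q)
  qed simp
  then have "pvalue x (psubst tp Q) = pvalue x (Const c * Q)" by simp
  then show ?thesis by (simp add: pvalue_psubst tp)
qed

lemma reparam_simps [simp]:
  "reparam p x (i, 1) = p 1 * x (i, 1)"
  "reparam p x (i, Suc 0) = p 1 * x (i, 1)"
  "reparam p x (i, 2) = p 1 ^ 2 * x (i, 2) + p 2 * x (i, 1)"
  "reparam p x (i, 3) = p 1 ^ 3 * x (i, 3) + 3 * p 1 * p 2 * x (i, 2) + p 3 * x (i, 1)"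
  "reparam p x (i, 4) = p 1 ^ 4 * x (i, 4) + 6 * p 1 ^ 2 * p 2 * x (i, 3)
       + (4 * p 1 * p 3 + 3 * p 2 ^ 2) * x (i, 2) + p 4 * x (i, 1)"
  by (simp_all add: reparam_def)

lemma minor2_reparam:
  "minor2 (reparam p x) i 1 2 = p 1 ^ 3 * minor2 x i 1 2"
  "minor2 (reparam p x) i 1 3 = p 1 ^ 4 * minor2 x i 1 3 + 3 * p 1 ^ 2 * p 2 * minor2 x i 1 2"
  "minor2 (reparam p x) i 1 4 = p 1 ^ 5 * minor2 x i 1 4 + 6 * p 1 ^ 3 * p 2 * minor2 x i 1 3
     + p 1 * (4 * p 1 * p 3 + 3 * p 2 ^ 2) * minor2 x i 1 2"
  "minor2 (reparam p x) i 2 3 = p 1 ^ 5 * minor2 x i 2 3 + p 1 ^ 3 * p 2 * minor2 x i 1 3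
     + (3 * p 1 * p 2 ^ 2 - p 1 ^ 2 * p 3) * minor2 x i 1 2"
  "minor2 (reparam p x) i 2 4 = p 1 ^ 6 * minor2 x i 2 4 + 6 * p 1 ^ 4 * p 2 * minor2 x i 2 3
     + p 1 ^ 4 * p 2 * minor2 x i 1 4 + 6 * p 1 ^ 2 * p 2 ^ 2 * minor2 x i 1 3
     + (p 2 * (4 * p 1 * p 3 + 3 * p 2 ^ 2) - p 1 ^ 2 * p 4) * minor2 x i 1 2"
  "minor2 (reparam p x) i 3 4 = p 1 ^ 7 * minor2 x i 3 4 + 3 * p 1 ^ 5 * p 2 * minor2 x i 2 4
     + p 1 ^ 3 * (15 * p 2 ^ 2 - 4 * p 1 * p 3) * minor2 x i 2 3
     + p 1 ^ 4 * p 3 * minor2 x i 1 4 + (6 * p 1 ^ 2 * p 2 * p 3 - p 1 ^ 3 * p 4) * minor2 x i 1 3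
     + (p 3 * (4 * p 1 * p 3 + 3 * p 2 ^ 2) - 3 * p 1 * p 2 * p 4) * minor2 x i 1 2"
  by (simp_all add: minor2_def power_numeral_reduce algebra_simps)

lemma minor3_reparam:
  "minor3 (reparam p x) 1 2 3 = p 1 ^ 6 * minor3 x 1 2 3"
  "minor3 (reparam p x) 1 2 4 = p 1 ^ 7 * minor3 x 1 2 4 + 6 * p 1 ^ 5 * p 2 * minor3 x 1 2 3"
  "minor3 (reparam p x) 1 3 4 = p 1 ^ 8 * minor3 x 1 3 4 + 3 * p 1 ^ 6 * p 2 * minor3 x 1 2 4
     + (15 * p 1 ^ 4 * p 2 ^ 2 - 4 * p 1 ^ 5 * p 3) * minor3 x 1 2 3"
  "minor3 (reparam p x) 2 3 4 = p 1 ^ 9 * minor3 x 2 3 4 + p 1 ^ 7 * p 2 * minor3 x 1 3 4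
     + p 1 ^ 4 * (3 * p 1 * p 2 ^ 2 - p 1 ^ 2 * p 3) * minor3 x 1 2 4
     + (15 * p 1 ^ 3 * p 2 ^ 3 - 10 * p 1 ^ 4 * p 2 * p 3 + p 1 ^ 5 * p 4) * minor3 x 1 2 3"
  unfolding minor3_def minor2_reparam by (simp_all add: power_numeral_reduce algebra_simps)

lemma minor4_reparam: "minor4 (reparam p x) = p 1 ^ 10 * minor4 x"
  unfolding minor4_def minor3_reparam
  by (simp add: power_numeral_reduce algebra_simps)

lemma unipotent_simps [simp]:
  "unipotent u x (1, l) = x (1, l)"
  "unipotent u x (Suc 0, l) = x (1, l)"
  "unipotent u x (2, l) = x (2, l) + u 2 1 * x (1, l)"
  "unipotent u x (3, l) = x (3, l) + u 3 1 * x (1, l) + u 3 2 * x (2, l)"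
  "unipotent u x (4, l) = x (4, l) + u 4 1 * x (1, l) + u 4 2 * x (2, l) + u 4 3 * x (3, l)"
  by (simp_all add: unipotent_def eval_nat_numeral atLeastLessThanSuc algebra_simps)

lemma minor2_unipotent: "minor2 (unipotent u x) 2 k l = minor2 x 2 k l"
  by (simp add: minor2_def algebra_simps)

lemma minor3_unipotent: "minor3 (unipotent u x) k l m = minor3 x k l m"
  by (simp add: minor3_def minor2_def algebra_simps)

lemma minor4_unipotent: "minor4 (unipotent u x) = minor4 x"
  unfolding minor4_def minor3_unipotent
  by (simp add: minor3_def minor2_def algebra_simps)

lemma val_N10_reparam: "val_N10 (reparam p x) = p 1 ^ 10 * val_N10 x"
  unfolding val_N10_def minor3_reparam
  by (simp add: power_numeral_reduce algebra_simps)

lemma val_M8_reparam: "val_M8 (reparam p x) = p 1 ^ 8 * val_M8 x"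
  unfolding val_M8_def minor2_reparam
  by (simp add: power_numeral_reduce algebra_simps)

lemma pvalue_bi_inv:
  "pvalue x (bi_inv W10) = minor4 x"
  "pvalue x (bi_inv F1) = x (1, 1)"
  "pvalue x (bi_inv L3) = minor2 x 2 1 2"
  "pvalue x (bi_inv L5) = x (1, 1) * minor2 x 2 1 3 - 3 * x (1, 2) * minor2 x 2 1 2"
  "pvalue x (bi_inv L7) = x (1, 1) ^ 2 * (minor2 x 2 1 4 + 4 * minor2 x 2 2 3)
     - 10 * x (1, 1) * x (1, 2) * minor2 x 2 1 3 + 15 * x (1, 2) ^ 2 * minor2 x 2 1 2"
  "pvalue x (bi_inv D6) = minor3 x 1 2 3"
  "pvalue x (bi_inv D8) = x (1, 1) * minor3 x 1 2 4 - 6 * x (1, 2) * minor3 x 1 2 3"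
  "pvalue x (bi_inv N10) = val_N10 x" "pvalue x (bi_inv M8) = val_M8 x"
  "pvalue x (bi_inv E10) = val_E10 x" "pvalue x (bi_inv L12) = val_L12 x"
  "pvalue x (bi_inv Q14) = val_Q14 x" "pvalue x (bi_inv R15) = val_R15 x"
  "pvalue x (bi_inv U17) = val_U17 x" "pvalue x (bi_inv V19) = val_V19 x"
  "pvalue x (bi_inv X21) = val_X21 x"
  by (simp_all add: wronskian_4 pvalue_Lambda3 pvalue_Lambda5 pvalue_Lambda7_2 pvalue_D6 pvalue_D8
      poly_N10_eq poly_M8_eq poly_E10_eq poly_L12_eq poly_Q14_eq poly_R15_eq poly_U17_eq poly_V19_eq poly_X21_eq)

lemma bi_inv_quotients:
  "3 * bi_inv L3 * bi_inv D8 - 6 * bi_inv L5 * bi_inv D6 = jet 1 1 * bi_inv E10"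
  "5 * bi_inv L3 * bi_inv N10 - bi_inv L7 * bi_inv D6 = jet 1 1 * bi_inv L12"
  "bi_inv L7 * bi_inv D8 - 10 * bi_inv L5 * bi_inv N10 = jet 1 1 * bi_inv Q14"
  "bi_inv D8 * bi_inv D8 - 12 * bi_inv D6 * bi_inv N10 = jet 1 1 * bi_inv R15"
  "4 * bi_inv D8 * bi_inv E10 + 3 * bi_inv L3 * bi_inv R15 = jet 1 1 * bi_inv U17"
  "8 * bi_inv N10 * bi_inv E10 + bi_inv L5 * bi_inv R15 = jet 1 1 * bi_inv V19"
  "4 * bi_inv D8 * bi_inv Q14 - 5 * bi_inv L7 * bi_inv R15 = jet 1 1 * bi_inv X21"
  using quotient_E10 quotient_L12 quotient_Q14 quotient_R15 quotient_U17 quotient_V19 quotient_X21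
  by (simp_all add: poly_E10_eq poly_L12_eq poly_Q14_eq poly_R15_eq poly_U17_eq poly_V19_eq poly_X21_eq)

text \<open>Nine generators are treated by their explicit formulas. The other seven inherit the law
  from their numerators by \<open>quotient_transport\<close>, in the order in which they are
  built.\<close>

lemma bi_inv_reparam:
  assumes p: "p 1 \<noteq> 0"
  shows "pvalue (reparam p x) (bi_inv v) = p 1 ^ weight v * pvalue x (bi_inv v)"
proof -
  note transport = quotient_transport[where T="reparam p" and a="p 1", OF _ pvalue_reparam _ p]
  have base: "pvalue (reparam p x) (bi_inv v) = p 1 ^ weight v * pvalue x (bi_inv v)"
    if "v \<in> {W10, F1, L3, L5, L7, D6, D8, N10, M8}" for v and x
  proof -
    have "minor2 (reparam p x) 2 1 2 = p 1 ^ 3 * minor2 x 2 1 2"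
      "x (1, 1) * minor2 x 2 2 3 = x (1, 2) * minor2 x 2 1 3 - x (1, 3) * minor2 x 2 1 2"
      by (rule minor2_reparam, rule minor2_plucker)
    have *: "pvalue (reparam p x) (bi_inv L5) = p 1 ^ 5 * pvalue x (bi_inv L5)"
      unfolding pvalue_bi_inv minor2_reparam by (simp add: power_numeral_reduce algebra_simps)
    have "pvalue (reparam p x) (bi_inv L7) = p 1 ^ 7 * pvalue x (bi_inv L7)"
      using arg_cong[OF minor2_plucker[of x], of "\<lambda>t. 4 * p 1 ^ 5 * p 2 * x (1, 1) * t"]
      unfolding pvalue_bi_inv minor2_reparam by (simp add: power_numeral_reduce algebra_simps)
    moreover have "pvalue (reparam p x) (bi_inv D8) = p 1 ^ 8 * pvalue x (bi_inv D8)"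
      unfolding pvalue_bi_inv minor3_reparam by (simp add: power_numeral_reduce algebra_simps)
    ultimately show ?thesis using that *
      by (auto simp: pvalue_bi_inv(1-3,6,8,9) minor2_reparam minor3_reparam minor4_reparam val_N10_reparam val_M8_reparam
          simp del: One_nat_def bi_inv.simps)
  qed
  have E: "pvalue (reparam p x) (bi_inv E10) = p 1 ^ 10 * pvalue x (bi_inv E10)" for x
    by (rule transport[OF bi_inv_quotients(1)]) (simp_all add: base power_numeral_reduce algebra_simps del: bi_inv.simps)
  have L: "pvalue (reparam p x) (bi_inv L12) = p 1 ^ 12 * pvalue x (bi_inv L12)" for x
    by (rule transport[OF bi_inv_quotients(2)]) (simp_all add: base power_numeral_reduce algebra_simps del: bi_inv.simps)
  have Q: "pvalue (reparam p x) (bi_inv Q14) = p 1 ^ 14 * pvalue x (bi_inv Q14)" for x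
    by (rule transport[OF bi_inv_quotients(3)]) (simp_all add: base power_numeral_reduce algebra_simps del: bi_inv.simps)
  have R: "pvalue (reparam p x) (bi_inv R15) = p 1 ^ 15 * pvalue x (bi_inv R15)" for x
    by (rule transport[OF bi_inv_quotients(4)]) (simp_all add: base power_numeral_reduce algebra_simps del: bi_inv.simps)
  have U: "pvalue (reparam p x) (bi_inv U17) = p 1 ^ 17 * pvalue x (bi_inv U17)" for x
    by (rule transport[OF bi_inv_quotients(5)]) (simp_all add: base E R power_numeral_reduce algebra_simps del: bi_inv.simps)
  have V: "pvalue (reparam p x) (bi_inv V19) = p 1 ^ 19 * pvalue x (bi_inv V19)" for x
    by (rule transport[OF bi_inv_quotients(6)]) (simp_all add: base E R power_numeral_reduce algebra_simps del: bi_inv.simps)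
  have X: "pvalue (reparam p x) (bi_inv X21) = p 1 ^ 21 * pvalue x (bi_inv X21)" for x
    by (rule transport[OF bi_inv_quotients(7)]) (simp_all add: base Q R power_numeral_reduce algebra_simps del: bi_inv.simps)
  show ?thesis
    by (cases v) (simp_all add: base E L Q R U V X del: bi_inv.simps)
qed

lemma bi_inv_unipotent: "pvalue (unipotent u x) (bi_inv v) = pvalue x (bi_inv v)"
  by (cases v) (simp_all add: pvalue_bi_inv val_defs minor2_unipotent minor3_unipotent minor4_unipotent del: bi_inv.simps)

lemma bi_inv_jet_ring: "bi_inv v \<in> jet_ring 4"
  unfolding jet_ring_def
  by (rule polysI, cases v) (simp_all add: pvalue_bi_inv val_defs minor2_def minor3_def minor4_def del: bi_inv.simps)

lemma bi_inv_jet_ring_3: "v \<noteq> W10 \<Longrightarrow> bi_inv v \<in> jet_ring 3"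
  unfolding jet_ring_def
  by (rule polysI, cases v) (simp_all add: pvalue_bi_inv val_defs minor2_def minor3_def del: bi_inv.simps)

section \<open>Germs, their 4-jets, and the pointwise form of invariance\<close>

lemma faa_di_bruno_4:
  fixes f \<phi> :: "complex \<Rightarrow> complex"
  assumes f: "f holomorphic_on B" "open B" and \<phi>: "\<phi> holomorphic_on A" "open A" "\<phi> ` A \<subseteq> B"
    and z: "z \<in> A" and l: "l \<in> {1..4}"
  shows "(deriv ^^ l) (f \<circ> \<phi>) z =
    reparam (\<lambda>k. (deriv ^^ k) \<phi> z) (\<lambda>(i, l). (deriv ^^ l) f (\<phi> z)) (i, l)"
proof -
  define F where "F k = (deriv ^^ k) f" for k
  define P where "P k = (deriv ^^ k) \<phi>" for k
  define H where "H k = (deriv ^^ k) (f \<circ> \<phi>)" for k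
  have dP: "(P k has_field_derivative P (Suc k) w) (at w)" if "w \<in> A" for k w
    using holomorphic_higher_deriv[OF \<phi>(1,2), of k] \<phi>(2) that
    by (simp add: P_def holomorphic_derivI)
  have dF: "(F k has_field_derivative F (Suc k) w) (at w)" if "w \<in> B" for k w
    using holomorphic_higher_deriv[OF f, of k] f(2) that
    by (simp add: F_def holomorphic_derivI)
  have dFP: "((\<lambda>w. F k (\<phi> w)) has_field_derivative F (Suc k) (\<phi> w) * P 1 w) (at w)" if "w \<in> A" for k w
  proof (rule DERIV_chain2[where f="F k" and g=\<phi>])
    show "(F k has_field_derivative F (Suc k) (\<phi> w)) (at (\<phi> w))" using \<phi>(3) that by (intro dF) auto
    show "(\<phi> has_field_derivative P 1 w) (at w)" using dP[OF that, of 0] by (simp add: P_def)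
  qed
  have step: "H (Suc k) w = D"
    if "\<And>u. u \<in> A \<Longrightarrow> H k u = G u" "(G has_field_derivative D) (at w)" "w \<in> A" for k G D w
  proof -
    have "(H k has_field_derivative D) (at w)"
      by (rule has_field_derivative_transform_within_open[OF that(2) \<phi>(2) that(3)]) (simp add: that(1))
    then show ?thesis by (simp add: H_def DERIV_imp_deriv)
  qed
  have H1: "H (Suc 0) w = F 1 (\<phi> w) * P 1 w" if "w \<in> A" for w
    by (rule step[OF _ _ that, of 0 "\<lambda>w. F 0 (\<phi> w)"]) (use dFP[OF that, of 0] in \<open>simp_all add: H_def F_def\<close>)
  have H2: "H (Suc (Suc 0)) w = F 2 (\<phi> w) * P 1 w ^ 2 + F 1 (\<phi> w) * P 2 w" if "w \<in> A" for w
    by (rule step[OF H1 _ that], assumption)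
       (use that in \<open>auto intro!: derivative_eq_intros dFP dP simp: eval_nat_numeral algebra_simps\<close>)
  have H3: "H (Suc (Suc (Suc 0))) w = F 3 (\<phi> w) * P 1 w ^ 3 + 3 * F 2 (\<phi> w) * P 1 w * P 2 w + F 1 (\<phi> w) * P 3 w"
    if "w \<in> A" for w
    by (rule step[OF H2 _ that], assumption)
       (use that in \<open>auto intro!: derivative_eq_intros dFP dP simp: eval_nat_numeral algebra_simps\<close>)
  have H4: "H (Suc (Suc (Suc (Suc 0)))) w = F 4 (\<phi> w) * P 1 w ^ 4 + 6 * F 3 (\<phi> w) * P 1 w ^ 2 * P 2 w
     + F 2 (\<phi> w) * (4 * P 1 w * P 3 w + 3 * P 2 w ^ 2) + F 1 (\<phi> w) * P 4 w" if "w \<in> A" for w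
    by (rule step[OF H3 _ that], assumption)
       (use that in \<open>auto intro!: derivative_eq_intros dFP dP simp: eval_nat_numeral algebra_simps\<close>)
  have "l = 1 \<or> l = 2 \<or> l = 3 \<or> l = 4" using l by auto
  moreover have "H l z = reparam (\<lambda>k. P k z) (\<lambda>(i, l). F l (\<phi> z)) (i, l)"
    if "l = 1 \<or> l = 2 \<or> l = 3 \<or> l = 4"
    using that H1[OF z] H2[OF z] H3[OF z] H4[OF z]
    by (elim disjE) (simp_all add: reparam_def eval_nat_numeral algebra_simps)
  ultimately show ?thesis by (simp add: H_def F_def P_def)
qed

lemma deriv_poly: "deriv (poly q) = poly (pderiv q)" for q :: "complex poly"
  by (rule ext) (rule DERIV_imp_deriv[OF poly_DERIV])

lemma higher_deriv_poly: "(deriv ^^ k) (poly q) = poly ((pderiv ^^ k) q)" for q :: "complex poly"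
  by (induction k) (simp_all add: deriv_poly)

text \<open>Taylor polynomial with prescribed derivatives. The constant term is 0, so that it can
  also serve as a change of the coordinate that fixes the origin.\<close>

definition jet_germ :: "(nat \<Rightarrow> complex) \<Rightarrow> complex poly" where
  "jet_germ c = [:0, c 1, c 2 / 2, c 3 / 6, c 4 / 24:]"

lemma higher_deriv_jet_germ: "l \<in> {1..4} \<Longrightarrow> (deriv ^^ l) (poly (jet_germ c)) 0 = c l"
proof -
  assume "l \<in> {1..4}"
  then have "l = 1 \<or> l = 2 \<or> l = 3 \<or> l = 4" by auto
  then show ?thesis
    unfolding higher_deriv_poly
    by (elim disjE) (simp_all add: jet_germ_def eval_nat_numeral pderiv_pCons)
qed

lemma local_biholomorphism_jet_germ:
  assumes "p 1 \<noteq> 0"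
  shows "local_biholomorphism (poly (jet_germ p))"
proof -
  let ?f = "poly (jet_germ p)"
  have hol: "?f holomorphic_on UNIV" by (intro holomorphic_intros)
  have d0: "deriv ?f 0 \<noteq> 0" using higher_deriv_jet_germ[of 1 p] assms by simp
  have f0: "?f 0 = 0" by (simp add: jet_germ_def)
  obtain r where r: "r > 0" "inj_on ?f (ball 0 r)"
    using has_complex_derivative_locally_injective[OF hol _ _ d0] by auto
  have hol_ball: "?f holomorphic_on ball 0 r" using hol by (rule holomorphic_on_subset) simp
  obtain \<psi> where \<psi>: "\<psi> holomorphic_on ?f ` ball 0 r"
    "\<And>z. z \<in> ball 0 r \<Longrightarrow> deriv ?f z * deriv \<psi> (?f z) = 1" "\<And>z. z \<in> ball 0 r \<Longrightarrow> \<psi> (?f z) = z"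
    by (rule holomorphic_has_inverse[OF hol_ball open_ball r(2)]) (rule that)
  have op: "open (?f ` ball 0 r)" using open_mapping_thm3[OF hol_ball _ r(2)] by simp
  have in0: "0 \<in> ?f ` ball 0 r" using r(1) f0 by (metis centre_in_ball image_eqI)
  have an: "\<psi> analytic_on {0}"
    using \<psi>(1) op in0 analytic_at by blast
  have "\<forall>\<^sub>F z in nhds 0. \<psi> (?f z) = z"
    using \<psi>(3) r(1) by (auto simp: eventually_nhds intro!: exI[of _ "ball 0 r"])
  moreover have "\<forall>\<^sub>F z in nhds 0. ?f (\<psi> z) = z"
    using \<psi>(3) op in0 by (auto simp: eventually_nhds intro!: exI[of _ "?f ` ball 0 r"])
  moreover have "\<psi> 0 = 0" using \<psi>(3)[of 0] r(1) f0 by simp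
  moreover have "?f analytic_on {0}" using hol by (simp add: analytic_on_holomorphic) (use hol in blast)
  ultimately show ?thesis using an f0 unfolding local_biholomorphism_def by blast
qed

text \<open>Every pair of jets is realized by polynomial germs, and the germ identity is read at 0.
  Conversely the law for jets is applied at each point near 0, with the derivatives of
  \<open>\<phi>\<close> there as parameters.\<close>

lemma reparam_invariant_iff:
  assumes P: "P \<in> jet_ring n"
  shows "reparam_invariant n m P \<longleftrightarrow>
    (\<forall>p x. p 1 \<noteq> 0 \<longrightarrow> pvalue (reparam p x) P = p 1 ^ m * pvalue x P)"
proof (intro iffI allI impI)
  fix p :: "nat \<Rightarrow> complex" and x :: "nat \<times> nat \<Rightarrow> complex"
  assume inv: "reparam_invariant n m P" and p: "p 1 \<noteq> 0"
  define f where "f i = poly (jet_germ (\<lambda>l. x (i, l)))" for i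
  define \<phi> where "\<phi> = poly (jet_germ p)"
  have hol: "f i holomorphic_on UNIV" "\<phi> holomorphic_on UNIV" for i
    unfolding f_def \<phi>_def by (intro holomorphic_intros)+
  have an: "f i analytic_on {0}" for i
    using hol(1)[of i] by (simp add: analytic_on_holomorphic) (use hol(1) in blast)
  have \<phi>0: "\<phi> 0 = 0" by (simp add: \<phi>_def jet_germ_def)
  have d\<phi>: "(deriv ^^ l) \<phi> 0 = p l" if "l \<in> {1..4}" for l
    unfolding \<phi>_def by (rule higher_deriv_jet_germ[OF that])
  have df: "(deriv ^^ l) (f i) 0 = x (i, l)" if "l \<in> {1..4}" for i l
    unfolding f_def by (rule higher_deriv_jet_germ[OF that])
  have "\<forall>\<^sub>F z in nhds 0. pvalue (jet_at (\<lambda>i. f i \<circ> \<phi>) z) P = deriv \<phi> z ^ m * pvalue (jet_at f (\<phi> z)) P"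
    using inv an local_biholomorphism_jet_germ[of p, OF p] unfolding reparam_invariant_def \<phi>_def by blast
  then have "pvalue (jet_at (\<lambda>i. f i \<circ> \<phi>) 0) P = deriv \<phi> 0 ^ m * pvalue (jet_at f (\<phi> 0)) P"
    by (rule eventually_nhds_x_imp_x)
  moreover have "pvalue (jet_at (\<lambda>i. f i \<circ> \<phi>) 0) P = pvalue (reparam p x) P"
  proof (rule pvalue_cong_polys[OF P[unfolded jet_ring_def]])
    fix v :: "nat \<times> nat" assume "v \<in> {1..n} \<times> {1..4}"
    then obtain i l where v: "v = (i, l)" "l \<in> {1..4}" by auto
    have "(deriv ^^ l) (f i \<circ> \<phi>) 0 =
        reparam (\<lambda>k. (deriv ^^ k) \<phi> 0) (\<lambda>(i', l). (deriv ^^ l) (f i) (\<phi> 0)) (i, l)"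
      by (rule faa_di_bruno_4[OF hol(1) _ hol(2)]) (use v in auto)
    also have "\<dots> = reparam p x (i, l)"
      using v(2) d\<phi>[of 1] df[of 1] by (auto simp: reparam_def d\<phi> df \<phi>0)
    finally show "jet_at (\<lambda>i. f i \<circ> \<phi>) 0 v = reparam p x v" by (simp add: v jet_at_def)
  qed
  moreover have "pvalue (jet_at f (\<phi> 0)) P = pvalue x P"
    by (rule pvalue_cong_polys[OF P[unfolded jet_ring_def]]) (auto simp: jet_at_def \<phi>0 df)
  moreover have "deriv \<phi> 0 = p 1" using d\<phi>[of 1] by simp
  ultimately show "pvalue (reparam p x) P = p 1 ^ m * pvalue x P" by simp
next
  assume inv: "\<forall>p x. p 1 \<noteq> 0 \<longrightarrow> pvalue (reparam p x) P = p 1 ^ m * pvalue x P"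
  show "reparam_invariant n m P"
    unfolding reparam_invariant_def
  proof (intro allI impI)
    fix f :: "nat \<Rightarrow> complex \<Rightarrow> complex" and \<phi> :: "complex \<Rightarrow> complex"
    assume "(\<forall>i\<in>{1..n}. f i analytic_on {0}) \<and> local_biholomorphism \<phi>"
    then have an: "\<And>i. i \<in> {1..n} \<Longrightarrow> f i analytic_on {0}" and \<phi>an: "\<phi> analytic_on {0}" and \<phi>0: "\<phi> 0 = 0"
      by (auto simp: local_biholomorphism_def)
    obtain \<psi> where \<psi>an: "\<psi> analytic_on {0}" and \<psi>: "\<forall>\<^sub>F z in nhds 0. \<psi> (\<phi> z) = z"
      using \<open>_ \<and> local_biholomorphism \<phi>\<close> unfolding local_biholomorphism_def by blast
    have "\<exists>S. open S \<and> 0 \<in> S \<and> f i holomorphic_on S" if "i \<in> {1..n}" for i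
      using an[OF that] by (auto simp: analytic_at)
    then obtain S where S: "\<And>i. i \<in> {1..n} \<Longrightarrow> open (S i) \<and> 0 \<in> S i \<and> f i holomorphic_on S i"
      by metis
    obtain T where T: "open T" "0 \<in> T" "\<psi> holomorphic_on T" using \<psi>an by (auto simp: analytic_at)
    define B where "B = T \<inter> (\<Inter>i\<in>{1..n}. S i)"
    have B: "open B" "0 \<in> B" unfolding B_def using S T by (auto intro!: open_Int open_INT)
    have fB: "f i holomorphic_on B" if "i \<in> {1..n}" for i
      using S[OF that] by (rule holomorphic_on_subset[OF conjunct2[OF conjunct2]]) (use that in \<open>auto simp: B_def\<close>)
    have \<psi>B: "\<psi> holomorphic_on B" using T(3) by (rule holomorphic_on_subset) (auto simp: B_def)
    obtain A0 where A0: "open A0" "0 \<in> A0" "\<phi> holomorphic_on A0" using \<phi>an by (auto simp: analytic_at)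
    obtain A1 where A1: "open A1" "0 \<in> A1" "\<And>z. z \<in> A1 \<Longrightarrow> \<psi> (\<phi> z) = z"
      using \<psi> by (auto simp: eventually_nhds)
    define A where "A = (A0 \<inter> \<phi> -` B) \<inter> A1"
    have "open A" unfolding A_def
      by (intro open_Int continuous_open_preimage holomorphic_on_imp_continuous_on A0 A1 B)
    have A: "0 \<in> A" "\<phi> ` A \<subseteq> B" "\<phi> holomorphic_on A"
      using A0 A1 B \<phi>0 by (auto simp: A_def intro: holomorphic_on_subset)
    have eq: "pvalue (jet_at (\<lambda>i. f i \<circ> \<phi>) z) P = deriv \<phi> z ^ m * pvalue (jet_at f (\<phi> z)) P" if z: "z \<in> A" for z
    proof -
      \<comment> \<open>Differentiating \<open>\<psi> (\<phi> z) = z\<close> shows that the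
        derivative of \<open>\<phi>\<close> does not vanish on \<open>A\<close>, as the law for jets
        requires.\<close>
      have "(\<phi> has_field_derivative deriv \<phi> z) (at z)"
        by (rule holomorphic_derivI[OF A(3) \<open>open A\<close> z])
      moreover have "(\<psi> has_field_derivative deriv \<psi> (\<phi> z)) (at (\<phi> z))"
        by (rule holomorphic_derivI[OF \<psi>B B(1)]) (use A(2) z in auto)
      ultimately have "((\<lambda>z. \<psi> (\<phi> z)) has_field_derivative deriv \<psi> (\<phi> z) * deriv \<phi> z) (at z)"
        by (rule DERIV_chain2[rotated])
      then have "((\<lambda>z. z) has_field_derivative deriv \<psi> (\<phi> z) * deriv \<phi> z) (at z)"
        by (rule has_field_derivative_transform_within_open[OF _ \<open>open A\<close> z]) (auto simp: A_def A1(3))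
      then have "deriv \<psi> (\<phi> z) * deriv \<phi> z = 1" using DERIV_ident DERIV_unique by blast
      then have nz: "deriv \<phi> z \<noteq> 0" by auto
      define p where "p k = (deriv ^^ k) \<phi> z" for k
      have "pvalue (jet_at (\<lambda>i. f i \<circ> \<phi>) z) P = pvalue (reparam p (jet_at f (\<phi> z))) P"
      proof (rule pvalue_cong_polys[OF P[unfolded jet_ring_def]])
        fix v :: "nat \<times> nat" assume "v \<in> {1..n} \<times> {1..4}"
        then obtain i l where v: "v = (i, l)" "i \<in> {1..n}" "l \<in> {1..4}" by auto
        have "(deriv ^^ l) (f i \<circ> \<phi>) z =
            reparam (\<lambda>k. (deriv ^^ k) \<phi> z) (\<lambda>(i', l). (deriv ^^ l) (f i) (\<phi> z)) (i, l)"
          by (rule faa_di_bruno_4[OF fB[OF v(2)] B(1) A(3) \<open>open A\<close> A(2) z v(3)])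
        also have "\<dots> = reparam p (jet_at f (\<phi> z)) (i, l)"
          by (simp add: reparam_def p_def jet_at_def)
        finally show "jet_at (\<lambda>i. f i \<circ> \<phi>) z v = reparam p (jet_at f (\<phi> z)) v" by (simp add: v jet_at_def)
      qed
      also have "\<dots> = p 1 ^ m * pvalue (jet_at f (\<phi> z)) P" using inv nz by (simp add: p_def)
      finally show ?thesis by (simp add: p_def)
    qed
    show "\<forall>\<^sub>F z in nhds 0. pvalue (jet_at (\<lambda>i. f i \<circ> \<phi>) z) P = deriv \<phi> z ^ m * pvalue (jet_at f (\<phi> z)) P"
      using eq \<open>open A\<close> A(1) by (auto simp: eventually_nhds)
  qed
qed

lemma unipotent_invariant_iff:
  "unipotent_invariant P \<longleftrightarrow> (\<forall>u x. pvalue (unipotent u x) P = pvalue x P)"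
proof -
  have "psubst (\<lambda>(i, l). jet i l + (\<Sum>j\<in>{1..<i}. Const (u i j) * jet j l)) P = P
    \<longleftrightarrow> (\<forall>x. pvalue (unipotent u x) P = pvalue x P)" for u
  proof -
    have *: "(\<lambda>(i, l). jet i l + (\<Sum>j\<in>{1..<i}. Const (u i j) * jet j l)) = unipotent (\<lambda>i j. Const (u i j)) Var"
      by (simp add: unipotent_def)
    have val: "pvalue x (psubst (unipotent (\<lambda>i j. Const (u i j)) Var) P) = pvalue (unipotent u x) P" for x
      by (simp add: pvalue_psubst pvalue_unipotent)
    show ?thesis unfolding *
      using mpoly_eqI[of "psubst (unipotent (\<lambda>i j. Const (u i j)) Var) P" P] val by metis
  qed
  then show ?thesis by (simp add: unipotent_invariant_def)
qed

lemma bi_invariants_iff: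
  "P \<in> bi_invariants n m \<longleftrightarrow> P \<in> jet_ring n \<and>
    (\<forall>p x. p 1 \<noteq> 0 \<longrightarrow> pvalue (reparam p x) P = p 1 ^ m * pvalue x P) \<and>
    (\<forall>u x. pvalue (unipotent u x) P = pvalue x P)"
  using reparam_invariant_iff[of P n m] unipotent_invariant_iff[of P]
  by (auto simp: bi_invariants_def)

lemma bi_inv_in_bi_invariants: "bi_inv v \<in> bi_invariants 4 (weight v)"
  by (simp add: bi_invariants_iff bi_inv_jet_ring bi_inv_reparam bi_inv_unipotent del: One_nat_def)

section \<open>Normal forms and division by a coordinate\<close>

text \<open>One notion for all gradings: \<open>weight\<close>, the total degree
  (\<open>w = (\<lambda>_. 1)\<close>), \<open>reduction_weight\<close> and the torus degrees
  \<open>degrees i\<close>.\<close>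

definition monom_weight :: "('v \<Rightarrow> nat) \<Rightarrow> 'v Defs.monom \<Rightarrow> nat" where
  "monom_weight w t = (\<Sum>v\<in>keys t. w v * lookup t v)"

lemma monom_weight_superset:
  assumes "finite S" "keys t \<subseteq> S"
  shows "monom_weight w t = (\<Sum>v\<in>S. w v * lookup t v)"
  unfolding monom_weight_def
  by (rule sum.mono_neutral_left) (use assms in \<open>auto simp: in_keys_iff\<close>)

lemma monom_weight_add: "monom_weight w (s + t) = monom_weight w s + monom_weight w t"
proof -
  let ?S = "keys s \<union> keys t"
  have "keys (s + t) \<subseteq> ?S" by (rule Poly_Mapping.keys_add)
  then show ?thesis
    by (simp add: monom_weight_superset[of ?S] lookup_add algebra_simps sum.distrib)
qed

lemma monom_weight_0 [simp]: "monom_weight w 0 = 0"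
  by (simp add: monom_weight_def)

lemma monom_weight_single [simp]: "monom_weight w (single v n) = w v * n"
  by (cases "n = 0") (simp_all add: monom_weight_def)

lemma keys_monom_add:
  "keys (s + t :: 'v Defs.monom) = keys s \<union> keys t"
  by (auto simp: in_keys_iff lookup_add)

lemma keys_Const_mult: "keys (Const c * p) \<subseteq> keys p"
  using Poly_Mapping.keys_mult[of "Const c" p] by (auto simp: Const_def split: if_splits)

lemma single_eq_mono_eval: "single t 1 = mono_eval Var t"
  using ps.peval_single[of Var t 1] by simp

lemma single_conv_Const: "single t c = Const c * single t 1"
  by (simp add: Const_def mult_single)

lemma psubst_conv_sum:
  "psubst g p = (\<Sum>t\<in>keys p. Const (lookup p t) * psubst g (single t 1))"
  by (simp add: ps.peval_superset[of "keys p"] ps.peval_single)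

lemma pvalue_conv_sum:
  "pvalue x p = (\<Sum>t\<in>keys p. lookup p t * mono_eval x t)"
  by (simp add: pv.peval_superset[of "keys p"])

text \<open>Remainder, and below it quotient, of the division by the variable
  \<open>d\<close>.\<close>

definition free_part :: "'v \<Rightarrow> 'v mpoly \<Rightarrow> 'v mpoly" where
  "free_part d p = (\<Sum>t\<in>{t\<in>keys p. lookup t d = 0}. single t (lookup p t))"

definition quotient_part :: "'v \<Rightarrow> 'v mpoly \<Rightarrow> 'v mpoly" where
  "quotient_part d p = (\<Sum>t\<in>{t\<in>keys p. lookup t d > 0}.
     single (t - single d 1) (lookup p t))"

lemma split_variable: "p = free_part d p + Var d * quotient_part d p"
proof -
  let ?m = "\<lambda>t. single t (lookup p t)"
  have *: "Var d * single (t - single d 1) c = single t c"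
    if "lookup t d > 0" for t c
  proof -
    have "single d 1 + (t - single d 1) = t"
      by (rule poly_mapping_eqI) (use that in \<open>auto simp: lookup_add lookup_minus lookup_single when_def\<close>)
    then show ?thesis by (simp add: Var_def mult_single)
  qed
  have "keys p = {t\<in>keys p. lookup t d = 0} \<union> {t\<in>keys p. lookup t d > 0}"
    by auto
  then have "p = (\<Sum>t\<in>{t\<in>keys p. lookup t d = 0} \<union> {t\<in>keys p. lookup t d > 0}. ?m t)"
    using mpoly_sum_monomials[of p] by simp
  also have "\<dots> = free_part d p + (\<Sum>t\<in>{t\<in>keys p. lookup t d > 0}. ?m t)"
    unfolding free_part_def by (rule sum.union_disjoint) auto
  also have "(\<Sum>t\<in>{t\<in>keys p. lookup t d > 0}. ?m t) = Var d * quotient_part d p"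
    unfolding quotient_part_def sum_distrib_left by (rule sum.cong) (simp_all add: * flip: One_nat_def)
  finally show ?thesis .
qed

lemma keys_free_part: "keys (free_part d p) \<subseteq> {t\<in>keys p. lookup t d = 0}"
  using Poly_Mapping.keys_sum[of "\<lambda>t. single t (lookup p t)" "{t\<in>keys p. lookup t d = 0}"]
  by (force simp: free_part_def split: if_splits)

lemma keys_quotient_part: "keys (quotient_part d p) \<subseteq>
   (\<lambda>t. t - single d 1) ` {t\<in>keys p. lookup t d > 0}"
  using Poly_Mapping.keys_sum[of "\<lambda>t. single (t - single d 1) (lookup p t)" "{t\<in>keys p. lookup t d > 0}"]
  by (force simp: quotient_part_def split: if_splits)

lemma lookup_sum_single:
  "finite S \<Longrightarrow> lookup (\<Sum>i\<in>S. single (E i) (c i)) e = (\<Sum>i\<in>{i\<in>S. E i = e}. c i)"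
  by (auto simp: lookup_sum lookup_single when_def sum.inter_filter intro!: sum.cong)

text \<open>Different indices may carry the same exponent, hence the sum over a fibre of
  \<open>E\<close>. Testing on the torus is enough by \<open>mpoly_zeroI\<close>.\<close>

lemma monomial_functions_independent:
  fixes E :: "'i \<Rightarrow> 'v Defs.monom" and c :: "'i \<Rightarrow> complex"
  assumes "finite S" "\<And>x. (\<And>v. x v \<noteq> 0) \<Longrightarrow> (\<Sum>i\<in>S. c i * mono_eval x (E i)) = 0"
  shows "(\<Sum>i\<in>{i\<in>S. E i = e}. c i) = 0"
proof -
  have "(\<Sum>i\<in>S. single (E i) (c i)) = 0"
    by (rule mpoly_zeroI) (simp add: pv.peval_single assms)
  then show ?thesis using lookup_sum_single[OF assms(1), of E c e] by simp
qed

text \<open>Rewriting of monomials in formal generators: a rule replaces \<open>l\<close> by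
  \<open>r\<close>, correctly after substitution of \<open>g\<close>. The weight \<open>w\<close>
  ensures termination. The preorder \<open>R\<close> only records what survives along a chain of
  reductions; it is trivial for the two auxiliary systems and \<open>gen_order\<close> for the
  bi-invariants.\<close>

locale normal_form =
  fixes g :: "'v \<Rightarrow> 'w mpoly" and X :: "'v set"
    and rules :: "('v Defs.monom \<times> 'v mpoly) set"
    and w :: "'v \<Rightarrow> nat"
    and R :: "'v Defs.monom \<Rightarrow> 'v Defs.monom \<Rightarrow> bool"
  assumes rule_eq: "(l, r) \<in> rules \<Longrightarrow> psubst g (single l 1) = psubst g r"
    and rule_polys: "(l, r) \<in> rules \<Longrightarrow> r \<in> polys X"
    and rule_decreasing: "(l, r) \<in> rules \<Longrightarrow> s \<in> keys r \<Longrightarrow> monom_weight w s < monom_weight w l"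
    and R_refl: "R t t"
    and R_trans: "R s t \<Longrightarrow> R t u \<Longrightarrow> R s u"
    and R_rule: "(l, r) \<in> rules \<Longrightarrow> s \<in> keys r \<Longrightarrow> R (l + \<gamma>) (s + \<gamma>)"
begin

definition normal :: "'v Defs.monom \<Rightarrow> bool" where
  "normal t \<longleftrightarrow> keys t \<subseteq> X \<and> \<not> (\<exists>(l, r)\<in>rules. \<exists>\<gamma>. t = l + \<gamma>)"

text \<open>Induction on \<open>w\<close>. Only existence is claimed: no confluence is checked,
  since uniqueness will come from linear independence.\<close>

lemma reduce_monomial:
  assumes "keys t \<subseteq> X"
  shows "\<exists>N. keys N \<subseteq> {s. normal s \<and> R t s} \<and> psubst g N = psubst g (single t 1)"
  using assms
proof (induction t rule: measure_induct_rule[of "monom_weight w"])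
  case (less t)
  show ?case
  proof (cases "normal t")
    case True
    then show ?thesis by (intro exI[of _ "single t 1"]) (auto simp: R_refl)
  next
    case False
    then obtain l r \<gamma> where lr: "(l, r) \<in> rules" "t = l + \<gamma>" using less.prems by (auto simp: normal_def)
    have ex: "\<exists>N. keys N \<subseteq> {u. normal u \<and> R (s + \<gamma>) u} \<and> psubst g N = psubst g (single (s + \<gamma>) 1)"
      if s: "s \<in> keys r" for s
    proof (rule less.IH)
      show "monom_weight w (s + \<gamma>) < monom_weight w t"
        using rule_decreasing[OF lr(1) s] by (simp add: lr(2) monom_weight_add)
      show "keys (s + \<gamma>) \<subseteq> X"
        using rule_polys[OF lr(1)] s less.prems by (auto simp: lr(2) keys_monom_add polys_keys)
    qed
    obtain M where M': "\<forall>s\<in>keys r. keys (M s) \<subseteq> {u. normal u \<and> R (s + \<gamma>) u} \<and>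
        psubst g (M s) = psubst g (single (s + \<gamma>) 1)"
      by (rule exE[OF bchoice[OF ballI[OF ex]]])
    note M = conjunct1[OF bspec[OF M']] conjunct2[OF bspec[OF M']]
    let ?N = "\<Sum>s\<in>keys r. Const (lookup r s) * M s"
    have "psubst g ?N = (\<Sum>s\<in>keys r. Const (lookup r s) *
        psubst g (single s 1 * single \<gamma> 1))"
      by (simp add: M(2) mult_single del: ps.peval_mult) (simp add: M(2))
    also have "\<dots> = psubst g r * psubst g (single \<gamma> 1)"
      by (subst psubst_conv_sum[of g r]) (simp add: sum_distrib_right mult.assoc)
    also have "\<dots> = psubst g (single t 1)"
      by (simp add: rule_eq[OF lr(1), symmetric] lr(2) ps.peval_single mono_eval_add)
    finally have eq: "psubst g ?N = psubst g (single t 1)" .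
    have "keys ?N \<subseteq> {u. normal u \<and> R t u}"
    proof
      fix u assume "u \<in> keys ?N"
      from subsetD[OF Poly_Mapping.keys_sum this]
      obtain s where s: "s \<in> keys r" "u \<in> keys (Const (lookup r s) * M s)"
        by blast
      have "u \<in> {u. normal u \<and> R (s + \<gamma>) u}"
        by (rule subsetD[OF M(1)[OF s(1)] subsetD[OF keys_Const_mult s(2)]])
      then have u: "normal u" "R (s + \<gamma>) u" by simp_all
      then show "u \<in> {u. normal u \<and> R t u}"
        using R_trans[OF R_rule[OF lr(1) s(1)]] lr(2) by simp
    qed
    with eq show ?thesis by blast
  qed
qed

lemma reduce:
  assumes "p \<in> polys X"
  shows "\<exists>N. keys N \<subseteq> {s. normal s \<and> (\<exists>t\<in>keys p. R t s)} \<and> psubst g N = psubst g p"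
proof -
  have ex: "\<exists>N. keys N \<subseteq> {s. normal s \<and> R t s} \<and> psubst g N = psubst g (single t 1)"
    if "t \<in> keys p" for t
    by (rule reduce_monomial) (use assms that in \<open>auto simp: polys_keys\<close>)
  obtain M where M': "\<forall>t\<in>keys p. keys (M t) \<subseteq> {s. normal s \<and> R t s} \<and>
      psubst g (M t) = psubst g (single t 1)"
    by (rule exE[OF bchoice[OF ballI[OF ex]]])
  note M = conjunct1[OF bspec[OF M']] conjunct2[OF bspec[OF M']]
  let ?N = "\<Sum>t\<in>keys p. Const (lookup p t) * M t"
  have "psubst g ?N = psubst g p"
    by (subst psubst_conv_sum[of g p]) (simp add: M(2))
  moreover have "keys ?N \<subseteq> {s. normal s \<and> (\<exists>t\<in>keys p. R t s)}"
  proof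
    fix u assume "u \<in> keys ?N"
    from subsetD[OF Poly_Mapping.keys_sum this]
    obtain t where t: "t \<in> keys p" "u \<in> keys (Const (lookup p t) * M t)"
      by blast
    have "u \<in> {s. normal s \<and> R t s}"
      by (rule subsetD[OF M(1)[OF t(1)] subsetD[OF keys_Const_mult t(2)]])
    then show "u \<in> {s. normal s \<and> (\<exists>t\<in>keys p. R t s)}"
      using t(1) by auto
  qed
  ultimately show ?thesis by blast
qed

end

text \<open>The generator \<open>d\<close> is a jet coordinate \<open>w\<^sub>0\<close>. The
  essential hypothesis is that normal monomials without \<open>d\<close> remain linearly independent
  on the hyperplane where this coordinate is 0. It gives both uniqueness of normal forms and
  division by the coordinate inside the algebra.\<close>

locale normal_division = normal_form +
  fixes d and w\<^sub>0
  assumes d_in: "d \<in> X" and g_d: "g d = Var w\<^sub>0"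
    and d_rule: "(l, r) \<in> rules \<Longrightarrow> lookup l d = 0"
    and restricted_independent: "keys N \<subseteq> {t. normal t \<and> lookup t d = 0} \<Longrightarrow>
      (\<And>x. x w\<^sub>0 = 0 \<Longrightarrow> pvalue x (psubst g N) = 0) \<Longrightarrow> N = 0"
begin

lemma normal_quotient:
  assumes "normal t" "lookup t d > 0"
  shows "normal (t - single d 1)"
proof -
  have t: "t = (t - single d 1) + single d 1"
    by (rule poly_mapping_eqI) (use assms(2) in \<open>auto simp: lookup_add lookup_minus lookup_single when_def\<close>)
  have "keys (t - single d 1) \<subseteq> keys t"
    by (auto simp: in_keys_iff lookup_minus)
  moreover have False if "(l, r) \<in> rules" "t - single d 1 = l + \<gamma>" for l r \<gamma>
  proof -
    have "t = l + (\<gamma> + single d 1)"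
      by (subst t) (simp only: that(2) add.assoc)
    then show False using assms(1) that(1) unfolding normal_def by blast
  qed
  ultimately show ?thesis using assms(1) unfolding normal_def by blast
qed

text \<open>On the hyperplane the multiple of \<open>d\<close> disappears, so the restriction sees
  only the free part, which independence then kills.\<close>

lemma free_part_vanishes:
  assumes "keys N \<subseteq> {t. normal t}" "\<And>x. x w\<^sub>0 = 0 \<Longrightarrow> pvalue x (psubst g N) = 0"
  shows "N = Var d * quotient_part d N"
proof -
  have "free_part d N = 0"
  proof (rule restricted_independent)
    show "keys (free_part d N) \<subseteq> {t. normal t \<and> lookup t d = 0}"
      using keys_free_part[of d N] assms(1) by auto
    fix x assume x: "x w\<^sub>0 = (0::complex)"
    have "pvalue x (psubst g N) = pvalue x (psubst g (free_part d N))"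
      by (subst split_variable[of N d]) (simp add: g_d x)
    then show "pvalue x (psubst g (free_part d N)) = 0" using assms(2)[of x, OF x] by simp
  qed
  then show ?thesis using split_variable[of N d] by simp
qed

lemma normal_quotient_part:
  assumes "keys N \<subseteq> {t. normal t}"
  shows "keys (quotient_part d N) \<subseteq> {t. normal t}"
  using keys_quotient_part[of d N] normal_quotient assms by blast

text \<open>A relation between normal monomials is a multiple of \<open>d\<close> by
  \<open>free_part_vanishes\<close>; the factor cancels in the jet ring and the quotient is again
  normal. Induction on a bound for the exponent of \<open>d\<close>.\<close>

lemma normal_unique:
  assumes "keys N \<subseteq> {t. normal t}" "psubst g N = 0"
  shows "N = 0"
proof -
  have "N = 0" if "keys N \<subseteq> {t. normal t}" "psubst g N = 0"
    "\<forall>t\<in>keys N. lookup t d < n" for n N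
    using that
  proof (induction n arbitrary: N)
    case 0
    then have "keys N = {}" by auto
    then show ?case by (metis poly_mapping_eqI lookup_zero in_keys_iff empty_iff)
  next
    case (Suc n)
    have N: "N = Var d * quotient_part d N"
      by (rule free_part_vanishes) (use Suc.prems in auto)
    then have "Var w\<^sub>0 * psubst g (quotient_part d N) = 0"
      using Suc.prems(2) by (metis ps.peval_mult ps.peval_Var g_d)
    then have "psubst g (quotient_part d N) = 0" by (simp add: mpoly_mult_eq_0)
    moreover have "\<forall>t\<in>keys (quotient_part d N). lookup t d < n"
    proof
      fix t assume "t \<in> keys (quotient_part d N)"
      then obtain s where s: "s \<in> keys N" "lookup s d > 0" "t = s - single d 1"
        using keys_quotient_part[of d N] by blast
      then have "lookup s d < Suc n" using Suc.prems(3) by blast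
      then show "lookup t d < n" using s(2,3) by (simp add: lookup_minus)
    qed
    ultimately have "quotient_part d N = 0"
      using Suc.IH normal_quotient_part[OF Suc.prems(1)] by blast
    then show ?case using N by simp
  qed
  moreover have "\<forall>t\<in>keys N. lookup t d < Suc (\<Sum>t\<in>keys N. lookup t d)"
    by (auto simp: less_Suc_eq_le intro!: member_le_sum)
  ultimately show ?thesis using assms by blast
qed

lemma normal_eq:
  assumes "keys M \<subseteq> {t. normal t}" "keys N \<subseteq> {t. normal t}"
    "psubst g M = psubst g N"
  shows "M = N"
proof -
  have "keys (M - N) \<subseteq> {t. normal t}"
    using Poly_Mapping.keys_diff[of M N] assms(1,2) by blast
  then have "M - N = 0" by (rule normal_unique) (simp add: assms(3))
  then show ?thesis by simp
qed

text \<open>The normal form of \<open>S\<close> vanishes on the hyperplane, hence is visibly a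
  multiple of \<open>Var d\<close>.\<close>

lemma divide:
  assumes "Var w\<^sub>0 * Q = psubst g S" "S \<in> polys X"
  shows "\<exists>T\<in>polys X. Q = psubst g T"
proof -
  obtain N where N: "keys N \<subseteq> {t. normal t}" "psubst g N = psubst g S"
    using reduce[OF assms(2)] by blast
  have NQ: "N = Var d * quotient_part d N"
    by (rule free_part_vanishes[OF N(1)]) (simp add: N(2) flip: assms(1))
  have "Var w\<^sub>0 * Q = Var w\<^sub>0 * psubst g (quotient_part d N)"
    using assms(1) N(2) NQ by (metis ps.peval_mult ps.peval_Var g_d)
  then have "Q = psubst g (quotient_part d N)" by (rule mpoly_mult_cancel[OF Var_neq_0])
  moreover have "quotient_part d N \<in> polys X"
    using normal_quotient_part[OF N(1)] by (auto simp: polys_keys normal_def)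
  ultimately show ?thesis by blast
qed

lemma divide_power:
  assumes "Var w\<^sub>0 ^ k * Q = psubst g S" "S \<in> polys X"
  shows "\<exists>T\<in>polys X. Q = psubst g T"
  using assms
proof (induction k arbitrary: S)
  case 0
  then show ?case by auto
next
  case (Suc k)
  then obtain T where "T \<in> polys X" "Var w\<^sub>0 ^ k * Q = psubst g T"
    using divide[of "Var w\<^sub>0 ^ k * Q" S] by (auto simp: mult.assoc)
  then show ?case using Suc.IH by blast
qed

end

text \<open>Functions that enter the algebra after multiplication by some power of
  \<open>\<delta>\<close> form a ring, because \<open>\<delta>\<close> itself is in the algebra. So
  only the coordinates \<open>G x v\<close> have to be examined.\<close>

lemma clear_denominators:
  fixes g :: "'v \<Rightarrow> 'w mpoly" and G :: "('w \<Rightarrow> complex) \<Rightarrow> 'u \<Rightarrow> complex"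
  assumes \<delta>: "\<delta> = psubst g q\<^sub>0" "q\<^sub>0 \<in> polys X"
    and G: "\<And>v. v \<in> vars p \<Longrightarrow> \<exists>k. \<exists>q\<in>polys X. \<forall>x. pvalue x \<delta> \<noteq> 0 \<longrightarrow> pvalue x \<delta> ^ k * G x v = pvalue x (psubst g q)"
  shows "\<exists>k. \<exists>q\<in>polys X. \<forall>x. pvalue x \<delta> \<noteq> 0 \<longrightarrow> pvalue x \<delta> ^ k * pvalue (G x) p = pvalue x (psubst g q)"
proof -
  define good where "good F \<longleftrightarrow> (\<exists>k. \<exists>q\<in>polys X. \<forall>x. pvalue x \<delta> \<noteq> 0 \<longrightarrow> pvalue x \<delta> ^ k * F x = pvalue x (psubst g q))"
    for F :: "('w \<Rightarrow> complex) \<Rightarrow> complex"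
  have const: "good (\<lambda>x. c)" for c
    unfolding good_def by (intro exI[of _ 0] bexI[of _ "Const c"]) auto
  have mult: "good (\<lambda>x. F x * F' x)" if F: "good F" and F': "good F'" for F F'
  proof -
    from F obtain k q where q: "q \<in> polys X" "\<forall>x. pvalue x \<delta> \<noteq> 0 \<longrightarrow> pvalue x \<delta> ^ k * F x = pvalue x (psubst g q)"
      unfolding good_def by blast
    from F' obtain k' q' where q': "q' \<in> polys X" "\<forall>x. pvalue x \<delta> \<noteq> 0 \<longrightarrow> pvalue x \<delta> ^ k' * F' x = pvalue x (psubst g q')"
      unfolding good_def by blast
    have "pvalue x \<delta> ^ (k + k') * (F x * F' x) = pvalue x (psubst g (q * q'))" if "pvalue x \<delta> \<noteq> 0" for x
    proof -
      have "pvalue x \<delta> ^ (k + k') * (F x * F' x) = (pvalue x \<delta> ^ k * F x) * (pvalue x \<delta> ^ k' * F' x)"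
        by (simp add: power_add mult_ac)
      then show ?thesis using q(2) q'(2) that by simp
    qed
    then show ?thesis unfolding good_def using q(1) q'(1) by blast
  qed
  have add: "good (\<lambda>x. F x + F' x)" if F: "good F" and F': "good F'" for F F'
  proof -
    from F obtain k q where q: "q \<in> polys X" "\<forall>x. pvalue x \<delta> \<noteq> 0 \<longrightarrow> pvalue x \<delta> ^ k * F x = pvalue x (psubst g q)"
      unfolding good_def by blast
    from F' obtain k' q' where q': "q' \<in> polys X" "\<forall>x. pvalue x \<delta> \<noteq> 0 \<longrightarrow> pvalue x \<delta> ^ k' * F' x = pvalue x (psubst g q')"
      unfolding good_def by blast
    have "pvalue x \<delta> ^ (k + k') * (F x + F' x) = pvalue x (psubst g (q\<^sub>0 ^ k' * q + q\<^sub>0 ^ k * q'))" if "pvalue x \<delta> \<noteq> 0" for x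
    proof -
      have "pvalue x \<delta> ^ (k + k') * (F x + F' x) =
          pvalue x \<delta> ^ k' * (pvalue x \<delta> ^ k * F x) + pvalue x \<delta> ^ k * (pvalue x \<delta> ^ k' * F' x)"
        by (simp add: power_add algebra_simps)
      then show ?thesis using q(2) q'(2) that by (simp add: \<delta>(1))
    qed
    moreover have "q\<^sub>0 ^ k' * q + q\<^sub>0 ^ k * q' \<in> polys X" using q(1) q'(1) \<delta>(2) by auto
    ultimately show ?thesis unfolding good_def by blast
  qed
  have power: "good (\<lambda>x. F x ^ n)" if "good F" for F n
    by (induction n) (simp_all add: const mult that)
  have prod: "good (\<lambda>x. \<Prod>i\<in>I. F i x)" if "\<And>i. i \<in> I \<Longrightarrow> good (F i)" for I :: "'u set" and F
    using that by (induction I rule: infinite_finite_induct) (simp_all add: const mult)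
  have sum: "good (\<lambda>x. \<Sum>i\<in>I. F i x)" if "\<And>i. i \<in> I \<Longrightarrow> good (F i)" for I :: "'u Defs.monom set" and F
    using that by (induction I rule: infinite_finite_induct) (simp_all add: const add)
  have "good (\<lambda>x. G x v)" if "v \<in> vars p" for v
    using G[OF that] unfolding good_def .
  then have "good (\<lambda>x. pvalue (G x) p)"
    unfolding peval_def by (intro sum mult const prod power) (auto simp: vars_def)
  then show ?thesis unfolding good_def .
qed

section \<open>Bi-invariants as Laurent polynomials in \<open>f\<^sub>1'\<close>\<close>

text \<open>\<open>section2\<close> consists of the coordinates which survive after \<open>f\<^sub>1'', f\<^sub>1''', f\<^sub>1''''\<close> and
  \<open>f\<^sub>2', f\<^sub>3', f\<^sub>4'\<close> have been normalized to \<open>0\<close>, and in \<open>section1\<close> also \<open>f\<^sub>3''\<close> and \<open>f\<^sub>4''\<close> vanish.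
  The polynomials \<open>gen1\<close> and \<open>gen2\<close> generate the invariants of the remaining unipotent transformations.\<close>

definition section1 :: "(nat \<times> nat) set" where
  "section1 = {(1, 1), (2, 2), (2, 3), (2, 4), (3, 3), (3, 4), (4, 3), (4, 4)}"

definition section2 :: "(nat \<times> nat) set" where
  "section2 = {(1, 1), (2, 2), (2, 3), (2, 4), (3, 2), (3, 3), (3, 4), (4, 2), (4, 3), (4, 4)}"

definition zero_outside :: "'v set \<Rightarrow> ('v \<Rightarrow> 'a::zero) \<Rightarrow> 'v \<Rightarrow> 'a" where
  "zero_outside K x v = (if v \<in> K then x v else 0)"

lemma pvalue_zero_outside: "pvalue x (psubst (zero_outside K Var) P) = pvalue (zero_outside K x) P"
  unfolding pvalue_psubst
  by (rule arg_cong[where f="\<lambda>f. pvalue f P"]) (auto simp: zero_outside_def fun_eq_iff)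

fun gen1 :: "nat \<Rightarrow> jet_poly" where
  "gen1 v = (if v = 0 then jet 1 1 else if v = 1 then jet 2 2 else if v = 2 then jet 2 3
     else if v = 3 then jet 2 4 else if v = 4 then jet 3 3 else if v = 5 then jet 3 4
     else if v = 6 then jet 3 3 * jet 4 4 - jet 3 4 * jet 4 3 else 0)"

fun gen2 :: "nat \<Rightarrow> jet_poly" where
  "gen2 v = (if v = 0 then jet 1 1 else if v = 1 then jet 2 2 else if v = 2 then jet 2 3
     else if v = 3 then jet 2 4
     else if v = 4 then jet 2 2 * jet 3 3 - jet 2 3 * jet 3 2
     else if v = 5 then jet 2 2 * jet 3 4 - jet 2 4 * jet 3 2
     else if v = 6 then jet 2 3 * jet 3 4 - jet 2 4 * jet 3 3
     else if v = 7 then jet 4 4 * (jet 2 2 * jet 3 3 - jet 2 3 * jet 3 2)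
       - jet 4 3 * (jet 2 2 * jet 3 4 - jet 2 4 * jet 3 2)
       + jet 4 2 * (jet 2 3 * jet 3 4 - jet 2 4 * jet 3 3)
     else 0)"

declare gen1.simps [simp del] gen2.simps [simp del]

interpretation nf1: normal_form gen1 "{..6}" "{}" "\<lambda>_. 0" "\<lambda>_ _. True"
  by unfold_locales auto

text \<open>For \<open>jet 3 3 = 0\<close> the generator 6 becomes
  \<open>- jet 3 4 * jet 4 3\<close>. Hence nonzero values of the generators other than 4 can be
  prescribed freely by solving for \<open>jet 4 3\<close>: no relation remains.\<close>

interpretation div1: normal_division gen1 "{..6}" "{}" "\<lambda>_. 0" "\<lambda>_ _. True" 4 "(3, 3)"
proof (unfold_locales, goal_cases)
  case (4 N)
  show ?case
  proof (rule mpoly_zeroI)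
    fix y :: "nat \<Rightarrow> complex" assume y: "\<And>v. y v \<noteq> 0"
    define x where "x = (\<lambda>_ :: nat \<times> nat. 0 :: complex)((1,1) := y 0, (2,2) := y 1, (2,3) := y 2, (2,4) := y 3,
      (3,4) := y 5, (4,3) := - y 6 / y 5)"
    have "N \<in> polys ({..6} - {4})"
      using 4(1) unfolding polys_keys nf1.normal_def by (auto simp: in_keys_iff)
    then have "pvalue x (psubst gen1 N) = pvalue y N"
      unfolding pvalue_psubst
    proof (rule pvalue_cong_polys)
      fix v :: nat assume "v \<in> {..6} - {4}"
      then have "v \<in> {0, 1, 2, 3, 5, 6}" by auto
      then show "pvalue x (gen1 v) = y v" using y by (auto simp: gen1.simps x_def)
    qed
    moreover have "x (3, 3) = 0" by (simp add: x_def)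
    ultimately show "pvalue y N = 0" using 4(2)[of x] by simp
  qed
qed (auto simp: gen1.simps)

text \<open>The relation comes from a 3x3 determinant with the row of the second function taken
  twice. The left side avoids generator 1, the coordinate to be divided by, and the weight counts
  generator 5, which the rule removes.\<close>

definition plucker_rules :: "(nat Defs.monom \<times> nat mpoly) set" where
  "plucker_rules = {(single 2 1 + single 5 1, Var 3 * Var 4 + Var 1 * Var 6)}"

lemma keys_plucker: "keys (Var 3 * Var 4 + Var 1 * Var (6::nat)) \<subseteq>
   {single 3 1 + single 4 1, single 1 1 + single 6 1}"
proof -
  have "keys (Var i * Var j) = {single i 1 + single j 1}" for i j :: nat
    by (simp add: Var_def mult_single)
  then show ?thesis using Poly_Mapping.keys_add[of "Var 3 * Var 4" "Var 1 * Var (6::nat)"] by auto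
qed

interpretation nf2: normal_form gen2 "{..7}" plucker_rules "\<lambda>v. if v = 5 then 1 else 0" "\<lambda>_ _. True"
proof (unfold_locales, goal_cases)
  case (1 l r)
  have "psubst gen2 (single l 1) = psubst gen2 r"
    by (rule mpoly_eqI) (use 1 in \<open>simp add: plucker_rules_def ps.peval_single mono_eval_add gen2.simps algebra_simps\<close>)
  then show ?case .
next
  case (2 l r)
  then show ?case by (auto simp: plucker_rules_def)
next
  case (3 l r s)
  then have "s \<in> keys (Var 3 * Var 4 + Var 1 * Var (6::nat))" by (simp add: plucker_rules_def)
  with keys_plucker 3 show ?case by (auto simp: plucker_rules_def monom_weight_add)
qed auto

text \<open>At the points used, with \<open>jet 2 2 = 0\<close>, the generators 2, 3, 4, 5 become
  \<open>y 2\<close>, \<open>y 3\<close>, \<open>y 2 * y 4\<close>, \<open>y 3 * y 4\<close>: a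
  Segre quadric, whose relation says that 2 times 5 is 3 times 4. Forbidding 2 together with 5 makes
  the exponent map \<open>E\<close> injective on normal monomials.\<close>

interpretation div2: normal_division gen2 "{..7}" plucker_rules "\<lambda>v. if v = 5 then 1 else 0" "\<lambda>_ _. True" 1 "(2, 2)"
proof (unfold_locales, goal_cases)
  case (4 N)
  define E where "E t = single 0 (lookup t 0)
      + single 2 (lookup t 2 + lookup t 4)
      + single 3 (lookup t 3 + lookup t 5)
      + single 4 (lookup t 4 + lookup t 5)
      + single 6 (lookup t 6) + single (7::nat) (lookup t (7::nat))"
    for t :: "nat Defs.monom"
  have N: "keys t \<subseteq> {..7}" "lookup t 1 = 0"
    "lookup t 2 = 0 \<or> lookup t 5 = 0" if "t \<in> keys N" for t
  proof -
    have t: "nf2.normal t" "lookup t 1 = 0" using 4(1) that by auto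
    then show "keys t \<subseteq> {..7}" "lookup t 1 = 0" by (auto simp: nf2.normal_def)
    show "lookup t 2 = 0 \<or> lookup t 5 = 0"
    proof (rule ccontr)
      assume "\<not> ?thesis"
      then have "t = (single 2 1 + single 5 1) +
          (t - (single 2 1 + single 5 1))"
        by (intro poly_mapping_eqI) (auto simp: lookup_add lookup_minus lookup_single when_def)
      moreover have "(single 2 1 + single 5 1, Var 3 * Var 4 + Var 1 * Var 6) \<in> plucker_rules"
        by (simp add: plucker_rules_def)
      ultimately show False using t(1) unfolding nf2.normal_def by blast
    qed
  qed
  have inj: "s = t" if st: "s \<in> keys N" "t \<in> keys N" "E s = E t" for s t
  proof (rule poly_mapping_eqI)
    fix v
    have "lookup (E s) i = lookup (E t) i" for i using st(3) by simp
    from this[of 0] this[of 2] this[of 3] this[of 4] this[of 6] this[of 7]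
    have *: "lookup s 0 = lookup t 0"
      "lookup s 2 + lookup s 4 = lookup t 2 + lookup t 4"
      "lookup s 3 + lookup s 5 = lookup t 3 + lookup t 5"
      "lookup s 4 + lookup s 5 = lookup t 4 + lookup t 5"
      "lookup s 6 = lookup t 6" "lookup s 7 = lookup t 7"
      by (simp_all add: E_def lookup_add lookup_single when_def)
    show "lookup s v = lookup t v"
    proof (cases "v \<in> {..7}")
      case False
      then have "v \<notin> keys s" "v \<notin> keys t" using N(1) st by blast+
      then show ?thesis by (simp add: in_keys_iff)
    next
      case True
      then have "v \<in> {0, 1, 2, 3, 4, 5, 6, 7}" by auto
      then show ?thesis using * N(2,3)[OF st(1)] N(2,3)[OF st(2)] by auto
    qed
  qed
  show ?case
  proof (rule poly_mapping_eqI)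
    fix t
    show "lookup N t = lookup 0 t"
    proof (cases "t \<in> keys N")
      case True
      have "(\<Sum>s\<in>{s\<in>keys N. E s = E t}. lookup N s) = 0"
      proof (rule monomial_functions_independent)
        fix y :: "nat \<Rightarrow> complex" assume y: "\<And>v. y v \<noteq> 0"
        define x where "x = (\<lambda>_ :: nat \<times> nat. 0 :: complex)((1,1) := y 0, (2,3) := y 2, (2,4) := y 3,
          (3,2) := - y 4, (3,4) := y 6 / y 2, (4,2) := y 7 / y 6)"
        have "mono_eval (\<lambda>v. pvalue x (gen2 v)) s = mono_eval y (E s)" if "s \<in> keys N" for s
        proof -
          have "mono_eval (\<lambda>v. pvalue x (gen2 v)) s = (\<Prod>v\<in>{0, 1, 2, 3, 4, 5, 6, 7}. pvalue x (gen2 v) ^ lookup s v)"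
            using N(1)[OF that] by (intro mono_eval_superset) auto
          then show ?thesis using y N(2)[OF that]
            by (simp add: gen2.simps x_def E_def mono_eval_add power_mult_distrib power_add flip: One_nat_def)
        qed
        then have "(\<Sum>s\<in>keys N. lookup N s * mono_eval y (E s)) = pvalue x (psubst gen2 N)"
          by (simp add: pvalue_psubst pvalue_conv_sum[of _ N])
        also have "\<dots> = 0" using 4(2)[of x] by (simp add: x_def)
        finally show "(\<Sum>s\<in>keys N. lookup N s * mono_eval y (E s)) = 0" .
      qed simp
      moreover have "{s\<in>keys N. E s = E t} = {t}" using inj True by blast
      ultimately show ?thesis by simp
    qed (simp add: in_keys_iff)
  qed
qed (auto simp: plucker_rules_def gen2.simps lookup_add lookup_single)

section \<open>From the triangular section to arbitrary jets\<close>

context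
  fixes P :: jet_poly and m :: nat
  assumes P: "P \<in> bi_invariants 4 m"
begin

lemma P_jet_cong: "(\<And>i l. i \<in> {1..4} \<Longrightarrow> l \<in> {1..4} \<Longrightarrow> x (i, l) = y (i, l)) \<Longrightarrow> pvalue x P = pvalue y P"
  using P by (intro pvalue_cong_polys[of P "{1..4} \<times> {1..4}"]) (auto simp: bi_invariants_iff jet_ring_def)

lemma P_unipotent: "pvalue (unipotent u x) P = pvalue x P"
  using P by (simp add: bi_invariants_iff)

text \<open>Subtracting a multiple of the third function from the fourth clears the entry (4,3) and
  turns (4,4) into \<open>gen1 6\<close> over \<open>x (3, 3)\<close>. The powers of
  \<open>x (3, 3)\<close> are then divided out by \<open>div1\<close>.\<close>

lemma section1_generated: "\<exists>S\<in>polys {..6}. psubst (zero_outside section1 Var) P = psubst gen1 S"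
proof -
  define G where "G x = (zero_outside section1 x)((4, 3) := 0, (4, 4) := pvalue x (gen1 6) / x (3, 3))"
    for x :: "nat \<times> nat \<Rightarrow> complex"
  have PG: "pvalue (zero_outside section1 x) P = pvalue (G x) P" if "x (3, 3) \<noteq> 0" for x
  proof -
    define u :: "nat \<Rightarrow> nat \<Rightarrow> complex" where "u i j = (if i = 4 \<and> j = 3 then - x (4, 3) / x (3, 3) else 0)" for i j
    have "pvalue (zero_outside section1 x) P = pvalue (unipotent u (zero_outside section1 x)) P"
      by (simp add: P_unipotent)
    also have "\<dots> = pvalue (G x) P"
    proof (rule P_jet_cong)
      fix i l :: nat assume "i \<in> {1..4}" "l \<in> {1..4}"
      then have "i = 1 \<or> i = 2 \<or> i = 3 \<or> i = 4" "l = 1 \<or> l = 2 \<or> l = 3 \<or> l = 4" by auto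
      then show "unipotent u (zero_outside section1 x) (i, l) = G x (i, l)"
        using that by (elim disjE) (simp_all add: G_def u_def zero_outside_def section1_def gen1.simps field_simps)
    qed
    finally show ?thesis .
  qed
  have "\<exists>k. \<exists>q\<in>polys {..6}. \<forall>x. pvalue x (jet 3 3) \<noteq> 0 \<longrightarrow>
      pvalue x (jet 3 3) ^ k * pvalue (G x) P = pvalue x (psubst gen1 q)"
  proof (rule clear_denominators[of _ _ "Var 4"])
    fix v :: "nat \<times> nat"
    have var: "\<exists>k. \<exists>q\<in>polys {..6}. \<forall>x. pvalue x (jet 3 3) \<noteq> 0 \<longrightarrow> pvalue x (jet 3 3) ^ k * G x v = pvalue x (psubst gen1 q)"
      if "j \<le> 6" "\<And>x. x (3, 3) \<noteq> 0 \<Longrightarrow> x (3, 3) ^ k * G x v = pvalue x (gen1 j)" for j k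
      using that by (intro exI[of _ k] bexI[of _ "Var j"]) auto
    have zero: "\<exists>k. \<exists>q\<in>polys {..6}. \<forall>x. pvalue x (jet 3 3) \<noteq> 0 \<longrightarrow> pvalue x (jet 3 3) ^ k * G x v = pvalue x (psubst gen1 q)"
      if "\<And>x. G x v = 0"
      using that by (intro exI[of _ 0] bexI[of _ 0]) auto
    consider "v = (1, 1)" | "v = (2, 2)" | "v = (2, 3)" | "v = (2, 4)" | "v = (3, 3)" | "v = (3, 4)" | "v = (4, 4)"
      | "v \<notin> section1 - {(4, 3)}"
      unfolding section1_def by blast
    then show "\<exists>k. \<exists>q\<in>polys {..6}. \<forall>x. pvalue x (jet 3 3) \<noteq> 0 \<longrightarrow> pvalue x (jet 3 3) ^ k * G x v = pvalue x (psubst gen1 q)"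
    proof cases
      case 1 then show ?thesis by (intro var[of 0 0]) (simp_all add: G_def zero_outside_def section1_def gen1.simps)
    next
      case 2 then show ?thesis by (intro var[of 1 0]) (simp_all add: G_def zero_outside_def section1_def gen1.simps)
    next
      case 3 then show ?thesis by (intro var[of 2 0]) (simp_all add: G_def zero_outside_def section1_def gen1.simps)
    next
      case 4 then show ?thesis by (intro var[of 3 0]) (simp_all add: G_def zero_outside_def section1_def gen1.simps)
    next
      case 5 then show ?thesis by (intro var[of 4 0]) (simp_all add: G_def zero_outside_def section1_def gen1.simps)
    next
      case 6 then show ?thesis by (intro var[of 5 0]) (simp_all add: G_def zero_outside_def section1_def gen1.simps)
    next
      case 7 then show ?thesis by (intro var[of 6 1]) (simp_all add: G_def)
    next
      case 8
      then have "v = (4, 3) \<or> v \<notin> section1 \<and> v \<noteq> (4, 4)" by (auto simp: section1_def)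
      then show ?thesis by (intro zero) (auto simp: G_def zero_outside_def)
    qed
  qed (auto simp: gen1.simps)
  then obtain k q where q: "q \<in> polys {..6}"
    "\<And>x. x (3, 3) \<noteq> 0 \<Longrightarrow> x (3, 3) ^ k * pvalue (G x) P = pvalue x (psubst gen1 q)"
    by auto
  have "jet 3 3 ^ k * psubst (zero_outside section1 Var) P = psubst gen1 q"
    by (rule mpoly_dense[of "jet 3 3"]) (simp_all add: pvalue_zero_outside PG q(2))
  then show ?thesis using div1.divide_power q(1) by blast
qed

text \<open>Subtracting multiples of the second function clears (3,2) and (4,2). The remaining
  entries are those of a Schur complement, so the generators 4 to 6 of the smaller section become
  minors divided by \<open>x (2, 2)\<close>; \<open>div2\<close> removes the denominator.\<close>

lemma section2_generated: "\<exists>S\<in>polys {..7}. psubst (zero_outside section2 Var) P = psubst gen2 S"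
proof -
  obtain S1 where S1: "S1 \<in> polys {..6}" "psubst (zero_outside section1 Var) P = psubst gen1 S1"
    using section1_generated by blast
  define G where "G x = (\<lambda>v. if v \<le> 3 then pvalue x (gen2 v) else if v = 4 then pvalue x (gen2 4) / x (2, 2)
      else if v = 5 then pvalue x (gen2 5) / x (2, 2) else if v = 6 then pvalue x (gen2 7) / x (2, 2) else 0)"
    for x :: "nat \<times> nat \<Rightarrow> complex"
  have PG: "pvalue (zero_outside section2 x) P = pvalue (G x) S1" if x: "x (2, 2) \<noteq> 0" for x
  proof -
    define u :: "nat \<Rightarrow> nat \<Rightarrow> complex" where "u i j = (if i \<ge> 3 \<and> j = 2 then - x (i, 2) / x (2, 2) else 0)" for i j
    define y where "y = unipotent u (zero_outside section2 x)"
    have y: "y (1, 1) = x (1, 1)" "y (2, 2) = x (2, 2)" "y (2, 3) = x (2, 3)" "y (2, 4) = x (2, 4)"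
      "y (3, 3) = x (3, 3) - x (3, 2) / x (2, 2) * x (2, 3)" "y (3, 4) = x (3, 4) - x (3, 2) / x (2, 2) * x (2, 4)"
      "y (4, 3) = x (4, 3) - x (4, 2) / x (2, 2) * x (2, 3)" "y (4, 4) = x (4, 4) - x (4, 2) / x (2, 2) * x (2, 4)"
      by (simp_all add: y_def u_def zero_outside_def section2_def)
    have "pvalue (zero_outside section2 x) P = pvalue y P" by (simp add: y_def P_unipotent)
    also have "\<dots> = pvalue (zero_outside section1 y) P"
    proof (rule P_jet_cong)
      fix i l :: nat assume "i \<in> {1..4}" "l \<in> {1..4}"
      then have "i = 1 \<or> i = 2 \<or> i = 3 \<or> i = 4" "l = 1 \<or> l = 2 \<or> l = 3 \<or> l = 4" by auto
      then show "y (i, l) = zero_outside section1 y (i, l)"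
        using that by (elim disjE) (simp_all add: y_def u_def zero_outside_def section1_def section2_def)
    qed
    also have "\<dots> = pvalue y (psubst gen1 S1)" by (simp add: pvalue_zero_outside flip: S1(2))
    also have "\<dots> = pvalue (G x) S1"
      unfolding pvalue_psubst
    proof (rule pvalue_cong_polys[OF S1(1)])
      fix v :: nat assume "v \<in> {..6}"
      then have "v \<in> {0, 1, 2, 3, 4, 5, 6}" by auto
      then show "pvalue y (gen1 v) = G x v"
        using x by (auto simp: gen1.simps gen2.simps G_def y field_simps simp del: One_nat_def)
    qed
    finally show ?thesis .
  qed
  have "\<exists>k. \<exists>q\<in>polys {..7}. \<forall>x. pvalue x (jet 2 2) \<noteq> 0 \<longrightarrow>
      pvalue x (jet 2 2) ^ k * pvalue (G x) S1 = pvalue x (psubst gen2 q)"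
  proof (rule clear_denominators[of _ _ "Var 1"])
    fix v assume "v \<in> vars S1"
    then have "v \<in> {..6}" using S1(1) by (auto simp: polys_def)
    have var: "\<exists>k. \<exists>q\<in>polys {..7}. \<forall>x. pvalue x (jet 2 2) \<noteq> 0 \<longrightarrow> pvalue x (jet 2 2) ^ k * G x v = pvalue x (psubst gen2 q)"
      if "j \<le> 7" "\<And>x. x (2, 2) \<noteq> 0 \<Longrightarrow> x (2, 2) ^ k * G x v = pvalue x (gen2 j)" for j k
      using that by (intro exI[of _ k] bexI[of _ "Var j"]) auto
    consider "v \<le> 3" | "v = 4" | "v = 5" | "v = 6" using \<open>v \<in> {..6}\<close> by fastforce
    then show "\<exists>k. \<exists>q\<in>polys {..7}. \<forall>x. pvalue x (jet 2 2) \<noteq> 0 \<longrightarrow> pvalue x (jet 2 2) ^ k * G x v = pvalue x (psubst gen2 q)"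
    proof cases
      case 1 then show ?thesis by (intro var[of v 0]) (simp_all add: G_def)
    next
      case 2 then show ?thesis by (intro var[of 4 1]) (simp_all add: G_def)
    next
      case 3 then show ?thesis by (intro var[of 5 1]) (simp_all add: G_def)
    next
      case 4 then show ?thesis by (intro var[of 7 1]) (simp_all add: G_def)
    qed
  qed (auto simp: gen2.simps)
  then obtain k q where q: "q \<in> polys {..7}"
    "\<And>x. x (2, 2) \<noteq> 0 \<Longrightarrow> x (2, 2) ^ k * pvalue (G x) S1 = pvalue x (psubst gen2 q)"
    by auto
  have "jet 2 2 ^ k * psubst (zero_outside section2 Var) P = psubst gen2 q"
    by (rule mpoly_dense[of "jet 2 2"]) (simp_all add: pvalue_zero_outside PG q(2))
  then show ?thesis using div2.divide_power q(1) by blast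
qed

text \<open>A reparametrization with first derivative 1 clears the higher derivatives of the first
  function, then a unipotent transformation clears the first derivatives of the others.
  Bi-invariants keep their values, so the section coordinates can be read off from them.\<close>

lemma generated_up_to_f1: "\<exists>k S. jet 1 1 ^ k * P = psubst bi_inv S"
proof -
  obtain S2 where S2: "S2 \<in> polys {..7}" "psubst (zero_outside section2 Var) P = psubst gen2 S2"
    using section2_generated by blast
  \<comment> \<open>On a normalized jet each of these bi-invariants is a power of
    \<open>f\<^sub>1'\<close> times one element of \<open>gen2\<close>; for example
    \<open>\<Lambda>\<^sup>5\<close> is \<open>f\<^sub>1'\<close> squared times
    \<open>jet 2 3\<close>. These powers are the denominators.\<close>
  define G where "G x = (\<lambda>v::nat.
      if v = 0 then x (1, 1)
      else if v = 1 then pvalue x (bi_inv L3) / x (1, 1)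
      else if v = 2 then pvalue x (bi_inv L5) / x (1, 1) ^ 2
      else if v = 3 then pvalue x (bi_inv L7) / x (1, 1) ^ 3
      else if v = 4 then pvalue x (bi_inv D6) / x (1, 1)
      else if v = 5 then pvalue x (bi_inv D8) / x (1, 1) ^ 2
      else if v = 6 then pvalue x (bi_inv N10) / x (1, 1) ^ 3
      else if v = 7 then pvalue x (bi_inv W10) / x (1, 1) else 0)"
    for x :: "nat \<times> nat \<Rightarrow> complex"
  have PG: "pvalue x P = pvalue (G x) S2" if x: "x (1, 1) \<noteq> 0" for x
  proof -
    \<comment> \<open>Solutions, one after the other, of the equations that the entries (1,2),
      (1,3), (1,4) of \<open>reparam p x\<close> vanish, with \<open>p 1 = 1\<close>.\<close>
    define p2 where "p2 = - x (1, 2) / x (1, 1)"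
    define p3 where "p3 = - (x (1, 3) + 3 * p2 * x (1, 2)) / x (1, 1)"
    define p4 where "p4 = - (x (1, 4) + 6 * p2 * x (1, 3) + (4 * p3 + 3 * p2 ^ 2) * x (1, 2)) / x (1, 1)"
    define p where "p k = (if k = 1 then 1 else if k = 2 then p2 else if k = 3 then p3 else p4)" for k :: nat
    have p: "p 1 = 1" "p 2 = p2" "p 3 = p3" "p 4 = p4" by (simp_all add: p_def)
    define x' where "x' = reparam p x"
    have x': "x' (1, 1) = x (1, 1)" "x' (1, 2) = 0" "x' (1, 3) = 0" "x' (1, 4) = 0"
      using x by (simp_all add: x'_def p p2_def p3_def p4_def del: One_nat_def)
    define u where "u i j = (if j = 1 then - x' (i, 1) / x (1, 1) else 0)" for i j :: nat
    define y where "y = unipotent u x'"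
    have y1: "y (1, 1) = x (1, 1)" "y (1, 2) = 0" "y (1, 3) = 0" "y (1, 4) = 0"
      "y (2, 1) = 0" "y (3, 1) = 0" "y (4, 1) = 0"
      using x x' by (simp_all add: y_def u_def)
    have inv: "pvalue y (bi_inv v) = pvalue x (bi_inv v)" for v
      using bi_inv_reparam[of p x v] p(1) by (simp add: y_def x'_def bi_inv_unipotent del: bi_inv.simps)
    have "pvalue x P = pvalue x' P"
      using P p(1) by (simp add: x'_def bi_invariants_iff)
    also have "\<dots> = pvalue y P" by (simp add: y_def P_unipotent)
    also have "\<dots> = pvalue (zero_outside section2 y) P"
    proof (rule P_jet_cong)
      fix i l :: nat assume "i \<in> {1..4}" "l \<in> {1..4}"
      then have "i = 1 \<or> i = 2 \<or> i = 3 \<or> i = 4" "l = 1 \<or> l = 2 \<or> l = 3 \<or> l = 4" by auto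
      then show "y (i, l) = zero_outside section2 y (i, l)"
        using y1 by (elim disjE) (simp_all add: zero_outside_def section2_def)
    qed
    also have "\<dots> = pvalue y (psubst gen2 S2)" by (simp add: pvalue_zero_outside flip: S2(2))
    also have "\<dots> = pvalue (G x) S2"
      unfolding pvalue_psubst
    proof (rule pvalue_cong_polys[OF S2(1)])
      fix v :: nat assume "v \<in> {..7}"
      then have "v \<in> {0, 1, 2, 3, 4, 5, 6, 7}" by auto
      moreover have "pvalue y (gen2 v) = G x v" if "v \<in> {0, 1, 2, 3, 4, 5, 6, 7}" for v
        unfolding G_def pvalue_bi_inv[of y, unfolded inv] val_N10_def minor4_def minor3_def minor2_def
        using that x y1
        by (auto simp: gen2.simps field_simps power2_eq_square power3_eq_cube)
      ultimately show "pvalue y (gen2 v) = G x v" by blast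
    qed
    finally show ?thesis .
  qed
  have "\<exists>k. \<exists>q\<in>polys UNIV. \<forall>x. pvalue x (jet 1 1) \<noteq> 0 \<longrightarrow>
      pvalue x (jet 1 1) ^ k * pvalue (G x) S2 = pvalue x (psubst bi_inv q)"
  proof (rule clear_denominators[of _ _ "Var F1"])
    fix v assume "v \<in> vars S2"
    then have "v \<in> {..7}" using S2(1) by (auto simp: polys_def)
    have var: "\<exists>k. \<exists>q\<in>polys UNIV. \<forall>x. pvalue x (jet 1 1) \<noteq> 0 \<longrightarrow> pvalue x (jet 1 1) ^ k * G x v = pvalue x (psubst bi_inv q)"
      if "\<And>x. x (1, 1) \<noteq> 0 \<Longrightarrow> x (1, 1) ^ k * G x v = pvalue x (bi_inv j)" for j k
      using that by (intro exI[of _ k] bexI[of _ "Var j"]) auto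
    have "v \<in> {0, 1, 2, 3, 4, 5, 6, 7}" using \<open>v \<in> {..7}\<close> by auto
    then consider "v = 0" | "v = 1" | "v = 2" | "v = 3" | "v = 4" | "v = 5" | "v = 6" | "v = 7" by blast
    then show "\<exists>k. \<exists>q\<in>polys UNIV. \<forall>x. pvalue x (jet 1 1) \<noteq> 0 \<longrightarrow> pvalue x (jet 1 1) ^ k * G x v = pvalue x (psubst bi_inv q)"
    proof cases
      case 1 then show ?thesis by (intro var[of 0 F1]) (simp add: G_def)
    next
      case 2 then show ?thesis by (intro var[of 1 L3]) (simp add: G_def del: bi_inv.simps)
    next
      case 3 then show ?thesis by (intro var[of 2 L5]) (simp add: G_def del: bi_inv.simps)
    next
      case 4 then show ?thesis by (intro var[of 3 L7]) (simp add: G_def del: bi_inv.simps)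
    next
      case 5 then show ?thesis by (intro var[of 1 D6]) (simp add: G_def del: bi_inv.simps)
    next
      case 6 then show ?thesis by (intro var[of 2 D8]) (simp add: G_def del: bi_inv.simps)
    next
      case 7 then show ?thesis by (intro var[of 3 N10]) (simp add: G_def del: bi_inv.simps)
    next
      case 8 then show ?thesis by (intro var[of 1 W10]) (simp add: G_def del: bi_inv.simps)
    qed
  qed auto
  then obtain k q where q: "\<And>x. x (1, 1) \<noteq> 0 \<Longrightarrow> x (1, 1) ^ k * pvalue (G x) S2 = pvalue x (psubst bi_inv q)"
    by auto
  have "jet 1 1 ^ k * P = psubst bi_inv q"
    by (rule mpoly_dense[of "jet 1 1"]) (use q in \<open>simp_all add: PG\<close>)
  then show ?thesis by blast
qed

end

section \<open>The relations as reduction rules\<close>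

definition monom_of :: "'v list \<Rightarrow> 'v Defs.monom" where
  "monom_of vs = (\<Sum>v\<leftarrow>vs. single v 1)"

lemma monom_of_simps [simp]:
  "monom_of [] = 0" "monom_of (v # vs) = single v 1 + monom_of vs"
  by (simp_all add: monom_of_def)

lemma lookup_monom_of: "lookup (monom_of vs) v = count_list vs v"
  by (induction vs) (simp_all add: lookup_add lookup_single)

lemma keys_monom_of: "keys (monom_of vs) = set vs"
  by (induction vs) (simp_all add: keys_monom_add)

lemma mono_eval_monom_of: "mono_eval g (monom_of vs) = (\<Prod>v\<leftarrow>vs. g v)"
  by (induction vs) (simp_all add: mono_eval_add)

lemma monom_weight_monom_of: "monom_weight w (monom_of vs) = (\<Sum>v\<leftarrow>vs. w v)"
  by (induction vs) (simp_all add: monom_weight_add)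

lemma single_monom_of: "single (monom_of vs) 1 = (\<Prod>v\<leftarrow>vs. Var v)"
  by (simp add: single_eq_mono_eval mono_eval_monom_of)

lemma first_monom_eq: "first_monom r = monom_of (snd (hd r))"
  by (simp add: first_monom_def monom_of_def)

text \<open>The \<open>s\<close>-th relation, evaluated at the bi-invariants, equals \<open>f\<^sub>1'\<close> times the \<open>s\<close>-th term of
  this list.\<close>

definition lifts :: "(complex \<times> gen list) list" where
  "lifts = [(1, [M8, F1]), (1/3, [E10]), (1, [L12]), (-6, [M8, D6]), (6, [M8, D8]), (1, [U17]),
    (0, []), (0, []), (0, []), (1, [L12]), (-1, [Q14]), (-1, [M8, D8]), (2, [M8, N10]), (1, [V19]),
    (0, []), (-1, [R15, M8]), (0, []), (-1, [X21]), (0, []), (0, []), (0, []), (0, []), (0, []),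
    (0, []), (0, []), (-1, [R15]), (-1, [U17]), (3, [V19]), (0, []), (0, []), (-1, [V19]),
    (-1, [X21]), (0, []), (0, []), (1, [V19, V19]), (-1, [X21, V19]), (-1, [X21, X21]), (0, []),
    (1, [R15, M8]), (0, []), (5, [X21, R15, M8])]"

definition relation_value :: "(gen \<Rightarrow> complex) \<Rightarrow> (int \<times> gen list) list \<Rightarrow> complex" where
  "relation_value val r = (\<Sum>(k, us)\<leftarrow>r. of_int k * (\<Prod>v\<leftarrow>us. val v))"

text \<open>Where \<open>f\<^sub>1'\<close> and \<open>\<Lambda>\<^sup>3\<close> are nonzero, all
  generators except \<open>W10\<close> are rational functions of the six values t, x, y, z, d, e. In
  these the 41 identities are identities of rational functions.\<close>

lemma lifts_values:
  fixes t x y z d e :: complex and val :: "gen \<Rightarrow> complex"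
  assumes nz: "t \<noteq> 0" "x \<noteq> 0"
    and val: "val F1 = t" "val L3 = x" "val L5 = y" "val L7 = z" "val D6 = d" "val D8 = e"
      "val N10 = (y * e - z * d) / x"
      "val M8 = (3 * x * z - 5 * y * y) / (t * t)"
      "val E10 = (3 * x * e - 6 * y * d) / t"
      "val L12 = (5 * y * e - 6 * z * d) / t"
      "val Q14 = (x * z * e - 10 * y * y * e + 10 * y * z * d) / (x * t)"
      "val R15 = (x * e * e - 12 * y * d * e + 12 * z * d * d) / (x * t)"
      "val U17 = (15 * x * e * e - 60 * y * d * e + 36 * z * d * d) / (t * t)"
      "val V19 = (25 * x * y * e * e - 60 * y * y * d * e - 24 * x * z * d * e + 60 * y * z * d * d) / (x * t * t)"
      "val X21 = (100 * y * z * d * e - x * z * e * e - 40 * y * y * e * e - 60 * z * z * d * d) / (x * t * t)"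
  shows "list_all2 (\<lambda>r (c, vs). relation_value val r = c * (val F1 * (\<Prod>v\<leftarrow>vs. val v))) relations lifts"
  unfolding relations_def lifts_def relation_value_def list.rel_inject list_all2_Cons list_all2_Nil prod.case
    list.map sum_list.Cons sum_list.Nil prod_list.Cons prod_list.Nil val
  using nz
  by (intro conjI TrueI; simp add: divide_simps; simp add: algebra_simps)

text \<open>Three-term Pluecker relation for the minors. It is hidden in the list: relations 3 and
  10 have the same lift, \<open>f\<^sub>1'\<close> times L12, and their difference is this identity.
  It eliminates N10 from the parametrization.\<close>

lemma bi_inv_plucker:
  "pvalue x (bi_inv L3) * pvalue x (bi_inv N10) =
   pvalue x (bi_inv L5) * pvalue x (bi_inv D8) - pvalue x (bi_inv L7) * pvalue x (bi_inv D6)"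
proof -
  have "minor2 x 2 1 2 * minor3 x 1 3 4 = minor2 x 2 1 3 * minor3 x 1 2 4 - minor2 x 2 1 4 * minor3 x 1 2 3"
    by (simp add: minor3_def minor2_def algebra_simps)
  from arg_cong[OF this, of "\<lambda>t. x (1, 1) ^ 2 * t"]
    arg_cong[OF minor2_plucker[of x], of "\<lambda>t. 4 * x (1, 1) * minor3 x 1 2 3 * t"]
  show ?thesis
    unfolding pvalue_bi_inv val_N10_def
    by (simp add: algebra_simps power2_eq_square del: One_nat_def)
qed

lemma relation_poly_value: "pvalue x (psubst bi_inv (relation_poly r)) = relation_value (\<lambda>v. pvalue x (bi_inv v)) r"
proof -
  have "pvalue val (relation_poly r) = relation_value val r" for val
    unfolding relation_poly_def relation_value_def
    by (induction r) auto
  then show ?thesis by (simp add: pvalue_psubst)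
qed

text \<open>By density it suffices to compare values where \<open>f\<^sub>1'\<close> and
  \<open>\<Lambda>\<^sup>3\<close> are nonzero, the domain of \<open>lifts_values\<close>.\<close>

lemma lifts_correct:
  assumes "(r, (c, vs)) \<in> set (zip relations lifts)"
  shows "psubst bi_inv (relation_poly r) = Const c * (jet 1 1 * (\<Prod>v\<leftarrow>vs. bi_inv v))"
proof (rule mpoly_dense[of "jet 1 1 * bi_inv L3"])
  have "pvalue ((\<lambda>_. 0)((1, 1) := 1, (2, 2) := 1)) (bi_inv L3) \<noteq> 0"
    unfolding pvalue_bi_inv by (simp add: minor2_def)
  then have "bi_inv L3 \<noteq> 0" by (metis pv.peval_0)
  then show "jet 1 1 * bi_inv L3 \<noteq> 0" unfolding mpoly_mult_eq_0 by simp
next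
  fix x assume "pvalue x (jet 1 1 * bi_inv L3) \<noteq> 0"
  then have nz: "x (1, 1) \<noteq> 0" "pvalue x (bi_inv L3) \<noteq> 0" by auto
  define val where "val v = pvalue x (bi_inv v)" for v
  have nz': "val F1 \<noteq> 0" "val L3 \<noteq> 0" using nz by (simp_all add: val_def)
  have F1: "pvalue x (jet 1 1) = val F1" by (simp add: val_def)
  have q: "3 * val L3 * val D8 - 6 * val L5 * val D6 = val F1 * val E10"
    "5 * val L3 * val N10 - val L7 * val D6 = val F1 * val L12"
    "val L7 * val D8 - 10 * val L5 * val N10 = val F1 * val Q14"
    "val D8 * val D8 - 12 * val D6 * val N10 = val F1 * val R15"
    "4 * val D8 * val E10 + 3 * val L3 * val R15 = val F1 * val U17"
    "8 * val N10 * val E10 + val L5 * val R15 = val F1 * val V19"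
    "4 * val D8 * val Q14 - 5 * val L7 * val R15 = val F1 * val X21"
    using bi_inv_quotients[THEN arg_cong[of _ _ "pvalue x"]]
    by (simp_all add: val_def del: bi_inv.simps) (simp_all add: val_def)
  have "list_all2 (\<lambda>r (c, vs). relation_value val r = c * (val F1 * (\<Prod>v\<leftarrow>vs. val v))) relations lifts"
  proof (rule lifts_values[OF nz' refl refl refl refl refl refl])
    show N: "val N10 = (val L5 * val D8 - val L7 * val D6) / val L3"
      using bi_inv_plucker[of x] nz' by (simp add: val_def field_simps del: bi_inv.simps)
    have "3 * val L3 * val L7 - 5 * val L5 * val L5 = val F1 ^ 2 * val M8"
      unfolding val_def pvalue_bi_inv val_M8_def by (simp add: algebra_simps power2_eq_square)
    then show "val M8 = (3 * val L3 * val L7 - 5 * val L5 * val L5) / (val F1 * val F1)"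
      using nz' by (simp add: field_simps power2_eq_square)
    show E: "val E10 = (3 * val L3 * val D8 - 6 * val L5 * val D6) / val F1"
      using q(1) nz' by (simp add: field_simps)
    show "val L12 = (5 * val L5 * val D8 - 6 * val L7 * val D6) / val F1"
    proof -
      have "val L3 * val N10 = val L5 * val D8 - val L7 * val D6"
        using bi_inv_plucker[of x] by (simp add: val_def del: bi_inv.simps)
      then have "val F1 * val L12 = 5 * val L5 * val D8 - 6 * val L7 * val D6"
        using q(2) by (simp add: mult.assoc mult.commute[of "val D6"])
      then show ?thesis using nz' by (simp add: field_simps)
    qed
    show Q: "val Q14 = (val L3 * val L7 * val D8 - 10 * val L5 * val L5 * val D8 + 10 * val L5 * val L7 * val D6) / (val L3 * val F1)"
      using q(3) nz' by (simp add: N field_simps)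
    show R: "val R15 = (val L3 * val D8 * val D8 - 12 * val L5 * val D6 * val D8 + 12 * val L7 * val D6 * val D6) / (val L3 * val F1)"
      using q(4) nz' by (simp add: N field_simps)
    have U: "val U17 = (4 * val D8 * val E10 + 3 * val L3 * val R15) / val F1"
      and V: "val V19 = (8 * val N10 * val E10 + val L5 * val R15) / val F1"
      and X: "val X21 = (4 * val D8 * val Q14 - 5 * val L7 * val R15) / val F1"
      using q(5-7) nz' by (simp_all add: field_simps)
    show "val U17 = (15 * val L3 * val D8 * val D8 - 60 * val L5 * val D6 * val D8 + 36 * val L7 * val D6 * val D6) / (val F1 * val F1)"
      unfolding U E R using nz' by (simp add: divide_simps; simp add: algebra_simps)
    show "val V19 = (25 * val L3 * val L5 * val D8 * val D8 - 60 * val L5 * val L5 * val D6 * val D8 - 24 * val L3 * val L7 * val D6 * val D8 + 60 * val L5 * val L7 * val D6 * val D6) / (val L3 * val F1 * val F1)"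
      unfolding V E R N using nz' by (simp add: divide_simps; simp add: algebra_simps)
    show "val X21 = (100 * val L5 * val L7 * val D6 * val D8 - val L3 * val L7 * val D8 * val D8 - 40 * val L5 * val L5 * val D8 * val D8 - 60 * val L7 * val L7 * val D6 * val D6) / (val L3 * val F1 * val F1)"
      unfolding X Q R using nz' by (simp add: divide_simps; simp add: algebra_simps)
  qed
  then have "relation_value val r = c * (val F1 * (\<Prod>v\<leftarrow>vs. val v))"
    using assms by (auto simp: list_all2_iff)
  then show "pvalue x (psubst bi_inv (relation_poly r)) = pvalue x (Const c * (jet 1 1 * (\<Prod>v\<leftarrow>vs. bi_inv v)))"
    by (simp add: relation_poly_value val_def[abs_def])
qed

text \<open>A solution of the linear inequalities saying that the leading monomial of each relation outweighs
  its other terms and the lifted term.\<close>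

definition reduction_weight :: "gen \<Rightarrow> nat" where
  "reduction_weight v = (case v of W10 \<Rightarrow> 0 | F1 \<Rightarrow> 0 | L3 \<Rightarrow> 93 | L5 \<Rightarrow> 139 | L7 \<Rightarrow> 189 | D6 \<Rightarrow> 163 | D8 \<Rightarrow> 214
     | N10 \<Rightarrow> 268 | M8 \<Rightarrow> 217 | E10 \<Rightarrow> 258 | L12 \<Rightarrow> 314 | Q14 \<Rightarrow> 371 | R15 \<Rightarrow> 410 | U17 \<Rightarrow> 458 | V19 \<Rightarrow> 516 | X21 \<Rightarrow> 576)"

section \<open>The lexicographic order in computable form, and the checks on the 41
  relations\<close>

fun lex_list :: "nat list \<Rightarrow> nat list \<Rightarrow> bool" where
  "lex_list (a # as) (b # bs) \<longleftrightarrow> a < b \<or> a = b \<and> lex_list as bs"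
| "lex_list _ _ \<longleftrightarrow> False"

lemma lex_less_Cons:
  "lex_less (v # vs) s t \<longleftrightarrow> lookup s v < lookup t v \<or>
     lookup s v = lookup t v \<and> lex_less vs s t"
  (is "?L = ?R")
proof
  assume ?L
  then obtain i where i: "i < Suc (length vs)" "lookup s ((v # vs) ! i) < lookup t ((v # vs) ! i)"
    "\<forall>j<i. lookup s ((v # vs) ! j) = lookup t ((v # vs) ! j)"
    by (auto simp: lex_less_def)
  show ?R
  proof (cases i)
    case 0
    then show ?thesis using i(2) by simp
  next
    case (Suc k)
    then have "lex_less vs s t" unfolding lex_less_def
      using i by (intro exI[of _ k]) force
    moreover have "lookup s v = lookup t v" using i(3) Suc by force
    ultimately show ?thesis by simp
  qed
next
  assume ?R
  then show ?L
  proof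
    assume "lookup s v < lookup t v"
    then show ?L unfolding lex_less_def by (intro exI[of _ 0]) simp
  next
    assume *: "lookup s v = lookup t v \<and> lex_less vs s t"
    then obtain i where "i < length vs" "lookup s (vs ! i) < lookup t (vs ! i)"
      "\<forall>j<i. lookup s (vs ! j) = lookup t (vs ! j)"
      by (auto simp: lex_less_def)
    with * show ?L unfolding lex_less_def
      by (intro exI[of _ "Suc i"]) (auto simp: less_Suc_eq_0_disj)
  qed
qed

lemma lex_less_Nil [simp]: "\<not> lex_less [] s t"
  by (simp add: lex_less_def)

lemma lex_less_iff: "lex_less vs s t \<longleftrightarrow> lex_list (map (lookup s) vs) (map (lookup t) vs)"
  by (induction vs) (simp_all add: lex_less_Cons)

lemma lex_less_trans: "lex_less vs s t \<Longrightarrow> lex_less vs t u \<Longrightarrow> lex_less vs s u"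
  by (induction vs) (auto simp: lex_less_Cons)

lemma lex_less_irrefl: "\<not> lex_less vs s s"
  by (induction vs) (auto simp: lex_less_Cons)

lemma lex_less_add: "lex_less vs (s + u) (t + u) \<longleftrightarrow> lex_less vs s t"
  by (induction vs) (auto simp: lex_less_Cons lookup_add)

lemma lex_less_total:
  "lex_less vs s t \<or> lex_less vs t s \<or> (\<forall>v\<in>set vs. lookup s v = lookup t v)"
  by (induction vs) (auto simp: lex_less_Cons)

text \<open>The first condition serves termination, the second homogeneity. The third, that every
  replacing term has degree at least 2, is what mutual independence will rest on.\<close>

definition tail_ok :: "gen list \<Rightarrow> gen list \<Rightarrow> bool" where
  "tail_ok ls us \<longleftrightarrow> (\<Sum>v\<leftarrow>us. reduction_weight v) < (\<Sum>v\<leftarrow>ls. reduction_weight v) \<and>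
     (\<Sum>v\<leftarrow>us. weight v) = (\<Sum>v\<leftarrow>ls. weight v) \<and> 2 \<le> length us"

definition relation_ok :: "(int \<times> gen list) list \<Rightarrow> complex \<times> gen list \<Rightarrow> bool" where
  "relation_ok r cv \<longleftrightarrow> r \<noteq> [] \<and> fst (hd r) \<noteq> 0 \<and> 2 \<le> length (snd (hd r)) \<and> set (snd (hd r)) \<subseteq> set gens14 \<and>
     (\<forall>(c, us)\<in>set (tl r). tail_ok (snd (hd r)) us \<and> set us \<subseteq> set gens14 \<and>
        lex_list (map (count_list us) gens14) (map (count_list (snd (hd r))) gens14)) \<and>
     (fst cv = 0 \<or> tail_ok (snd (hd r)) (F1 # snd cv))"

lemma relations_ok: "list_all2 relation_ok relations lifts"
  unfolding relations_def lifts_def list.rel_inject list_all2_Cons list_all2_Nil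
  by (intro conjI TrueI; simp add: relation_ok_def tail_ok_def reduction_weight_def gens14_def)


text \<open>The relation solved for its leading monomial. At the bi-invariants the relation is not 0
  but its lift, hence the extra term with the factor \<open>F1\<close>.\<close>

definition rule_of :: "(int \<times> gen list) list \<Rightarrow> complex \<times> gen list \<Rightarrow> gen Defs.monom \<times> gen mpoly" where
  "rule_of r cv = (first_monom r, Const (inverse (of_int (fst (hd r)))) *
     (single (monom_of (F1 # snd cv)) (fst cv) -
      (\<Sum>(k, us)\<leftarrow>tl r. single (monom_of us) (of_int k))))"

definition gen_rules :: "(gen Defs.monom \<times> gen mpoly) set" where
  "gen_rules = (\<lambda>(r, cv). rule_of r cv) ` set (zip relations lifts)"

text \<open>The clauses on the total degree (no monomial of degree below 2 is rewritten or produced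
  from higher degree) give mutual independence. The clauses on \<open>F1\<close> (its exponent never
  drops, and while it stays constant the monomial goes down lexicographically) give the Groebner
  property.\<close>

definition gen_order :: "gen Defs.monom \<Rightarrow> gen Defs.monom \<Rightarrow> bool" where
  "gen_order t s \<longleftrightarrow> monom_weight weight s = monom_weight weight t \<and>
     (2 \<le> monom_weight (\<lambda>_. 1) t \<longrightarrow> 2 \<le> monom_weight (\<lambda>_. 1) s) \<and>
     (monom_weight (\<lambda>_. 1) t < 2 \<longrightarrow> s = t) \<and>
     lookup t F1 \<le> lookup s F1 \<and>
     (lookup t F1 = lookup s F1 \<longrightarrow> s = t \<or> lex14 s t)"

lemma relation_okD: "(r, cv) \<in> set (zip relations lifts) \<Longrightarrow> relation_ok r cv"
  using relations_ok by (auto simp: list_all2_iff)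

lemma relation_poly_conv: "relation_poly r = (\<Sum>(k, us)\<leftarrow>r. single (monom_of us) (of_int k))"
proof -
  have "single (monom_of us) (of_int k) = of_int k * (\<Prod>v\<leftarrow>us. Var v)" for k and us :: "gen list"
    using single_conv_Const[of "monom_of us" "of_int k"] by (simp add: Const_def flip: single_monom_of single_of_int)
  then show ?thesis by (simp add: relation_poly_def)
qed

lemma keys_sum_list_single:
  "keys (\<Sum>(k, us)\<leftarrow>ts. single (monom_of us) (of_int k :: complex)) \<subseteq> monom_of ` snd ` set ts"
proof (induction ts)
  case (Cons a ts)
  obtain k us where a: "a = (k, us)" by fastforce
  have "keys (single (monom_of us) (of_int k) +
      (\<Sum>(k, us)\<leftarrow>ts. single (monom_of us) (of_int k :: complex)))
    \<subseteq> {monom_of us} \<union> monom_of ` snd ` set ts"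
    by (rule order.trans[OF Poly_Mapping.keys_add]) (use Cons in auto)
  then show ?case by (simp add: a)
qed simp

lemma keys_rule_of:
  "keys (snd (rule_of r cv)) \<subseteq>
     (if fst cv = 0 then {} else {monom_of (F1 # snd cv)}) \<union> monom_of ` snd ` set (tl r)"
proof -
  have "keys (snd (rule_of r cv)) \<subseteq> keys (single (monom_of (F1 # snd cv)) (fst cv) -
      (\<Sum>(k, us)\<leftarrow>tl r. single (monom_of us) (of_int k)))"
    unfolding rule_of_def snd_conv by (rule keys_Const_mult)
  also have "\<dots> \<subseteq> keys (single (monom_of (F1 # snd cv)) (fst cv)) \<union>
      keys (\<Sum>(k, us)\<leftarrow>tl r. single (monom_of us) (of_int k :: complex))"
    by (rule Poly_Mapping.keys_diff)
  also have "\<dots> \<subseteq> (if fst cv = 0 then {} else {monom_of (F1 # snd cv)}) \<union> monom_of ` snd ` set (tl r)"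
    using keys_sum_list_single[of "tl r"] by (auto split: if_splits)
  finally show ?thesis .
qed

lemma rule_of_eq:
  assumes "(r, cv) \<in> set (zip relations lifts)"
  shows "psubst bi_inv (single (first_monom r) 1) = psubst bi_inv (snd (rule_of r cv))"
proof -
  obtain c vs where cv: "cv = (c, vs)" by fastforce
  have ok: "r \<noteq> []" "fst (hd r) \<noteq> 0" using relation_okD[OF assms] by (simp_all add: relation_ok_def)
  define k where "k = (of_int (fst (hd r)) :: complex)"
  have k: "k \<noteq> 0" using ok by (simp add: k_def)
  let ?T = "\<Sum>(k, us)\<leftarrow>tl r. single (monom_of us) (of_int k :: complex)"
  have "relation_poly r = single (first_monom r) k + ?T"
    using ok(1) by (cases r) (auto simp: relation_poly_conv first_monom_eq k_def)
  then have "psubst bi_inv (single (first_monom r) k) = psubst bi_inv (relation_poly r) - psubst bi_inv ?T"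
    by (simp del: ps.peval_sum_list)
  also have "psubst bi_inv (relation_poly r) = psubst bi_inv (single (monom_of (F1 # vs)) c)"
    using lifts_correct[of r c vs] assms
    by (simp add: cv ps.peval_single mono_eval_add mono_eval_monom_of)
  finally have "Const k * psubst bi_inv (single (first_monom r) 1) =
      psubst bi_inv (single (monom_of (F1 # vs)) c - ?T)"
    by (simp add: single_conv_Const[of _ k] del: ps.peval_sum_list)
  then have "Const (inverse k) * (Const k * psubst bi_inv (single (first_monom r) 1)) =
      psubst bi_inv (snd (rule_of r cv))"
    by (simp add: rule_of_def cv k_def del: ps.peval_sum_list)
  moreover have "Const (inverse k) * (Const k * q) = q" for q :: jet_poly
    using k by (simp add: mult.assoc[symmetric] flip: Const_mult)
  ultimately show ?thesis by simp
qed

lemma lookup_gens14_0: "set us \<subseteq> set gens14 \<Longrightarrow> count_list us F1 = 0 \<and> count_list us W10 = 0"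
  by (auto simp: count_list_0_iff gens14_def)

interpretation nf: normal_form bi_inv UNIV gen_rules reduction_weight gen_order
proof (unfold_locales, goal_cases)
  case (1 l r)
  then show ?case by (auto simp: gen_rules_def rule_of_eq) (auto simp: rule_of_def rule_of_eq[simplified rule_of_def snd_conv])
next
  case (2 l r)
  show ?case by simp
next
  case (3 l r s)
  then obtain q cv where q: "(q, cv) \<in> set (zip relations lifts)" "rule_of q cv = (l, r)"
    by (auto simp: gen_rules_def)
  note ok = relation_okD[OF q(1)]
  have l: "l = monom_of (snd (hd q))" using q(2) by (simp add: rule_of_def first_monom_eq)
  have "s \<in> (if fst cv = 0 then {} else {monom_of (F1 # snd cv)}) \<union> monom_of ` snd ` set (tl q)"
    using subsetD[OF keys_rule_of[of q cv], of s] 3(2) q(2) by simp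
  then show ?case using ok
    by (auto simp: l relation_ok_def tail_ok_def monom_weight_monom_of monom_weight_add split: if_splits)
next
  case (4 t)
  show ?case by (simp add: gen_order_def)
next
  case (5 s t u)
  then show ?case unfolding gen_order_def
    by (auto intro: lex_less_trans)
next
  case (6 l r s \<gamma>)
  then obtain q cv where q: "(q, cv) \<in> set (zip relations lifts)" "rule_of q cv = (l, r)"
    by (auto simp: gen_rules_def)
  note ok = relation_okD[OF q(1)]
  have l: "l = monom_of (snd (hd q))" using q(2) by (simp add: rule_of_def first_monom_eq)
  have ones: "monom_weight (\<lambda>_. 1) (monom_of us) = length us" for us :: "gen list"
    by (simp add: monom_weight_monom_of sum_list_triv)
  have s: "s \<in> (if fst cv = 0 then {} else {monom_of (F1 # snd cv)}) \<union> monom_of ` snd ` set (tl q)"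
    using subsetD[OF keys_rule_of[of q cv], of s] 6(2) q(2) by simp
  then obtain us where us: "s = monom_of us" "tail_ok (snd (hd q)) us"
    using ok by (auto simp: relation_ok_def split: if_splits simp del: monom_of_simps)
  have l_ok: "2 \<le> length (snd (hd q))" "set (snd (hd q)) \<subseteq> set gens14" using ok by (auto simp: relation_ok_def)
  have F1: "lookup l F1 = 0" using lookup_gens14_0[OF l_ok(2)] by (simp add: l lookup_monom_of)
  \<comment> \<open>The lifted term contains \<open>F1\<close> and escapes the lexicographic
    comparison; only the tail of the relation is concerned.\<close>
  have "s = l \<or> lex14 s l" if "lookup s F1 = 0"
  proof -
    have "s \<in> monom_of ` snd ` set (tl q)" using s that by (auto simp: lookup_add split: if_splits)
    moreover have "lookup (monom_of us) = count_list us" for us :: "gen list"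
      by (rule ext) (rule lookup_monom_of)
    ultimately show ?thesis using ok
      by (auto simp: relation_ok_def l lex_less_iff)
  qed
  then show ?case
    using us l_ok F1
    unfolding gen_order_def monom_weight_add lookup_add lex_less_add
    by (auto simp: l ones tail_ok_def) (auto simp: monom_weight_monom_of sum_list_triv)
qed

section \<open>Independence of the normal monomials on the hyperplane \<open>f\<^sub>1' = 0\<close>\<close>

lemma UNIV_gen: "(UNIV :: gen set) = {W10, F1, L3, L5, L7, D6, D8, N10, M8, E10, L12, Q14, R15, U17, V19, X21}"
proof -
  have "v \<in> {W10, F1, L3, L5, L7, D6, D8, N10, M8, E10, L12, Q14, R15, U17, V19, X21}" for v
    by (cases v) simp_all
  then show ?thesis by blast
qed

lemma monom_weight_gen: "monom_weight w t = (\<Sum>v\<in>{W10, F1, L3, L5, L7, D6, D8, N10, M8, E10, L12, Q14, R15, U17, V19, X21}.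
    w v * lookup t v)"
  by (rule monom_weight_superset) (simp, simp flip: UNIV_gen)

lemma mono_eval_gen: "mono_eval g t = (\<Prod>v\<in>{W10, F1, L3, L5, L7, D6, D8, N10, M8, E10, L12, Q14, R15, U17, V19, X21}.
    g v ^ lookup t v)"
  by (rule mono_eval_superset) (simp, simp flip: UNIV_gen)

lemma first_monom_dvd_iff:
  "(\<exists>\<gamma>. t = monom_of ls + \<gamma>) \<longleftrightarrow> (\<forall>v\<in>set ls. count_list ls v \<le> lookup t v)"
proof
  assume R: "\<forall>v\<in>set ls. count_list ls v \<le> lookup t v"
  have "t = monom_of ls + (t - monom_of ls)"
  proof (rule poly_mapping_eqI)
    fix v
    show "lookup t v = lookup (monom_of ls + (t - monom_of ls)) v"
      using R by (cases "v \<in> set ls") (auto simp: lookup_add lookup_minus lookup_monom_of)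
  qed
  then show "\<exists>\<gamma>. t = monom_of ls + \<gamma>" by blast
qed (auto simp: lookup_add lookup_monom_of)

lemma fst_gen_rules: "fst ` gen_rules = first_monom ` set relations"
proof -
  have "fst ` set (zip relations lifts) = set relations"
    using list_all2_lengthD[OF relations_ok] by (simp flip: set_map)
  moreover have "fst ` gen_rules = first_monom ` fst ` set (zip relations lifts)"
    by (force simp: gen_rules_def rule_of_def image_iff)
  ultimately show ?thesis by simp
qed

lemma normal_gen_iff:
  "nf.normal t \<longleftrightarrow> (\<forall>r\<in>set relations. \<exists>v\<in>set (snd (hd r)). lookup t v < count_list (snd (hd r)) v)"
proof -
  have "nf.normal t \<longleftrightarrow> \<not> (\<exists>l\<in>fst ` gen_rules. \<exists>\<gamma>. t = l + \<gamma>)"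
    by (force simp: nf.normal_def)
  also have "\<dots> \<longleftrightarrow> \<not> (\<exists>r\<in>set relations. \<exists>\<gamma>. t = monom_of (snd (hd r)) + \<gamma>)"
    by (simp add: fst_gen_rules first_monom_eq)
  also have "\<dots> \<longleftrightarrow> (\<forall>r\<in>set relations. \<exists>v\<in>set (snd (hd r)). lookup t v < count_list (snd (hd r)) v)"
    unfolding first_monom_dvd_iff by (auto simp: not_le)
  finally show ?thesis .
qed

text \<open>At the point of the hyperplane chosen below, the generator \<open>v\<close> takes the value
  \<open>scalar v * (\<Prod>i<5. Y i ^ degrees i v) * poly (linear_factor v) s\<close>.\<close>

definition scalar :: "gen \<Rightarrow> complex" where
  "scalar v = (case v of W10 \<Rightarrow> 1 | F1 \<Rightarrow> 1 | L3 \<Rightarrow> -1 | L5 \<Rightarrow> 3 | L7 \<Rightarrow> -15 | D6 \<Rightarrow> 1 | D8 \<Rightarrow> -6 | N10 \<Rightarrow> 3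
     | M8 \<Rightarrow> 1/36 | E10 \<Rightarrow> 1 | L12 \<Rightarrow> -5 | Q14 \<Rightarrow> -25 | R15 \<Rightarrow> -8 | U17 \<Rightarrow> -1/3 | V19 \<Rightarrow> 1/3 | X21 \<Rightarrow> 1/3)"

definition degrees :: "nat \<Rightarrow> gen \<Rightarrow> nat" where
  "degrees i v = (case v of W10 \<Rightarrow> [0,0,0,0,1] | F1 \<Rightarrow> [0,0,0,0,0] | L3 \<Rightarrow> [1,1,0,0,0] | L5 \<Rightarrow> [2,1,0,0,0]
     | L7 \<Rightarrow> [3,1,0,0,0] | D6 \<Rightarrow> [1,1,1,0,0] | D8 \<Rightarrow> [2,1,1,0,0] | N10 \<Rightarrow> [3,1,1,0,0]
     | M8 \<Rightarrow> [0,0,0,2,0] | E10 \<Rightarrow> [1,1,1,1,0] | L12 \<Rightarrow> [2,1,1,1,0] | Q14 \<Rightarrow> [3,1,1,1,0] | R15 \<Rightarrow> [2,1,2,1,0]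
     | U17 \<Rightarrow> [1,1,2,2,0] | V19 \<Rightarrow> [2,1,2,2,0] | X21 \<Rightarrow> [3,1,2,2,0]) ! i"

text \<open>The shifts come from relations 7 to 9: with M8 = s/36, L3 = -1, D6 = 1, D8 = -6, E10 = 1
  and L12 = -5 they read -3 U17 = s + 5, 3 V19 = s + 25, 3 X21 = s + 125.\<close>

definition linear_factor :: "gen \<Rightarrow> complex poly" where
  "linear_factor v = (case v of M8 \<Rightarrow> [:0, 1:] | U17 \<Rightarrow> [:5, 1:] | V19 \<Rightarrow> [:25, 1:] | X21 \<Rightarrow> [:125, 1:] | _ \<Rightarrow> 1)"

text \<open>The five torus degrees are packed into the exponent of a monomial in \<open>Y\<close>,
  to suit \<open>monomial_functions_independent\<close>.\<close>

definition multidegree :: "gen Defs.monom \<Rightarrow> nat Defs.monom" where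
  "multidegree t = (\<Sum>i<5. single i (monom_weight (degrees i) t))"

lemma lookup_multidegree: "i < 5 \<Longrightarrow> lookup (multidegree t) i = monom_weight (degrees i) t"
  by (auto simp: multidegree_def lookup_sum lookup_single when_def)

lemma multidegree_eqD:
  assumes "multidegree s = multidegree t" "i < 5"
  shows "monom_weight (degrees i) s = monom_weight (degrees i) t"
  using assms by (metis lookup_multidegree)

text \<open>The zeros are those that the group can produce on a generic jet with
  \<open>f\<^sub>1' = 0\<close>. Reparametrization clears the higher derivatives of the second
  function; unipotent transformations clear the third function in orders 1 and 2 and the fourth in
  orders 1 to 3; adding a multiple of the first function to the second and renormalizing clears
  (1,3). Six entries remain, parametrized by \<open>Y\<close> and \<open>s\<close> so that each
  generator becomes a monomial times at most one linear factor.\<close>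

lemma hyperplane_point:
  fixes Y :: "nat \<Rightarrow> complex" and s :: complex
  assumes Y: "\<And>i. Y i \<noteq> 0"
  shows "\<exists>x. x (1, 1) = 0 \<and> (\<forall>v\<in>UNIV - {F1}. pvalue x (bi_inv v) =
    scalar v * (\<Prod>i<5. Y i ^ degrees i v) * poly (linear_factor v) s)"
proof -
  define x where "x = (\<lambda>_ :: nat \<times> nat. 0 :: complex)((1, 2) := Y 0, (1, 4) := s * Y 3 ^ 2 / (108 * Y 0 * Y 1 ^ 2),
     (2, 1) := Y 1, (3, 3) := - Y 2, (3, 4) := Y 2 * Y 3 / (3 * Y 0 * Y 1), (4, 4) := Y 4 / (Y 0 * Y 1 * Y 2))"
  have "pvalue x (bi_inv v) = scalar v * (\<Prod>i<5. Y i ^ degrees i v) * poly (linear_factor v) s" if "v \<noteq> F1" for v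
  proof -
    have x: "x (1, 1) = 0" "x (1, 2) = Y 0" "x (1, 3) = 0" "x (1, 4) = s * Y 3 ^ 2 / (108 * Y 0 * Y 1 ^ 2)"
      "x (2, 1) = Y 1" "x (2, 2) = 0" "x (2, 3) = 0" "x (2, 4) = 0"
      "x (3, 1) = 0" "x (3, 2) = 0" "x (3, 3) = - Y 2" "x (3, 4) = Y 2 * Y 3 / (3 * Y 0 * Y 1)"
      "x (4, 1) = 0" "x (4, 2) = 0" "x (4, 3) = 0" "x (4, 4) = Y 4 / (Y 0 * Y 1 * Y 2)"
      by (simp_all add: x_def)
    have m2: "minor2 x 2 1 2 = - (Y 0 * Y 1)" "minor2 x 2 1 3 = 0"
      "minor2 x 2 1 4 = - (s * Y 3 ^ 2 / (108 * Y 0 * Y 1))" "minor2 x 2 2 3 = 0" "minor2 x 2 2 4 = 0"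
      unfolding minor2_def x using Y[of 1] by (simp_all add: power2_eq_square)
    have m3: "minor3 x 1 2 3 = Y 0 * Y 1 * Y 2" "minor3 x 1 2 4 = - (Y 2 * Y 3 / 3)"
      "minor3 x 1 3 4 = - (s * Y 2 * Y 3 ^ 2 / (108 * Y 0 * Y 1))"
      unfolding minor3_def x m2 using Y[of 0] Y[of 1] by simp_all
    have m4: "minor4 x = Y 4" unfolding minor4_def x m3 using Y[of 0] Y[of 1] Y[of 2] by simp
    have five: "(\<Prod>i<5. Y i ^ degrees i v) = Y 0 ^ degrees 0 v * Y 1 ^ degrees 1 v * Y 2 ^ degrees 2 v * Y 3 ^ degrees 3 v * Y 4 ^ degrees 4 v"
      by (simp add: eval_nat_numeral)
    show ?thesis
      unfolding five using that Y[of 0] Y[of 1] Y[of 2]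
      by (cases v)
         (simp_all add: pvalue_bi_inv val_defs m2 m3 m4 x scalar_def degrees_def linear_factor_def
            field_simps power2_eq_square power3_eq_cube del: bi_inv.simps One_nat_def)
  qed
  moreover have "x (1, 1) = 0" by (simp add: x_def)
  ultimately show ?thesis by blast
qed

lemma mono_eval_mult: "mono_eval (\<lambda>v. f v * g v) t = mono_eval f t * mono_eval g t"
  by (simp add: mono_eval_def power_mult_distrib prod.distrib)

lemma mono_eval_power: "mono_eval (\<lambda>v. z ^ e v) t = z ^ monom_weight e t"
  by (simp add: mono_eval_def monom_weight_def power_sum power_mult)

lemma mono_eval_prod: "finite I \<Longrightarrow> mono_eval (\<lambda>v. \<Prod>i\<in>I. f i v) t = (\<Prod>i\<in>I. mono_eval (f i) t)"
  by (induction I rule: finite_induct) (simp_all add: mono_eval_mult, simp add: mono_eval_def)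

lemma mono_eval_multidegree: "mono_eval Y (multidegree t) = (\<Prod>i<5. Y i ^ monom_weight (degrees i) t)"
  by (simp add: multidegree_def eval_nat_numeral mono_eval_add)

lemma poly_mono_eval: "poly (mono_eval f t) s = mono_eval (\<lambda>v. poly (f v) s) t"
  by (simp add: mono_eval_def poly_prod)

abbreviation s_degree :: "gen Defs.monom \<Rightarrow> nat" where
  "s_degree t \<equiv> lookup t M8 + lookup t U17 + lookup t V19 + lookup t X21"

lemma mono_eval_linear_factor:
  "mono_eval linear_factor t = [:0, 1:] ^ lookup t M8 * [:5, 1:] ^ lookup t U17 *
     [:25, 1:] ^ lookup t V19 * [:125, 1:] ^ lookup t X21"
  unfolding mono_eval_gen by (simp add: linear_factor_def mult_ac)

lemma degree_linear_factor: "degree (mono_eval linear_factor t) = s_degree t"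
  unfolding mono_eval_linear_factor by (simp add: degree_mult_eq degree_power_eq)

lemma lead_coeff_linear_factor: "coeff (mono_eval linear_factor t) (s_degree t) = 1"
  unfolding degree_linear_factor[symmetric] unfolding mono_eval_linear_factor
  by (simp add: lead_coeff_mult lead_coeff_power)

text \<open>The 41 leading monomials, regrouped by one variable at a time for the counting
  arguments. The exceptional bounds R15 = 1 and L12 < 2 come from the two leads with a square next
  to another variable, in relations 25 and 41.\<close>

lemma normal_disjunctions:
  assumes "nf.normal t"
  defines "e \<equiv> lookup t"
  shows "e L3 = 0 \<or> e L7 = 0 \<and> e D8 = 0 \<and> e N10 = 0 \<and> e L12 = 0 \<and> e Q14 = 0 \<and> e R15 = 0 \<and> e U17 = 0 \<and> e V19 = 0 \<and> e X21 = 0"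
    "e L5 = 0 \<or> e D8 = 0 \<and> e N10 = 0 \<and> e L12 = 0 \<and> e Q14 = 0 \<and> e R15 = 0 \<and> e U17 = 0 \<and> e V19 = 0 \<and> e X21 = 0"
    "e L7 = 0 \<or> e R15 = 0 \<and> e U17 = 0 \<and> e V19 = 0 \<and> e X21 = 0"
    "e M8 = 0 \<or> e R15 = 0 \<or> e R15 = 1 \<and> e D6 = 0 \<and> e D8 = 0 \<and> e N10 = 0"
    "e D6 = 0 \<or> e N10 = 0 \<and> e L12 = 0 \<and> e Q14 = 0 \<and> e V19 = 0 \<and> e X21 = 0"
    "e D8 = 0 \<or> e L12 = 0 \<and> e Q14 = 0 \<and> e V19 = 0 \<and> e X21 = 0"
    "e N10 = 0 \<or> e V19 = 0 \<or> e E10 = 0 \<and> e L12 = 0"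
    "e N10 = 0 \<or> e X21 = 0 \<or> e L12 = 0 \<and> e U17 = 0"
    "e E10 = 0 \<or> e Q14 = 0 \<and> e X21 = 0"
    "e X21 = 0 \<or> e L12 < 2"
proof -
  have *: "\<forall>r\<in>set relations. \<exists>v\<in>set (snd (hd r)). e v < count_list (snd (hd r)) v"
    using assms(1) by (simp add: normal_gen_iff e_def)
  have big: "(e L3 = 0 \<or> e L7 = 0) \<and> (e L3 = 0 \<or> e D8 = 0) \<and> (e L3 = 0 \<or> e N10 = 0) \<and> (e L3 = 0 \<or> e L12 = 0)
    \<and> (e L3 = 0 \<or> e Q14 = 0) \<and> (e L3 = 0 \<or> e R15 = 0) \<and> (e L3 = 0 \<or> e U17 = 0) \<and> (e L3 = 0 \<or> e V19 = 0)
    \<and> (e L3 = 0 \<or> e X21 = 0) \<and> (e L5 = 0 \<or> e D8 = 0) \<and> (e L5 = 0 \<or> e N10 = 0) \<and> (e L5 = 0 \<or> e L12 = 0)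
    \<and> (e L5 = 0 \<or> e Q14 = 0) \<and> (e L5 = 0 \<or> e R15 = 0) \<and> (e L5 = 0 \<or> e U17 = 0) \<and> (e L5 = 0 \<or> e V19 = 0)
    \<and> (e L5 = 0 \<or> e X21 = 0) \<and> (e L7 = 0 \<or> e R15 = 0) \<and> (e L7 = 0 \<or> e U17 = 0) \<and> (e L7 = 0 \<or> e V19 = 0)
    \<and> (e L7 = 0 \<or> e X21 = 0) \<and> (e D6 = 0 \<or> e M8 = 0 \<or> e R15 = 0) \<and> (e D8 = 0 \<or> e M8 = 0 \<or> e R15 = 0)
    \<and> (e N10 = 0 \<or> e M8 = 0 \<or> e R15 = 0) \<and> (e M8 = 0 \<or> e R15 = 0 \<or> e R15 = 1) \<and> (e D6 = 0 \<or> e N10 = 0)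
    \<and> (e D6 = 0 \<or> e L12 = 0) \<and> (e D6 = 0 \<or> e Q14 = 0) \<and> (e D6 = 0 \<or> e V19 = 0) \<and> (e D6 = 0 \<or> e X21 = 0)
    \<and> (e D8 = 0 \<or> e L12 = 0) \<and> (e D8 = 0 \<or> e Q14 = 0) \<and> (e D8 = 0 \<or> e V19 = 0) \<and> (e D8 = 0 \<or> e X21 = 0)
    \<and> (e N10 = 0 \<or> e E10 = 0 \<or> e V19 = 0) \<and> (e N10 = 0 \<or> e L12 = 0 \<or> e V19 = 0)
    \<and> (e N10 = 0 \<or> e L12 = 0 \<or> e X21 = 0) \<and> (e N10 = 0 \<or> e U17 = 0 \<or> e X21 = 0)
    \<and> (e E10 = 0 \<or> e Q14 = 0) \<and> (e E10 = 0 \<or> e X21 = 0) \<and> (e L12 < 2 \<or> e X21 = 0)"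
    using * unfolding relations_def list.set ball_simps
    by (simp add: less_Suc_eq[of _ "Suc 0"] numeral_2_eq_2)
  show "e L3 = 0 \<or> e L7 = 0 \<and> e D8 = 0 \<and> e N10 = 0 \<and> e L12 = 0 \<and> e Q14 = 0 \<and> e R15 = 0 \<and> e U17 = 0 \<and> e V19 = 0 \<and> e X21 = 0"
    by (cases "e L3 = 0") (use big in simp_all)
  show "e L5 = 0 \<or> e D8 = 0 \<and> e N10 = 0 \<and> e L12 = 0 \<and> e Q14 = 0 \<and> e R15 = 0 \<and> e U17 = 0 \<and> e V19 = 0 \<and> e X21 = 0"
    by (cases "e L5 = 0") (use big in simp_all)
  show "e L7 = 0 \<or> e R15 = 0 \<and> e U17 = 0 \<and> e V19 = 0 \<and> e X21 = 0"
    by (cases "e L7 = 0") (use big in simp_all)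
  show "e M8 = 0 \<or> e R15 = 0 \<or> e R15 = 1 \<and> e D6 = 0 \<and> e D8 = 0 \<and> e N10 = 0"
    by (cases "e M8 = 0"; cases "e R15 = 0") (use big in simp_all)
  show "e D6 = 0 \<or> e N10 = 0 \<and> e L12 = 0 \<and> e Q14 = 0 \<and> e V19 = 0 \<and> e X21 = 0"
    by (cases "e D6 = 0") (use big in simp_all)
  show "e D8 = 0 \<or> e L12 = 0 \<and> e Q14 = 0 \<and> e V19 = 0 \<and> e X21 = 0"
    by (cases "e D8 = 0") (use big in simp_all)
  show "e N10 = 0 \<or> e V19 = 0 \<or> e E10 = 0 \<and> e L12 = 0"
    by (cases "e N10 = 0"; cases "e V19 = 0") (use big in simp_all)
  show "e N10 = 0 \<or> e X21 = 0 \<or> e L12 = 0 \<and> e U17 = 0"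
    by (cases "e N10 = 0"; cases "e X21 = 0") (use big in simp_all)
  show "e E10 = 0 \<or> e Q14 = 0 \<and> e X21 = 0"
    by (cases "e E10 = 0") (use big in simp_all)
  show "e X21 = 0 \<or> e L12 < 2"
    by (cases "e X21 = 0") (use big in simp_all)
qed

text \<open>The sums \<open>l\<close>, \<open>\<delta>\<close>, \<open>h\<close>, \<open>\<omega>\<close> count the factors among \<open>\<Lambda>\<close>, among \<open>D\<^sup>6, D\<^sup>8, N\<close>, among
  \<open>E, L, Q\<close> and among \<open>U, V, X\<close>; within each group the first degree grows by one from one generator to
  the next.\<close>

lemma same_counts:
  fixes \<delta> h r m \<omega> \<delta>' h' r' m' \<omega>' :: nat
  assumes "m = 0 \<or> r = 0 \<or> r = 1 \<and> \<delta> = 0" "m' = 0 \<or> r' = 0 \<or> r' = 1 \<and> \<delta>' = 0"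
    and *: "r + \<omega> = r' + \<omega>'" "\<delta> + h = \<delta>' + h'" "2 * m + h + r + 2 * \<omega> = 2 * m' + h' + r' + 2 * \<omega>'"
    "m + \<omega> = m' + \<omega>'"
  shows "r = r' \<and> m = m' \<and> h = h' \<and> \<delta> = \<delta>' \<and> \<omega> = \<omega>'"
proof -
  have "r = r' \<and> m = m'"
    using assms(1)
  proof (elim disjE conjE)
    assume "m = 0"
    with assms(2) * show ?thesis by (elim disjE conjE) auto
  next
    assume "r = 0"
    with assms(2) * show ?thesis by (elim disjE conjE) auto
  next
    assume "r = 1" "\<delta> = 0"
    with assms(2) * show ?thesis by (elim disjE conjE) auto
  qed
  then show ?thesis using * by auto
qed

text \<open>Otherwise the equations force \<open>m < m'\<close> and \<open>r + 2 \<le> r'\<close>,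
  whereas \<open>m' > 0\<close> bounds \<open>r'\<close> by 1.\<close>

lemma minimal_s_degree:
  fixes h r m \<omega> \<delta>' h' r' m' \<omega>' :: nat
  assumes "m = 0 \<or> r = 0 \<or> r = 1" "m' = 0 \<or> r' = 0 \<or> r' = 1 \<and> \<delta>' = 0"
    "r + \<omega> = r' + \<omega>'" "h = \<delta>' + h'" "2 * m + h + r + 2 * \<omega> = 2 * m' + h' + r' + 2 * \<omega>'"
  shows "m + \<omega> \<le> m' + \<omega>'"
proof (rule ccontr)
  assume "\<not> ?thesis"
  then have "m' + r < m + r'" "2 * m + r' + \<delta>' = 2 * m' + r" using assms(3-5) by simp_all
  then show False using assms(1,2) by auto
qed
text \<open>Used inside a group of three generators with consecutive first degrees. That the first
  and third do not occur together is due to the leads of relations 1, 26 and 39 for the groups of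
  L3, D6 and E10.\<close>

lemma chain_unique:
  fixes a b c a' b' c' :: nat
  assumes "a = 0 \<or> c = 0" "a' = 0 \<or> c' = 0" "a + b + c = a' + b' + c'" "b + 2 * c = b' + 2 * c'"
  shows "a = a' \<and> b = b' \<and> c = c'"
  using assms by (intro conjI; elim disjE; linarith)

text \<open>Each group contributes an excess of first degree between 0 and twice its number of
  factors. A later group may have positive excess only when the earlier ones are saturated, so the
  total excess fills the groups greedily and determines all four.\<close>

lemma chains_unique:
  fixes A B C W A' B' C' W' l \<delta> h \<omega> :: nat
  assumes "A \<le> 2 * l" "B \<le> 2 * \<delta>" "C \<le> 2 * h" "W \<le> 2 * \<omega>"
    and "A' \<le> 2 * l" "B' \<le> 2 * \<delta>" "C' \<le> 2 * h" "W' \<le> 2 * \<omega>"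
    and "A = 2 * l \<or> B = 0 \<and> C = 0 \<and> W = 0" "A' = 2 * l \<or> B' = 0 \<and> C' = 0 \<and> W' = 0"
    and "B = 2 * \<delta> \<or> C = 0 \<and> W = 0" "B' = 2 * \<delta> \<or> C' = 0 \<and> W' = 0"
    and "C = 2 * h \<or> W = 0" "C' = 2 * h \<or> W' = 0"
    and "A + B + C + W = A' + B' + C' + W'"
  shows "A = A' \<and> B = B' \<and> C = C' \<and> W = W'"
proof -
  have "A = A'" using assms(1,5,9,10,15) by (elim disjE) simp_all
  moreover from this have "B = B'" using assms(2,6,9-12,15) by (elim disjE) simp_all
  moreover from calculation have "C = C'" using assms(3,7,13-15) by (elim disjE) simp_all
  ultimately show ?thesis using assms(15) by simp
qed

text \<open>With \<open>x = X21\<close> present, E10 is absent and L12 occurs at most once, so the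
  excess of the group of E10 is within 1 of its maximum; changing \<open>x\<close> would shift the
  total by at least 2.\<close>

lemma tail_unique:
  fixes a b c x a' b' c' x' :: nat
  assumes "x = 0 \<or> a = 0 \<and> b < 2" "x' = 0 \<or> a' = 0 \<and> b' < 2"
    and eq: "a + b + c = a' + b' + c'" "b + 2 * c + 2 * x = b' + 2 * c' + 2 * x'"
  shows "x = x'"
proof (rule ccontr)
  assume neq: "x \<noteq> x'"
  have less: False if "x > x'" "x = 0 \<or> a = 0 \<and> b < 2" "a + b + c = a' + b' + c'"
    "b + 2 * c + 2 * x = b' + 2 * c' + 2 * x'" for a b c x a' b' c' x' :: nat
  proof -
    have "a = 0" "b < 2" using that(1,2) by auto
    moreover from this have "2 * x + 2 * a' + b' = 2 * x' + b" using that(3,4) by simp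
    ultimately show False using that(1) by simp
  qed
  show False
    using less[of x' x a b c a' b' c'] less[of x x' a' b' c' a b c] assms neq by (metis nat_neq_iff)
qed

lemma multidegree_explicit:
  "monom_weight (degrees 0) t = lookup t L3 + 2 * lookup t L5 + 3 * lookup t L7
     + lookup t D6 + 2 * lookup t D8 + 3 * lookup t N10
     + lookup t E10 + 2 * lookup t L12 + 3 * lookup t Q14
     + 2 * lookup t R15 + lookup t U17 + 2 * lookup t V19 + 3 * lookup t X21"
  "monom_weight (degrees 1) t = lookup t L3 + lookup t L5 + lookup t L7
     + lookup t D6 + lookup t D8 + lookup t N10
     + lookup t E10 + lookup t L12 + lookup t Q14
     + lookup t R15 + lookup t U17 + lookup t V19 + lookup t X21"
  "monom_weight (degrees 2) t = lookup t D6 + lookup t D8 + lookup t N10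
     + lookup t E10 + lookup t L12 + lookup t Q14
     + 2 * lookup t R15 + 2 * lookup t U17 + 2 * lookup t V19 + 2 * lookup t X21"
  "monom_weight (degrees 3) t = 2 * lookup t M8
     + lookup t E10 + lookup t L12 + lookup t Q14
     + lookup t R15 + 2 * lookup t U17 + 2 * lookup t V19 + 2 * lookup t X21"
  "monom_weight (degrees 4) t = lookup t W10"
  unfolding monom_weight_gen by (simp_all add: degrees_def)

text \<open>The degrees 1 and 2 only give the number of Lambda factors minus the number of factors
  R, U, V, X. A normal monomial has none of the former or none of the latter (leads of relations 6-9
  and 14-21), so the difference determines both.\<close>

lemma normal_counts:
  assumes "nf.normal s" "nf.normal t" "multidegree s = multidegree t"
  defines "e \<equiv> lookup s" and "f \<equiv> lookup t"
  shows "e L3 + e L5 + e L7 = f L3 + f L5 + f L7"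
    "e R15 + (e U17 + e V19 + e X21) = f R15 + (f U17 + f V19 + f X21)"
    "(e D6 + e D8 + e N10) + (e E10 + e L12 + e Q14) = (f D6 + f D8 + f N10) + (f E10 + f L12 + f Q14)"
    "2 * e M8 + (e E10 + e L12 + e Q14) + e R15 + 2 * (e U17 + e V19 + e X21) =
     2 * f M8 + (f E10 + f L12 + f Q14) + f R15 + 2 * (f U17 + f V19 + f X21)"
proof -
  have d: "monom_weight (degrees i) s = monom_weight (degrees i) t" if "i < 5" for i
    by (rule multidegree_eqD[OF assms(3) that])
  have d1: "e L3 + e L5 + e L7 + e D6 + e D8 + e N10 + e E10 + e L12 + e Q14 + e R15 + e U17 + e V19 + e X21
     = f L3 + f L5 + f L7 + f D6 + f D8 + f N10 + f E10 + f L12 + f Q14 + f R15 + f U17 + f V19 + f X21"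
    using d[of 1] by (simp only: multidegree_explicit e_def f_def; simp?)
  have d2: "e D6 + e D8 + e N10 + e E10 + e L12 + e Q14 + 2 * e R15 + 2 * e U17 + 2 * e V19 + 2 * e X21
     = f D6 + f D8 + f N10 + f E10 + f L12 + f Q14 + 2 * f R15 + 2 * f U17 + 2 * f V19 + 2 * f X21"
    using d[of 2] by (simp only: multidegree_explicit e_def f_def; simp?)
  have d3: "2 * e M8 + e E10 + e L12 + e Q14 + e R15 + 2 * e U17 + 2 * e V19 + 2 * e X21
     = 2 * f M8 + f E10 + f L12 + f Q14 + f R15 + 2 * f U17 + 2 * f V19 + 2 * f X21"
    using d[of 3] by (simp only: multidegree_explicit e_def f_def; simp?)
  have lr: "e L3 + e L5 + e L7 = 0 \<or> e R15 + (e U17 + e V19 + e X21) = 0"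
    using normal_disjunctions(1-3)[OF assms(1)] by (auto simp: e_def)
  have lr': "f L3 + f L5 + f L7 = 0 \<or> f R15 + (f U17 + f V19 + f X21) = 0"
    using normal_disjunctions(1-3)[OF assms(2)] by (auto simp: f_def)
  show 1: "e L3 + e L5 + e L7 = f L3 + f L5 + f L7"
    using lr lr' d1 d2 by (elim disjE) linarith+
  show 2: "e R15 + (e U17 + e V19 + e X21) = f R15 + (f U17 + f V19 + f X21)"
    using 1 d1 d2 by linarith
  show "(e D6 + e D8 + e N10) + (e E10 + e L12 + e Q14) = (f D6 + f D8 + f N10) + (f E10 + f L12 + f Q14)"
    using d2 2 by linarith
  show "2 * e M8 + (e E10 + e L12 + e Q14) + e R15 + 2 * (e U17 + e V19 + e X21) =
     2 * f M8 + (f E10 + f L12 + f Q14) + f R15 + 2 * (f U17 + f V19 + f X21)"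
    using d3 by simp
qed

lemma normal_m_r:
  assumes "nf.normal t"
  defines "e \<equiv> lookup t"
  shows "e M8 = 0 \<or> e R15 = 0 \<or> e R15 = 1 \<and> e D6 + e D8 + e N10 = 0"
  using normal_disjunctions(4)[OF assms(1)] by (auto simp: e_def)

text \<open>Applied to a monomial of maximal degree in s, this forces all monomials of its
  multidegree to have that same degree.\<close>

lemma normal_minimal_s_degree:
  assumes "nf.normal s" "nf.normal t" "multidegree s = multidegree t"
    and "lookup s D6 + lookup s D8 + lookup s N10 = 0"
  shows "s_degree s \<le> s_degree t"
proof -
  note c = normal_counts[OF assms(1-3)]
  note m = normal_m_r[OF assms(1)] normal_m_r[OF assms(2)]
  have "lookup s M8 + (lookup s U17 + lookup s V19 + lookup s X21)
    \<le> lookup t M8 + (lookup t U17 + lookup t V19 + lookup t X21)"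
  proof (rule minimal_s_degree[OF _ m(2) c(2) _ c(4)])
    show "lookup s M8 = 0 \<or> lookup s R15 = 0 \<or> lookup s R15 = 1"
      using m(1) by blast
    show "lookup s E10 + lookup s L12 + lookup s Q14 =
      lookup t D6 + lookup t D8 + lookup t N10 +
      (lookup t E10 + lookup t L12 + lookup t Q14)"
      using c(3) assms(4) by linarith
  qed
  then show ?thesis by linarith
qed

text \<open>Multidegree and degree in s fix the number of factors in each group, and degree 0 fixes
  the total excess. If D6, D8 or N10 occurs, \<open>chains_unique\<close> finishes. Otherwise U17
  and X21 may occur together, and \<open>V19^2\<close> is not distinguished from
  \<open>U17 * X21\<close>; hence the condition on V19.\<close>

lemma normal_determined:
  assumes s: "nf.normal s" and t: "nf.normal t" and eq: "multidegree s = multidegree t" "s_degree s = s_degree t"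
    and F1: "lookup s F1 = 0" "lookup t F1 = 0"
    and last: "lookup s D6 + lookup s D8 + lookup s N10 > 0 \<or>
      lookup s V19 = lookup t V19"
  shows "s = t"
proof -
  define e where "e = lookup s"
  define f where "f = lookup t"
  note c = normal_counts[OF s t eq(1), folded e_def f_def]
  note ns = normal_disjunctions[OF s, folded e_def] and nt = normal_disjunctions[OF t, folded f_def]
  have d0: "e L3 + 2 * e L5 + 3 * e L7 + e D6 + 2 * e D8 + 3 * e N10 + e E10 + 2 * e L12 + 3 * e Q14 + 2 * e R15
      + e U17 + 2 * e V19 + 3 * e X21 = f L3 + 2 * f L5 + 3 * f L7 + f D6 + 2 * f D8 + 3 * f N10 + f E10
      + 2 * f L12 + 3 * f Q14 + 2 * f R15 + f U17 + 2 * f V19 + 3 * f X21"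
    using multidegree_eqD[OF eq(1), of 0] by (simp only: multidegree_explicit e_def f_def; simp?)
  have W: "e W10 = f W10"
    using multidegree_eqD[OF eq(1), of 4] by (simp only: multidegree_explicit e_def f_def; simp?)
  have "e R15 = f R15 \<and> e M8 = f M8 \<and> e E10 + e L12 + e Q14 = f E10 + f L12 + f Q14 \<and>
     e D6 + e D8 + e N10 = f D6 + f D8 + f N10 \<and> e U17 + e V19 + e X21 = f U17 + f V19 + f X21"
    by (rule same_counts[OF normal_m_r[OF s, folded e_def] normal_m_r[OF t, folded f_def] c(2,3,4)])
       (use eq(2) in \<open>simp add: e_def f_def\<close>)
  then have R: "e R15 = f R15" and M: "e M8 = f M8" and h: "e E10 + e L12 + e Q14 = f E10 + f L12 + f Q14"
    and \<delta>: "e D6 + e D8 + e N10 = f D6 + f D8 + f N10" and \<omega>: "e U17 + e V19 + e X21 = f U17 + f V19 + f X21"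
    by blast+
  have sum: "(e L5 + 2 * e L7) + (e D8 + 2 * e N10) + (e L12 + 2 * e Q14) + (e V19 + 2 * e X21) =
      (f L5 + 2 * f L7) + (f D8 + 2 * f N10) + (f L12 + 2 * f Q14) + (f V19 + 2 * f X21)"
    using d0 R h \<delta> \<omega> c(1) by linarith
  have L: "e L5 + 2 * e L7 = 2 * (e L3 + e L5 + e L7) \<or> e D8 + 2 * e N10 = 0 \<and> e L12 + 2 * e Q14 = 0 \<and> e V19 + 2 * e X21 = 0"
    using ns(1,2) by auto
  have L': "f L5 + 2 * f L7 = 2 * (e L3 + e L5 + e L7) \<or> f D8 + 2 * f N10 = 0 \<and> f L12 + 2 * f Q14 = 0 \<and> f V19 + 2 * f X21 = 0"
    unfolding c(1) using nt(1,2) by auto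
  have all: "e L5 + 2 * e L7 = f L5 + 2 * f L7 \<and> e D8 + 2 * e N10 = f D8 + 2 * f N10 \<and>
      e L12 + 2 * e Q14 = f L12 + 2 * f Q14 \<and> e V19 + 2 * e X21 = f V19 + 2 * f X21 \<and> e U17 = f U17"
  proof (cases "e D6 + e D8 + e N10 > 0")
    case True
    then have True': "f D6 + f D8 + f N10 > 0" using \<delta> by simp
    have D: "e D8 + 2 * e N10 = 2 * (e D6 + e D8 + e N10) \<or> e L12 + 2 * e Q14 = 0 \<and> e V19 + 2 * e X21 = 0"
      using ns(5,6) by auto
    have D': "f D8 + 2 * f N10 = 2 * (e D6 + e D8 + e N10) \<or> f L12 + 2 * f Q14 = 0 \<and> f V19 + 2 * f X21 = 0"
      unfolding \<delta> using nt(5,6) by auto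
    have E: "e L12 + 2 * e Q14 = 2 * (e E10 + e L12 + e Q14) \<or> e V19 + 2 * e X21 = 0"
      using ns(5-9) True by (cases "e N10 = 0") auto
    have E': "f L12 + 2 * f Q14 = 2 * (e E10 + e L12 + e Q14) \<or> f V19 + 2 * f X21 = 0"
      unfolding h using nt(5-9) True' by (cases "f N10 = 0") auto
    have "e L5 + 2 * e L7 = f L5 + 2 * f L7 \<and> e D8 + 2 * e N10 = f D8 + 2 * f N10 \<and>
      e L12 + 2 * e Q14 = f L12 + 2 * f Q14 \<and> e V19 + 2 * e X21 = f V19 + 2 * f X21"
    proof (rule chains_unique[OF _ _ _ _ _ _ _ _ L L' D D' E E' sum])
      show "e V19 + 2 * e X21 \<le> 2 * (f U17 + f V19 + f X21)" unfolding \<omega>[symmetric] by simp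
      show "f L5 + 2 * f L7 \<le> 2 * (e L3 + e L5 + e L7)" unfolding c(1) by simp
      show "f D8 + 2 * f N10 \<le> 2 * (e D6 + e D8 + e N10)" unfolding \<delta> by simp
      show "f L12 + 2 * f Q14 \<le> 2 * (e E10 + e L12 + e Q14)" unfolding h by simp
    qed simp_all
    moreover have "e U17 = 0 \<or> e X21 = 0" using ns(5,6,8) True by auto
    moreover have "f U17 = 0 \<or> f X21 = 0" using nt(5,6,8) True' by auto
    ultimately show ?thesis
      using chain_unique[of "e U17" "e X21" "f U17" "f X21" "e V19" "f V19"] \<omega> by simp
  next
    case False
    then have z: "e D6 = 0" "e D8 = 0" "e N10 = 0" "f D6 = 0" "f D8 = 0" "f N10 = 0" using \<delta> by simp_all
    have V: "e V19 = f V19" using last False by (simp add: e_def f_def)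
    have "e X21 = f X21 \<and> e L5 + 2 * e L7 = f L5 + 2 * f L7"
    proof (cases "e L3 + e L5 + e L7 = 0")
      case True
      then have l0: "e L5 = 0" "e L7 = 0" "f L5 = 0" "f L7 = 0" using c(1) by simp_all
      have "e X21 = f X21"
      proof (rule tail_unique)
        show "e X21 = 0 \<or> e E10 = 0 \<and> e L12 < 2" using ns(9,10) by auto
        show "f X21 = 0 \<or> f E10 = 0 \<and> f L12 < 2" using nt(9,10) by auto
        show "e E10 + e L12 + e Q14 = f E10 + f L12 + f Q14" by (rule h)
        show "e L12 + 2 * e Q14 + 2 * e X21 = f L12 + 2 * f Q14 + 2 * f X21"
          using sum V z l0 by simp
      qed
      then show ?thesis by (simp add: l0)
    next
      case False
      then have x: "e U17 + e V19 + e X21 = 0" "f U17 + f V19 + f X21 = 0"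
        using ns(1-3) \<omega> by auto
      have "e L12 + 2 * e Q14 \<le> 2 * (e E10 + e L12 + e Q14)" "f L12 + 2 * f Q14 \<le> 2 * (e E10 + e L12 + e Q14)"
        using h by simp_all
      then show ?thesis using L L' c(1) sum x z by (elim disjE) simp_all
    qed
    then show ?thesis using V \<omega> sum z by simp
  qed
  have "e L3 = f L3 \<and> e L5 = f L5 \<and> e L7 = f L7"
    by (rule chain_unique) (use ns(1) nt(1) c(1) all in auto)
  moreover have "e D6 = f D6 \<and> e D8 = f D8 \<and> e N10 = f N10"
    by (rule chain_unique) (use ns(5) nt(5) \<delta> all in auto)
  moreover have "e E10 = f E10 \<and> e L12 = f L12 \<and> e Q14 = f Q14"
    by (rule chain_unique) (use ns(9) nt(9) h all in auto)
  moreover have "e U17 = f U17 \<and> e V19 = f V19 \<and> e X21 = f X21" using \<omega> all by simp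
  moreover have "e F1 = f F1" using F1 by (simp add: e_def f_def)
  ultimately have "e v = f v" for v using W M R by (cases v) simp_all
  then show ?thesis by (intro poly_mapping_eqI) (simp add: e_def f_def)
qed

text \<open>A relation splits by multidegree into relations between products of linear polynomials
  in s. Its top coefficient shows that two monomials share the maximal degree, which excludes D6, D8
  and N10; then all degrees agree and the exponents of V19 are distinct. The least order of
  vanishing at s = -25 singles out one monomial, whose coefficient must vanish.\<close>

lemma restricted_generators_independent:
  assumes keys: "keys N \<subseteq> {t. nf.normal t \<and> lookup t F1 = 0}"
    and zero: "\<And>x. x (1, 1) = 0 \<Longrightarrow> pvalue x (psubst bi_inv N) = 0"
  shows "N = 0"
proof (rule ccontr)
  assume "N \<noteq> 0"
  then obtain t\<^sub>0 where t\<^sub>0: "t\<^sub>0 \<in> keys N" by fastforce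
  define c where "c t = lookup N t * mono_eval scalar t" for t
  define T where "T = {t\<in>keys N. multidegree t = multidegree t\<^sub>0}"
  define F where "F t = (mono_eval linear_factor t :: complex poly)" for t
  have [simp]: "finite T" by (simp add: T_def)
  have T: "nf.normal t" "lookup t F1 = 0" "multidegree t = multidegree t\<^sub>0" "c t \<noteq> 0" if "t \<in> T" for t
  proof -
    show "nf.normal t" "lookup t F1 = 0" "multidegree t = multidegree t\<^sub>0" using keys that by (auto simp: T_def)
    have "scalar v \<noteq> 0" for v by (cases v) (simp_all add: scalar_def)
    then show "c t \<noteq> 0" using that by (simp add: c_def T_def in_keys_iff mono_eval_neq_0)
  qed
  have "(\<Sum>t\<in>T. c t * poly (F t) s) = 0" for s
    unfolding T_def
  proof (rule monomial_functions_independent)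
    fix Y :: "nat \<Rightarrow> complex" assume Y: "\<And>i. Y i \<noteq> 0"
    obtain x where x: "x (1, 1) = 0" "\<forall>v\<in>UNIV - {F1}. pvalue x (bi_inv v) =
        scalar v * (\<Prod>i<5. Y i ^ degrees i v) * poly (linear_factor v) s"
      using hyperplane_point[of Y s, OF Y] by blast
    have "N \<in> polys (UNIV - {F1})" using keys by (auto simp: polys_keys in_keys_iff)
    then have "pvalue x (psubst bi_inv N) =
        pvalue (\<lambda>v. scalar v * (\<Prod>i<5. Y i ^ degrees i v) * poly (linear_factor v) s) N"
      unfolding pvalue_psubst by (rule pvalue_cong_polys) (rule bspec[OF x(2)])
    also have "\<dots> = (\<Sum>t\<in>keys N. c t * poly (F t) s * mono_eval Y (multidegree t))"
      by (simp add: pvalue_conv_sum c_def F_def mono_eval_mult mono_eval_prod mono_eval_power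
          mono_eval_multidegree poly_mono_eval mult_ac)
    finally show "(\<Sum>t\<in>keys N. c t * poly (F t) s * mono_eval Y (multidegree t)) = 0"
      using zero[of x, OF x(1)] by simp
  qed simp
  then have "poly (\<Sum>t\<in>T. smult (c t) (F t)) s = 0" for s by (simp add: poly_sum)
  then have sum0: "(\<Sum>t\<in>T. smult (c t) (F t)) = 0" using poly_all_0_iff_0 by blast
  have "T \<noteq> {}" using t\<^sub>0 by (auto simp: T_def)
  define D where "D = Max (s_degree ` T)"
  have D: "s_degree t \<le> D" if "t \<in> T" for t unfolding D_def using that by (intro Max_ge) auto
  have "D \<in> s_degree ` T" unfolding D_def using \<open>T \<noteq> {}\<close> by (intro Max_in) auto
  then obtain t\<^sub>1 where t\<^sub>1: "t\<^sub>1 \<in> T" "s_degree t\<^sub>1 = D" by auto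
  have "coeff (F t) D = (if s_degree t = D then 1 else 0)" if "t \<in> T" for t
  proof (cases "s_degree t = D")
    case True
    then show ?thesis using lead_coeff_linear_factor[of t] by (simp add: F_def)
  next
    case False
    then have "degree (F t) < D" using D[OF that] by (simp add: F_def degree_linear_factor)
    then show ?thesis using False by (simp add: coeff_eq_0)
  qed
  then have "(\<Sum>t\<in>T. c t * (if s_degree t = D then 1 else 0)) = coeff (\<Sum>t\<in>T. smult (c t) (F t)) D"
    by (simp add: coeff_sum)
  moreover have "(\<Sum>t\<in>T. c t * (if s_degree t = D then 1 else 0)) = (\<Sum>t\<in>{t\<in>T. s_degree t = D}. c t)"
    by (simp only: sum.inter_filter[OF \<open>finite T\<close>]) (rule sum.cong, simp_all)
  ultimately have top: "(\<Sum>t\<in>{t\<in>T. s_degree t = D}. c t) = 0"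
    using sum0 by simp
  \<comment> \<open>All the polynomials are monic, so a single monomial of top degree would have
    coefficient 0.\<close>
  have "{t\<in>T. s_degree t = D} \<noteq> {t\<^sub>1}"
  proof
    assume "{t\<in>T. s_degree t = D} = {t\<^sub>1}"
    then show False using top T(4)[OF t\<^sub>1(1)] by simp
  qed
  then obtain t\<^sub>2 where t\<^sub>2: "t\<^sub>2 \<in> T" "s_degree t\<^sub>2 = D" "t\<^sub>1 \<noteq> t\<^sub>2" using t\<^sub>1 by blast
  have same: "s = t" if "s \<in> T" "t \<in> T" "s_degree s = s_degree t"
    "lookup s D6 + lookup s D8 + lookup s N10 > 0 \<or>
      lookup s V19 = lookup t V19" for s t
    by (rule normal_determined[OF T(1)[OF that(1)] T(1)[OF that(2)] _ that(3) T(2)[OF that(1)] T(2)[OF that(2)] that(4)])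
       (simp add: T(3)[OF that(1)] T(3)[OF that(2)])
  \<comment> \<open>If one of D6, D8, N10 occurred, the degree in s would already identify the two
    monomials.\<close>
  have \<delta>: "lookup t\<^sub>1 D6 + lookup t\<^sub>1 D8 + lookup t\<^sub>1 N10 = 0"
  proof (rule ccontr)
    assume "\<not> ?thesis"
    then have "t\<^sub>1 = t\<^sub>2" using t\<^sub>1 t\<^sub>2 by (intro same) auto
    then show False using t\<^sub>2(3) by simp
  qed
  have sD: "s_degree t = D" if "t \<in> T" for t
  proof -
    have "s_degree t\<^sub>1 \<le> s_degree t"
      by (rule normal_minimal_s_degree[OF T(1)[OF t\<^sub>1(1)] T(1)[OF that] _ \<delta>])
         (simp add: T(3)[OF that] T(3)[OF t\<^sub>1(1)])
    then show ?thesis using D[OF that] t\<^sub>1(2) by linarith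
  qed
  have V_inj: "s = t" if "s \<in> T" "t \<in> T" "lookup s V19 = lookup t V19" for s t
    using that sD[OF that(1)] sD[OF that(2)] by (intro same) auto
  define v\<^sub>0 where "v\<^sub>0 = Min ((\<lambda>t. lookup t V19) ` T)"
  have "v\<^sub>0 \<in> (\<lambda>t. lookup t V19) ` T" unfolding v\<^sub>0_def using \<open>T \<noteq> {}\<close> by (intro Min_in) auto
  then obtain t\<^sub>3 where t\<^sub>3: "t\<^sub>3 \<in> T" "lookup t\<^sub>3 V19 = v\<^sub>0" by auto
  have v\<^sub>0: "v\<^sub>0 \<le> lookup t V19" if "t \<in> T" for t
    unfolding v\<^sub>0_def using that by (intro Min_le) auto
  define H where "H t = [:0, 1:] ^ lookup t M8 * [:5, 1:] ^ lookup t U17 *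
     [:25, 1:] ^ (lookup t V19 - v\<^sub>0) * ([:125, 1:] ^ lookup t X21 :: complex poly)" for t
  have FH: "F t = [:25, 1:] ^ v\<^sub>0 * H t" if "t \<in> T" for t
  proof -
    have "[:25, 1:] ^ lookup t V19 = [:25, 1:] ^ v\<^sub>0 * ([:25, 1:] ^ (lookup t V19 - v\<^sub>0) :: complex poly)"
      using v\<^sub>0[OF that] by (simp flip: power_add)
    then show ?thesis by (simp only: F_def H_def mono_eval_linear_factor mult_ac)
  qed
  have "[:25, 1:] ^ v\<^sub>0 * (\<Sum>t\<in>T. smult (c t) (H t)) = (\<Sum>t\<in>T. smult (c t) (F t))"
    unfolding sum_distrib_left by (rule sum.cong) (simp_all add: FH)
  then have "(\<Sum>t\<in>T. smult (c t) (H t)) = 0" using sum0 by simp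
  then have "poly (\<Sum>t\<in>T. smult (c t) (H t)) (-25) = 0" by simp
  moreover have "poly (H t) (-25) = (if t = t\<^sub>3 then poly (H t\<^sub>3) (-25) else 0)" if "t \<in> T" for t
  proof (cases "t = t\<^sub>3")
    case False
    then have "lookup t V19 \<noteq> v\<^sub>0" using V_inj[OF that t\<^sub>3(1)] t\<^sub>3(2) by auto
    then have "lookup t V19 > v\<^sub>0" using v\<^sub>0[OF that] by simp
    then show ?thesis using False by (simp add: H_def)
  qed simp
  ultimately have "(\<Sum>t\<in>T. c t * (if t = t\<^sub>3 then poly (H t\<^sub>3) (-25) else 0)) = 0"
    by (simp add: poly_sum)
  then have "c t\<^sub>3 * poly (H t\<^sub>3) (-25) = 0" using t\<^sub>3(1) by (simp add: if_distrib cong: if_cong)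
  \<comment> \<open>At s = -25 the surviving linear factors take the values -25, -20 and 100, so
    \<open>H\<close> does not vanish there.\<close>
  then show False using T(4)[OF t\<^sub>3(1)] by (simp add: H_def t\<^sub>3(2))
qed

interpretation nd: normal_division bi_inv UNIV gen_rules reduction_weight gen_order F1 "(1, 1)"
proof (unfold_locales, goal_cases)
  case (3 l r)
  then obtain q cv where q: "(q, cv) \<in> set (zip relations lifts)" "l = first_monom q"
    by (auto simp: gen_rules_def rule_of_def)
  then have "set (snd (hd q)) \<subseteq> set gens14" using relation_okD[OF q(1)] by (auto simp: relation_ok_def)
  then show ?case using lookup_gens14_0[of "snd (hd q)"] by (simp add: q(2) first_monom_eq lookup_monom_of)
qed (auto intro: restricted_generators_independent)

section \<open>Normal forms of bi-invariants\<close>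

lemma weighted_degree_eq: "weighted_degree t = monom_weight weight t"
  by (simp add: weighted_degree_def monom_weight_def)

lemma lookup_Const_mult: "lookup (Const c * p) t = c * lookup p t"
  unfolding Const_def mult_map_scale_conv_mult[symmetric]
  by transfer (simp add: when_def)

lemma lookup_free_part:
  assumes "lookup t d = 0"
  shows "lookup (free_part d p) t = lookup p t"
proof -
  let ?S = "{t\<in>keys p. lookup t d = 0}"
  have "lookup (free_part d p) t = (\<Sum>s\<in>{s\<in>?S. s = t}. lookup p s)"
    unfolding free_part_def by (rule lookup_sum_single[of ?S "\<lambda>s. s"]) simp
  also have "{s\<in>?S. s = t} = (if t \<in> keys p then {t} else {})" using assms by auto
  finally show ?thesis by (auto simp: in_keys_iff)
qed

lemma free_part_polys: "p \<in> polys X \<Longrightarrow> free_part d p \<in> polys (X - {d})"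
proof -
  assume p: "p \<in> polys X"
  have "keys t \<subseteq> X - {d}" if t: "t \<in> keys (free_part d p)" for t
  proof -
    have "t \<in> keys p" "lookup t d = 0" using subsetD[OF keys_free_part t] by simp_all
    then show ?thesis using p by (auto simp: polys_keys in_keys_iff)
  qed
  then show ?thesis by (simp add: polys_keys)
qed

lemma quotient_part_polys: "p \<in> polys X \<Longrightarrow> quotient_part d p \<in> polys X"
proof -
  assume p: "p \<in> polys X"
  have "keys t \<subseteq> X" if t: "t \<in> keys (quotient_part d p)" for t
  proof -
    obtain s where s: "s \<in> keys p" "t = s - single d 1"
      using subsetD[OF keys_quotient_part t] by blast
    have "keys t \<subseteq> keys s" by (auto simp: s(2) in_keys_iff lookup_minus)
    then show ?thesis using p s(1) by (auto simp: polys_keys)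
  qed
  then show ?thesis by (simp add: polys_keys)
qed

lemma homogeneous_bi_invariant:
  assumes "keys c \<subseteq> {t. monom_weight weight t = m}"
  shows "psubst bi_inv c \<in> bi_invariants 4 m"
  unfolding bi_invariants_iff
proof (intro conjI allI impI)
  show "psubst bi_inv c \<in> jet_ring 4"
    unfolding jet_ring_def
    by (rule psubst_polys[OF polys_UNIV]) (rule bi_inv_jet_ring[unfolded jet_ring_def])
next
  fix p :: "nat \<Rightarrow> complex" and x :: "nat \<times> nat \<Rightarrow> complex"
  assume p: "p 1 \<noteq> 0"
  have "pvalue (reparam p x) (psubst bi_inv c) =
      (\<Sum>t\<in>keys c. lookup c t * (p 1 ^ monom_weight weight t * mono_eval (\<lambda>v. pvalue x (bi_inv v)) t))"
    unfolding pvalue_psubst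
    by (simp add: pvalue_conv_sum[of _ c] bi_inv_reparam[of p, OF p] mono_eval_mult mono_eval_power del: bi_inv.simps One_nat_def)
  also have "\<dots> = (\<Sum>t\<in>keys c. p 1 ^ m * (lookup c t * mono_eval (\<lambda>v. pvalue x (bi_inv v)) t))"
    by (rule sum.cong) (use assms in \<open>auto simp: mult_ac\<close>)
  also have "\<dots> = p 1 ^ m * pvalue x (psubst bi_inv c)"
    unfolding pvalue_psubst by (simp add: pvalue_conv_sum[of _ c] sum_distrib_left del: bi_inv.simps)
  finally show "pvalue (reparam p x) (psubst bi_inv c) = p 1 ^ m * pvalue x (psubst bi_inv c)" .
next
  fix u :: "nat \<Rightarrow> nat \<Rightarrow> complex" and x :: "nat \<times> nat \<Rightarrow> complex"
  show "pvalue (unipotent u x) (psubst bi_inv c) = pvalue x (psubst bi_inv c)"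
    unfolding pvalue_psubst bi_inv_unipotent ..
qed

text \<open>Divisibility and reduction give a normal form, but not yet homogeneity. The scaling with
  \<open>p 1 = 2\<close> multiplies each monomial by 2 to its weight and \<open>P\<close> by
  \<open>2 ^ m\<close>; uniqueness of normal forms then leaves only the weight
  \<open>m\<close>.\<close>

lemma bi_invariant_normal_form:
  assumes P: "P \<in> bi_invariants 4 m"
  shows "\<exists>N. keys N \<subseteq> {t. nf.normal t \<and> monom_weight weight t = m} \<and> P = psubst bi_inv N"
proof -
  obtain k S where "jet 1 1 ^ k * P = psubst bi_inv S" using generated_up_to_f1[OF P] by blast
  then obtain T where T: "P = psubst bi_inv T" using nd.divide_power[of k P S] by auto
  obtain N where N: "keys N \<subseteq> {t. nf.normal t}" "psubst bi_inv N = P"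
    using nf.reduce[of T] T by auto
  define p :: "nat \<Rightarrow> complex" where "p k = (if k = 1 then 2 else 0)" for k
  define N2 where "N2 = (\<Sum>t\<in>keys N. single t (2 ^ monom_weight weight t * lookup N t))"
  have N2: "lookup N2 t = 2 ^ monom_weight weight t * lookup N t" for t
  proof -
    have "lookup N2 t = (\<Sum>s\<in>{s\<in>keys N. s = t}. 2 ^ monom_weight weight s * lookup N s)"
      unfolding N2_def by (rule lookup_sum_single[of _ "\<lambda>s. s"]) simp
    also have "{s\<in>keys N. s = t} = (if t \<in> keys N then {t} else {})" by auto
    finally show ?thesis by (auto simp: in_keys_iff)
  qed
  have "psubst bi_inv N2 = psubst bi_inv (Const (2 ^ m) * N)"
  proof (rule mpoly_eqI)
    fix x :: "nat \<times> nat \<Rightarrow> complex"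
    have "pvalue x (psubst bi_inv N2) =
      (\<Sum>t\<in>keys N. lookup N t * (2 ^ monom_weight weight t * mono_eval (\<lambda>v. pvalue x (bi_inv v)) t))"
      unfolding pvalue_psubst N2_def by (simp add: pv.peval_single mult_ac del: bi_inv.simps)
    also have "\<dots> = pvalue (\<lambda>v. 2 ^ weight v * pvalue x (bi_inv v)) N"
      by (simp add: pvalue_conv_sum[of _ N] mono_eval_mult mono_eval_power del: bi_inv.simps)
    also have "\<dots> = pvalue (reparam p x) (psubst bi_inv N)"
      unfolding pvalue_psubst by (simp add: bi_inv_reparam p_def del: bi_inv.simps)
    also have "\<dots> = 2 ^ m * pvalue x P"
      unfolding N(2) using P by (simp add: bi_invariants_iff p_def)
    finally show "pvalue x (psubst bi_inv N2) = pvalue x (psubst bi_inv (Const (2 ^ m) * N))"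
      by (simp add: N(2))
  qed
  moreover have "keys N2 \<subseteq> {t. nf.normal t}" "keys (Const (2 ^ m) * N) \<subseteq> {t. nf.normal t}"
    using N(1) by (auto simp: in_keys_iff N2 lookup_Const_mult)
  ultimately have eq: "N2 = Const (2 ^ m) * N" using nd.normal_eq by blast
  have "monom_weight weight t = m" if "t \<in> keys N" for t
  proof -
    have "2 ^ monom_weight weight t * lookup N t = 2 ^ m * lookup N t"
      using arg_cong[OF eq, of "\<lambda>q. lookup q t"] by (simp add: N2 lookup_Const_mult)
    then have "(2::complex) ^ monom_weight weight t = 2 ^ m" using that by (simp add: in_keys_iff)
    then have "norm ((2::complex) ^ monom_weight weight t) = norm ((2::complex) ^ m)" by simp
    then have "(2::real) ^ monom_weight weight t = 2 ^ m" by (simp add: norm_power)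
    then show ?thesis by simp
  qed
  then show ?thesis using N by blast
qed

section \<open>Dimension three: forgetting the fourth function\<close>

definition without_f4 :: "(nat \<times> nat \<Rightarrow> complex) \<Rightarrow> nat \<times> nat \<Rightarrow> complex" where
  "without_f4 x = (\<lambda>(i, l). if i = 4 then 0 else x (i, l))"

lemma pvalue_without_f4: "P \<in> jet_ring 3 \<Longrightarrow> pvalue (without_f4 x) P = pvalue x P"
  unfolding jet_ring_def by (rule pvalue_cong_polys) (auto simp: without_f4_def)

lemma bi_inv_without_f4:
  "pvalue (without_f4 x) (bi_inv v) = (if v = W10 then 0 else pvalue x (bi_inv v))"
  using pvalue_without_f4[OF bi_inv_jet_ring_3[of v], of x]
  by (auto simp: pvalue_bi_inv(1) minor4_def without_f4_def simp del: bi_inv.simps)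

lemma pvalue_free_part_W10: "pvalue x (psubst bi_inv (free_part W10 p)) = pvalue (without_f4 x) (psubst bi_inv p)"
proof -
  have "pvalue (without_f4 x) (psubst bi_inv p) = pvalue (without_f4 x) (psubst bi_inv (free_part W10 p))"
    by (subst split_variable[of p W10]) (simp add: bi_inv_without_f4 del: bi_inv.simps)
  also have "\<dots> = pvalue x (psubst bi_inv (free_part W10 p))"
    unfolding pvalue_psubst
    by (rule pvalue_cong_polys[OF free_part_polys[OF polys_UNIV]]) (simp add: bi_inv_without_f4 del: bi_inv.simps)
  finally show ?thesis by simp
qed

lemma bi_invariants_3_4: "P \<in> bi_invariants 3 m \<Longrightarrow> P \<in> bi_invariants 4 m"
  by (auto simp: bi_invariants_iff jet_ring_def intro: polys_mono)

text \<open>A bi-invariant in dimension three is one in dimension four. Setting the fourth function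
  to 0 does not change it, but removes from its normal form all monomials with
  \<open>W10\<close>.\<close>

lemma bi_invariant_3_normal_form:
  assumes P: "P \<in> bi_invariants 3 m"
  shows "\<exists>N. keys N \<subseteq> {t. nf.normal t \<and> monom_weight weight t = m \<and> lookup t W10 = 0} \<and>
    P = psubst bi_inv N"
proof -
  obtain N where N: "keys N \<subseteq> {t. nf.normal t \<and> monom_weight weight t = m}" "P = psubst bi_inv N"
    using bi_invariant_normal_form[OF bi_invariants_3_4[OF P]] by blast
  have "P = psubst bi_inv (free_part W10 N)"
  proof (rule mpoly_eqI)
    fix x :: "nat \<times> nat \<Rightarrow> complex"
    have "pvalue x P = pvalue (without_f4 x) P"
      using pvalue_without_f4[of P x] P by (simp add: bi_invariants_iff)
    then show "pvalue x P = pvalue x (psubst bi_inv (free_part W10 N))"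
      by (simp only: pvalue_free_part_W10 N(2))
  qed
  moreover have "keys (free_part W10 N) \<subseteq>
      {t. nf.normal t \<and> monom_weight weight t = m \<and> lookup t W10 = 0}"
    using keys_free_part[of W10 N] N(1) by blast
  ultimately show ?thesis by blast
qed

lemma homogeneous_bi_invariant_3:
  assumes "keys c \<subseteq> {t. monom_weight weight t = m}" "c \<in> polys (UNIV - {W10})"
  shows "psubst bi_inv c \<in> bi_invariants 3 m"
proof -
  have "psubst bi_inv c \<in> jet_ring 3"
    unfolding jet_ring_def
    by (rule psubst_polys[OF assms(2)]) (use bi_inv_jet_ring_3 in \<open>simp add: jet_ring_def del: bi_inv.simps\<close>)
  then show ?thesis using homogeneous_bi_invariant[OF assms(1)] by (simp add: bi_invariants_iff)
qed

lemma UE_eq_generated_algebra: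
  assumes generated: "\<And>m P. P \<in> bi_invariants n m \<Longrightarrow> \<exists>N\<in>polys X. P = psubst bi_inv N"
    and invariant: "\<And>m c. keys c \<subseteq> {t. monom_weight weight t = m} \<Longrightarrow> c \<in> polys X \<Longrightarrow>
      psubst bi_inv c \<in> bi_invariants n m"
  shows "UE n = generated_algebra bi_inv X"
proof (intro equalityI subsetI)
  fix Q assume "Q \<in> UE n"
  then obtain M P where MP: "finite M" "\<forall>m\<in>M. P m \<in> bi_invariants n m" "Q = (\<Sum>m\<in>M. P m)"
    by (auto simp: UE_def)
  have "\<exists>N. N \<in> polys X \<and> P m = psubst bi_inv N" if "m \<in> M" for m
    using generated MP(2) that by blast
  then have "\<forall>m\<in>M. \<exists>N. N \<in> polys X \<and> P m = psubst bi_inv N" by blast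
  then obtain N where N: "\<forall>m\<in>M. N m \<in> polys X \<and> P m = psubst bi_inv (N m)"
    by (rule exE[OF bchoice])
  have "Q = psubst bi_inv (\<Sum>m\<in>M. N m)" using N MP(3) by simp
  moreover have "(\<Sum>m\<in>M. N m) \<in> polys X" using N by (intro sum_polys) blast
  ultimately show "Q \<in> generated_algebra bi_inv X" unfolding generated_algebra_def by blast
next
  fix Q assume "Q \<in> generated_algebra bi_inv X"
  then obtain p where p: "p \<in> polys X" "Q = psubst bi_inv p" by (auto simp: generated_algebra_def)
  define c where "c m = (\<Sum>t\<in>{t\<in>keys p. monom_weight weight t = m}. single t (lookup p t))" for m
  have keys: "keys (c m) \<subseteq> {t\<in>keys p. monom_weight weight t = m}" for m
    unfolding c_def by (rule order.trans[OF Poly_Mapping.keys_sum]) (auto split: if_splits)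
  have "(\<Sum>m\<in>monom_weight weight ` keys p. c m) = p"
    unfolding c_def using sum.image_gen[of "keys p" "\<lambda>t. single t (lookup p t)" "monom_weight weight"]
    by (simp add: mpoly_sum_monomials)
  then have "Q = (\<Sum>m\<in>monom_weight weight ` keys p. psubst bi_inv (c m))"
    using p(2) by (metis ps.peval_sum)
  moreover have "psubst bi_inv (c m) \<in> bi_invariants n m" for m
    by (rule invariant) (use keys[of m] p(1) in \<open>auto simp: polys_keys\<close>)
  ultimately show "Q \<in> UE n" unfolding UE_def
    by (intro CollectI exI[of _ "monom_weight weight ` keys p"] exI[of _ "\<lambda>m. psubst bi_inv (c m)"]) simp
qed

lemma first_monom_degree: "(l, r) \<in> gen_rules \<Longrightarrow> 2 \<le> monom_weight (\<lambda>_. 1) l"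
  by (auto simp: gen_rules_def rule_of_def first_monom_eq monom_weight_monom_of sum_list_triv relation_ok_def
      dest!: relation_okD)

text \<open>All leading monomials have degree at least 2, so \<open>Var v\<close> is its own normal
  form. A polynomial \<open>S\<close> with the same value would reduce to \<open>Var v\<close>; by
  \<open>gen_order\<close> a monomial of degree 1 arises only from itself, so \<open>S\<close> would
  contain \<open>v\<close>.\<close>

lemma bi_inv_mutually_independent: "mutually_independent bi_inv"
  unfolding mutually_independent_def
proof (intro allI notI)
  fix v assume "bi_inv v \<in> generated_algebra bi_inv (UNIV - {v})"
  then obtain S where S: "S \<in> polys (UNIV - {v})" "bi_inv v = psubst bi_inv S"
    by (auto simp: generated_algebra_def)
  obtain N where N: "keys N \<subseteq> {s. nf.normal s \<and> (\<exists>t\<in>keys S. gen_order t s)}"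
    "psubst bi_inv N = psubst bi_inv S"
    using nf.reduce[of S] by auto
  have "nf.normal (single v 1)"
    unfolding nf.normal_def
  proof (intro conjI notI)
    assume "\<exists>(l, r)\<in>gen_rules. \<exists>\<gamma>. single v 1 = l + \<gamma>"
    then obtain l r \<gamma> where lr: "(l, r) \<in> gen_rules" "single v 1 = l + \<gamma>" by blast
    have "monom_weight (\<lambda>_. 1) (single v 1) = monom_weight (\<lambda>_. 1) l + monom_weight (\<lambda>_. 1) \<gamma>"
      by (simp only: lr(2) monom_weight_add)
    then show False using first_monom_degree[OF lr(1)] by simp
  qed simp
  then have "keys (Var v) \<subseteq> {t. nf.normal t}" by (simp add: Var_def)
  moreover have "keys N \<subseteq> {t. nf.normal t}" using N(1) by blast
  moreover have "psubst bi_inv N = psubst bi_inv (Var v)"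
    by (simp add: N(2) S(2)[symmetric] del: bi_inv.simps)
  ultimately have "N = Var v" using nd.normal_eq by blast
  then have "single v 1 \<in> keys N" by (simp add: Var_def)
  then obtain t where t: "t \<in> keys S" "gen_order t (single v 1)" using N(1) by blast
  then have "t = single v 1" by (auto simp: gen_order_def not_le)
  then show False using S(1) t(1) by (auto simp: polys_keys)
qed

section \<open>The reduced Groebner basis\<close>

lemma lead_monomI:
  assumes "t \<in> keys p" "\<And>s. s \<in> keys p \<Longrightarrow> s \<noteq> t \<Longrightarrow> lex_less vs s t"
  shows "lead_monom (lex_less vs) p = t"
  unfolding lead_monom_def
proof (rule the_equality)
  fix u assume u: "u \<in> keys p \<and> (\<forall>s\<in>keys p. s \<noteq> u \<longrightarrow> lex_less vs s u)"
  show "u = t"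
  proof (rule ccontr)
    assume "u \<noteq> t"
    then have "lex_less vs u t" "lex_less vs t u" using u assms by auto
    then show False using lex_less_trans lex_less_irrefl by blast
  qed
qed (use assms in blast)

lemma lex_max_exists:
  assumes "finite S" "S \<noteq> {}" "\<And>s. s \<in> S \<Longrightarrow> keys s \<subseteq> set vs"
  shows "\<exists>t\<in>S. \<forall>s\<in>S. s \<noteq> t \<longrightarrow> lex_less vs s t"
  using assms
proof (induction S rule: finite_ne_induct)
  case (insert u S)
  then obtain t where t: "t \<in> S" "\<forall>s\<in>S. s \<noteq> t \<longrightarrow> lex_less vs s t" by auto
  consider "lex_less vs u t" | "lex_less vs t u" | "u = t"
  proof -
    have "u = t" if "\<forall>v\<in>set vs. lookup u v = lookup t v"
    proof (rule poly_mapping_eqI)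
      fix v
      show "lookup u v = lookup t v"
      proof (cases "v \<in> set vs")
        case False
        then have "v \<notin> keys u" "v \<notin> keys t" using insert.prems t(1) by blast+
        then show ?thesis by (simp add: in_keys_iff)
      qed (use that in blast)
    qed
    then show thesis using that lex_less_total[of vs u t] by blast
  qed
  then show ?case
  proof cases
    case 2
    have "lex_less vs s u" if "s \<in> S" for s
      using t(2) that 2 lex_less_trans by (cases "s = t") blast+
    then show ?thesis by blast
  qed (use t in blast)+
qed simp

lemma relation_lift_exists: "r \<in> set relations \<Longrightarrow> \<exists>cv. (r, cv) \<in> set (zip relations lifts)"
  using list_all2_lengthD[OF relations_ok] in_set_impl_in_set_zip1[of relations lifts r] by force

abbreviation first_coeff :: "(int \<times> gen list) list \<Rightarrow> complex" where
  "first_coeff r \<equiv> of_int (fst (hd r))"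

lemma lookup_monom_of_fun: "lookup (monom_of us) = count_list us"
  by (rule ext) (rule lookup_monom_of)

lemma relation_lead:
  assumes r: "r \<in> set relations"
  shows "first_coeff r \<noteq> 0" "lookup (relation_poly r) (first_monom r) = first_coeff r"
    "s \<in> keys (relation_poly r) \<Longrightarrow> s = first_monom r \<or> s \<in> monom_of ` snd ` set (tl r)"
    "s \<in> keys (relation_poly r) \<Longrightarrow> s \<noteq> first_monom r \<Longrightarrow> lex14 s (first_monom r)"
    "relation_poly r \<in> polys (set gens14)"
proof -
  obtain cv where ok: "relation_ok r cv" using relation_lift_exists[OF r] relation_okD by blast
  then show c: "first_coeff r \<noteq> 0" by (simp add: relation_ok_def)
  let ?T = "\<Sum>(k, us)\<leftarrow>tl r. single (monom_of us) (of_int k :: complex)"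
  have eq: "relation_poly r = single (first_monom r) (first_coeff r) + ?T"
    using ok by (cases r) (auto simp: relation_poly_conv first_monom_eq relation_ok_def)
  have tail: "lex14 s (first_monom r)" if "s \<in> monom_of ` snd ` set (tl r)" for s
    using ok that by (auto simp: relation_ok_def lex_less_iff first_monom_eq lookup_monom_of_fun)
  have "first_monom r \<notin> keys ?T"
    using keys_sum_list_single[of "tl r"] tail lex_less_irrefl by blast
  then show "lookup (relation_poly r) (first_monom r) = first_coeff r"
    by (simp add: eq lookup_add in_keys_iff)
  have keys: "s = first_monom r \<or> s \<in> monom_of ` snd ` set (tl r)" if "s \<in> keys (relation_poly r)" for s
    using subsetD[OF Poly_Mapping.keys_add that[unfolded eq]] keys_sum_list_single[of "tl r"] by (auto split: if_splits)
  then show "s \<in> keys (relation_poly r) \<Longrightarrow> s = first_monom r \<or> s \<in> monom_of ` snd ` set (tl r)" .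
  show "s \<in> keys (relation_poly r) \<Longrightarrow> s \<noteq> first_monom r \<Longrightarrow> lex14 s (first_monom r)"
    using keys tail by blast
  have "keys s \<subseteq> set gens14" if "s \<in> keys (relation_poly r)" for s
    using keys[OF that] ok by (fastforce simp: first_monom_eq keys_monom_of relation_ok_def)
  then show "relation_poly r \<in> polys (set gens14)" by (simp add: polys_keys)
qed

lemma lead_monom_relation: "r \<in> set relations \<Longrightarrow> lead_monom lex14 (relation_poly r) = first_monom r"
  using relation_lead[of r] by (intro lead_monomI) (auto simp: in_keys_iff)

text \<open>The leading monomials involve neither \<open>F1\<close> nor \<open>W10\<close>, so
  powers of these two can be split off without affecting divisibility.\<close>

lemma normal_exponents_eq: "normal_exponents m = {t. nf.normal t \<and> monom_weight weight t = m}"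
proof -
  have box: "(\<Union>r\<in>set relations. box r) = {first_monom r + \<gamma> | r \<gamma>. r \<in> set relations \<and> \<gamma> \<in> exponents14}"
    by (auto simp: box_def lead_monom_relation)
  have dvd: "(\<exists>(l, q)\<in>gen_rules. \<exists>\<gamma>. t = l + \<gamma>) \<longleftrightarrow> (\<exists>r\<in>set relations. \<exists>\<gamma>. t = first_monom r + \<gamma>)" for t
  proof -
    have "(\<exists>(l, q)\<in>gen_rules. \<exists>\<gamma>. t = l + \<gamma>) \<longleftrightarrow> (\<exists>l\<in>fst ` gen_rules. \<exists>\<gamma>. t = l + \<gamma>)" by force
    then show ?thesis by (simp add: fst_gen_rules)
  qed
  have first14: "lookup (first_monom r) F1 = 0 \<and> lookup (first_monom r) W10 = 0"
    if r: "r \<in> set relations" for r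
  proof -
    obtain cv where "relation_ok r cv" using relation_lift_exists[OF r] relation_okD by blast
    then show ?thesis using lookup_gens14_0 by (simp add: relation_ok_def first_monom_eq lookup_monom_of)
  qed
  have gens: "v = F1 \<or> v = W10 \<or> v \<in> set gens14" for v by (cases v) (simp_all add: gens14_def)
  show ?thesis
  proof (intro equalityI subsetI)
    fix t assume "t \<in> normal_exponents m"
    then obtain a p \<beta> where t: "t = single F1 a + single W10 p + \<beta>"
      and \<beta>: "\<beta> \<in> exponents14" "\<beta> \<notin> (\<Union>r\<in>set relations. box r)" "weighted_degree \<beta> + a + 10 * p = m"
      by (auto simp: normal_exponents_def)
    have "monom_weight weight t = m"
      using \<beta>(3) by (simp add: t monom_weight_add weighted_degree_eq)
    moreover have "nf.normal t"
      unfolding nf.normal_def dvd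
    proof (intro conjI notI)
      assume "\<exists>r\<in>set relations. \<exists>\<gamma>. t = first_monom r + \<gamma>"
      then obtain r \<gamma> where r: "r \<in> set relations" "t = first_monom r + \<gamma>" by blast
      define \<gamma>' where "\<gamma>' = \<gamma> - (single F1 a + single W10 p)"
      have at: "lookup (single F1 a + single W10 p + \<beta>) v =
          lookup (first_monom r + \<gamma>) v" for v using t r(2) by simp
      have \<beta>0: "lookup \<beta> F1 = 0" "lookup \<beta> W10 = 0"
        using \<beta>(1) by (auto simp: exponents14_def gens14_def in_keys_iff)
      have "\<beta> = first_monom r + \<gamma>'"
      proof (rule poly_mapping_eqI)
        fix v
        show "lookup \<beta> v = lookup (first_monom r + \<gamma>') v"
          using at[of v] first14[OF r(1)] \<beta>0 gens[of v]
          by (auto simp: \<gamma>'_def lookup_add lookup_minus lookup_single when_def gens14_def split: if_splits)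
      qed
      moreover from this have "\<gamma>' \<in> exponents14"
        using \<beta>(1) by (auto simp: exponents14_def keys_monom_add)
      ultimately have "\<beta> \<in> (\<Union>r\<in>set relations. box r)" unfolding box using r(1) by blast
      then show False using \<beta>(2) by blast
    qed simp
    ultimately show "t \<in> {t. nf.normal t \<and> monom_weight weight t = m}" by simp
  next
    fix t assume "t \<in> {t. nf.normal t \<and> monom_weight weight t = m}"
    then have t: "nf.normal t" "monom_weight weight t = m" by auto
    define a where "a = lookup t F1"
    define p where "p = lookup t W10"
    define \<beta> where "\<beta> = t - (single F1 a + single W10 p)"
    have eq: "t = single F1 a + single W10 p + \<beta>"
      by (rule poly_mapping_eqI)
         (auto simp: \<beta>_def a_def p_def lookup_add lookup_minus lookup_single when_def)
    have \<beta>0: "lookup \<beta> F1 = 0" "lookup \<beta> W10 = 0"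
      by (auto simp: \<beta>_def a_def p_def lookup_add lookup_minus lookup_single when_def)
    have "\<beta> \<in> exponents14"
      unfolding exponents14_def
    proof (intro CollectI subsetI)
      fix v assume "v \<in> keys \<beta>"
      then show "v \<in> set gens14" using gens[of v] \<beta>0 by (auto simp: in_keys_iff)
    qed
    moreover have "\<beta> \<notin> (\<Union>r\<in>set relations. box r)"
    proof
      assume "\<beta> \<in> (\<Union>r\<in>set relations. box r)"
      then obtain r \<gamma> where r: "r \<in> set relations" "\<beta> = first_monom r + \<gamma>" unfolding box by blast
      then have "t = first_monom r + (\<gamma> + single F1 a + single W10 p)"
        by (subst eq) (simp add: ac_simps)
      then show False using t(1) r(1) unfolding nf.normal_def dvd by blast
    qed
    moreover have "weighted_degree \<beta> + a + 10 * p = m"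
      using t(2) by (simp add: weighted_degree_eq eq monom_weight_add)
    ultimately show "t \<in> normal_exponents m" unfolding normal_exponents_def using eq by blast
  qed
qed

lemma unique_normal_form_4: "unique_normal_form 4 normal_exponents"
  unfolding unique_normal_form_def normal_exponents_eq
proof (intro allI conjI ballI impI)
  fix m P assume P: "P \<in> bi_invariants 4 m"
  show "\<exists>!c. keys c \<subseteq> {t. nf.normal t \<and> monom_weight weight t = m} \<and> P = psubst bi_inv c"
  proof (rule ex_ex1I)
    show "\<exists>c. keys c \<subseteq> {t. nf.normal t \<and> monom_weight weight t = m} \<and> P = psubst bi_inv c"
      by (rule bi_invariant_normal_form[OF P])
    fix c c' :: "gen mpoly"
    assume "keys c \<subseteq> {t. nf.normal t \<and> monom_weight weight t = m} \<and> P = psubst bi_inv c"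
      "keys c' \<subseteq> {t. nf.normal t \<and> monom_weight weight t = m} \<and> P = psubst bi_inv c'"
    then show "c = c'" by (intro nd.normal_eq) auto
  qed
next
  fix m and c :: "gen mpoly"
    assume "keys c \<subseteq> {t. nf.normal t \<and> monom_weight weight t = m}"
  then show "psubst bi_inv c \<in> bi_invariants 4 m" by (intro homogeneous_bi_invariant) auto
qed

lemma unique_normal_form_3: "unique_normal_form 3 normal_exponents_without_W10"
proof -
  have eq: "normal_exponents_without_W10 m = {t. nf.normal t \<and> monom_weight weight t = m \<and> lookup t W10 = 0}" for m
    by (auto simp: normal_exponents_without_W10_def normal_exponents_eq)
  show ?thesis
    unfolding unique_normal_form_def eq
  proof (intro allI conjI ballI impI)
    fix m P assume P: "P \<in> bi_invariants 3 m"
    let ?S = "{t. nf.normal t \<and> monom_weight weight t = m \<and> lookup t W10 = 0}"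
    show "\<exists>!c. keys c \<subseteq> ?S \<and> P = psubst bi_inv c"
    proof (rule ex_ex1I)
      show "\<exists>c. keys c \<subseteq> ?S \<and> P = psubst bi_inv c" by (rule bi_invariant_3_normal_form[OF P])
      fix c c' :: "gen mpoly"
    assume "keys c \<subseteq> ?S \<and> P = psubst bi_inv c" "keys c' \<subseteq> ?S \<and> P = psubst bi_inv c'"
      then show "c = c'" by (intro nd.normal_eq) auto
    qed
  next
    fix m and c :: "gen mpoly"
    assume "keys c \<subseteq> {t. nf.normal t \<and> monom_weight weight t = m \<and> lookup t W10 = 0}"
    then show "psubst bi_inv c \<in> bi_invariants 3 m"
      by (intro homogeneous_bi_invariant_3) (auto simp: polys_keys in_keys_iff)
  qed
qed

lemma UE_4: "UE 4 = generated_algebra bi_inv UNIV"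
proof (rule UE_eq_generated_algebra)
  fix m P assume "P \<in> bi_invariants 4 m"
  then obtain N where "P = psubst bi_inv N" using bi_invariant_normal_form by blast
  then show "\<exists>N\<in>polys UNIV. P = psubst bi_inv N" by (intro bexI[of _ N]) simp_all
qed (rule homogeneous_bi_invariant)

lemma UE_3: "UE 3 = generated_algebra bi_inv (UNIV - {W10})"
proof (rule UE_eq_generated_algebra)
  fix m P assume "P \<in> bi_invariants 3 m"
  then obtain N where "keys N \<subseteq> {t. nf.normal t \<and> monom_weight weight t = m \<and> lookup t W10 = 0}"
    "P = psubst bi_inv N" using bi_invariant_3_normal_form by blast
  then show "\<exists>N\<in>polys (UNIV - {W10}). P = psubst bi_inv N"
    by (intro bexI[of _ N]) (auto simp: polys_keys in_keys_iff)
qed (rule homogeneous_bi_invariant_3)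

section \<open>Closure properties of generated ideals\<close>

lemma ideal_generatedI:
  "g \<in> G \<Longrightarrow> q \<in> polys X \<Longrightarrow> q * g \<in> ideal_generated X G"
  unfolding ideal_generated_def by (intro CollectI exI[of _ "{g}"] exI[of _ "\<lambda>_. q"]) simp

lemma ideal_generated_0: "0 \<in> ideal_generated X G"
  unfolding ideal_generated_def by (intro CollectI exI[of _ "{}"]) simp

lemma ideal_generated_add:
  assumes "a \<in> ideal_generated X G" "b \<in> ideal_generated X G"
  shows "a + b \<in> ideal_generated X G"
proof -
  obtain F q where F: "finite F" "F \<subseteq> G" "\<forall>g\<in>F. q g \<in> polys X" "a = (\<Sum>g\<in>F. q g * g)"
    using assms(1) unfolding ideal_generated_def by blast
  obtain F' q' where F': "finite F'" "F' \<subseteq> G" "\<forall>g\<in>F'. q' g \<in> polys X" "b = (\<Sum>g\<in>F'. q' g * g)"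
    using assms(2) unfolding ideal_generated_def by blast
  define Q where "Q g = (if g \<in> F then q g else 0) + (if g \<in> F' then q' g else 0)" for g
  have "(\<Sum>g\<in>F \<union> F'. (if g \<in> F then q g else 0) * g) = a"
    unfolding F(4) by (rule sum.mono_neutral_cong_right) (use F(1) F'(1) in auto)
  moreover have "(\<Sum>g\<in>F \<union> F'. (if g \<in> F' then q' g else 0) * g) = b"
    unfolding F'(4) by (rule sum.mono_neutral_cong_right) (use F(1) F'(1) in auto)
  ultimately have "a + b = (\<Sum>g\<in>F \<union> F'. Q g * g)"
    by (simp add: Q_def distrib_right sum.distrib)
  moreover have "\<forall>g\<in>F \<union> F'. Q g \<in> polys X" using F(3) F'(3) by (auto simp: Q_def)
  moreover have "finite (F \<union> F')" "F \<union> F' \<subseteq> G" using F F' by auto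
  ultimately show ?thesis unfolding ideal_generated_def by blast
qed

lemma ideal_generated_mult:
  assumes "a \<in> ideal_generated X G" "p \<in> polys X"
  shows "p * a \<in> ideal_generated X G"
proof -
  obtain F q where F: "finite F" "F \<subseteq> G" "\<forall>g\<in>F. q g \<in> polys X" "a = (\<Sum>g\<in>F. q g * g)"
    using assms(1) unfolding ideal_generated_def by blast
  have "p * a = (\<Sum>g\<in>F. (p * q g) * g)" by (simp add: F(4) sum_distrib_left mult.assoc)
  moreover have "\<forall>g\<in>F. p * q g \<in> polys X" using F(3) assms(2) by auto
  ultimately show ?thesis unfolding ideal_generated_def using F(1,2)
    by (intro CollectI exI[of _ F] exI[of _ "\<lambda>g. p * q g"]) blast
qed

lemma ideal_generated_sum:
  "(\<And>i. i \<in> I \<Longrightarrow> a i \<in> ideal_generated X G) \<Longrightarrow> (\<Sum>i\<in>I. a i) \<in> ideal_generated X G"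
  by (induction I rule: infinite_finite_induct) (auto simp: ideal_generated_0 ideal_generated_add)

lemma ideal_generated_subset:
  assumes "\<And>g. g \<in> G \<Longrightarrow> g \<in> ideal_generated X H"
  shows "ideal_generated X G \<subseteq> ideal_generated X H"
proof
  fix a assume "a \<in> ideal_generated X G"
  then obtain F q where F: "finite F" "F \<subseteq> G" "\<forall>g\<in>F. q g \<in> polys X" "a = (\<Sum>g\<in>F. q g * g)"
    unfolding ideal_generated_def by blast
  show "a \<in> ideal_generated X H" unfolding F(4)
    by (intro ideal_generated_sum ideal_generated_mult assms) (use F in auto)
qed

lemma monomial_in_monomial_ideal:
  assumes "single t (1::complex) \<in> ideal_generated X S"
    and S: "\<And>g. g \<in> S \<Longrightarrow> \<exists>m c. g = single m c \<and> m \<in> M"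
  shows "\<exists>m\<in>M. \<exists>\<gamma>. t = m + \<gamma>"
proof -
  obtain F q where F: "F \<subseteq> S" "single t 1 = (\<Sum>g\<in>F. q g * g)"
    using assms(1) unfolding ideal_generated_def by blast
  have "t \<in> keys (\<Sum>g\<in>F. q g * g)" by (simp flip: F(2))
  from subsetD[OF Poly_Mapping.keys_sum this]
  obtain g where g: "g \<in> F" "t \<in> keys (q g * g)" by blast
  obtain m c where m: "g = single m c" "m \<in> M" using S F(1) g(1) by blast
  obtain \<gamma> u where "t = \<gamma> + u" "u \<in> keys g"
    using subsetD[OF Poly_Mapping.keys_mult g(2)] by blast
  then have "t = m + \<gamma>" by (simp add: m(1) add.commute split: if_splits)
  then show ?thesis using m(2) by blast
qed

section \<open>The ideal of relations on the hyperplane\<close>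

lemma relation_ideal_iff:
  "p \<in> relation_ideal X \<longleftrightarrow> p \<in> polys X \<and> (\<forall>x. x (1, 1) = 0 \<longrightarrow> pvalue x (psubst bi_inv p) = 0)"
proof -
  have val: "pvalue x (psubst (\<lambda>v. restrict (bi_inv v)) p) = pvalue (x((1, 1) := 0)) (psubst bi_inv p)" for x
    by (simp add: pvalue_psubst pvalue_restrict del: bi_inv.simps)
  have "psubst (\<lambda>v. restrict (bi_inv v)) p = 0 \<longleftrightarrow> (\<forall>x. x (1, 1) = 0 \<longrightarrow> pvalue x (psubst bi_inv p) = 0)"
  proof
    assume L: "psubst (\<lambda>v. restrict (bi_inv v)) p = 0"
    show "\<forall>x. x (1, 1) = 0 \<longrightarrow> pvalue x (psubst bi_inv p) = 0"
    proof (intro allI impI)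
      fix x :: "nat \<times> nat \<Rightarrow> complex" assume "x (1, 1) = 0"
      then have "x((1, 1) := 0) = x" by auto
      then show "pvalue x (psubst bi_inv p) = 0" using val[of x] by (simp only: L pv.peval_0)
    qed
  next
    assume R: "\<forall>x. x (1, 1) = 0 \<longrightarrow> pvalue x (psubst bi_inv p) = 0"
    show "psubst (\<lambda>v. restrict (bi_inv v)) p = 0"
    proof (rule mpoly_zeroI)
      fix x :: "nat \<times> nat \<Rightarrow> complex"
      have "pvalue (x((1, 1) := 0)) (psubst bi_inv p) = 0" by (rule R[rule_format]) simp
      then show "pvalue x (psubst (\<lambda>v. restrict (bi_inv v)) p) = 0" by (simp only: val)
    qed
  qed
  then show ?thesis by (simp add: relation_ideal_def)
qed

lemma relation_ideal_mult:
  "a \<in> relation_ideal X \<Longrightarrow> p \<in> polys X \<Longrightarrow> p * a \<in> relation_ideal X"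
  by (simp add: relation_ideal_iff polys_closed)

lemma relation_ideal_sum:
  "(\<And>i. i \<in> I \<Longrightarrow> a i \<in> relation_ideal X) \<Longrightarrow> (\<Sum>i\<in>I. a i) \<in> relation_ideal X"
  by (simp add: relation_ideal_iff sum_polys del: bi_inv.simps)

lemma relation_ideal_mono: "X \<subseteq> Y \<Longrightarrow> relation_ideal X = relation_ideal Y \<inter> polys X"
  by (auto simp: relation_ideal_def intro: polys_mono)

lemma set_gens14: "set gens14 = UNIV - {F1} - {W10}"
proof -
  have "v \<in> set gens14 \<longleftrightarrow> v \<in> UNIV - {F1} - {W10}" for v by (cases v) (simp_all add: gens14_def)
  then show ?thesis by blast
qed

text \<open>Setting the fourth function to 0 kills \<open>W10\<close> and leaves the other
  generators unchanged, so the part free of \<open>W10\<close> is itself a relation. What remains is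
  \<open>W10\<close> times the quotient, and the restriction of \<open>W10\<close> is a nonzero
  element of an integral domain.\<close>

lemma relation_ideal_split_W10:
  assumes "p \<in> relation_ideal (UNIV - {F1})"
  shows "free_part W10 p \<in> relation_ideal (UNIV - {F1}) \<inter> polys (set gens14)"
    and "quotient_part W10 p \<in> relation_ideal (UNIV - {F1})"
proof -
  have p: "p \<in> polys (UNIV - {F1})" "\<And>x. x (1, 1) = 0 \<Longrightarrow> pvalue x (psubst bi_inv p) = 0"
    using assms by (auto simp: relation_ideal_iff)
  have free_polys: "free_part W10 p \<in> polys (set gens14)"
    using free_part_polys[OF p(1), of W10] by (simp only: set_gens14)
  have free: "pvalue x (psubst bi_inv (free_part W10 p)) = 0" if "x (1, 1) = 0" for x
    unfolding pvalue_free_part_W10 by (rule p(2)) (use that in \<open>simp add: without_f4_def\<close>)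
  show "free_part W10 p \<in> relation_ideal (UNIV - {F1}) \<inter> polys (set gens14)"
    using free free_polys by (auto simp: relation_ideal_iff set_gens14 intro: polys_mono)
  have "restrict (bi_inv W10) * restrict (psubst bi_inv (quotient_part W10 p)) = 0"
  proof (rule mpoly_zeroI)
    fix x :: "nat \<times> nat \<Rightarrow> complex"
    define y where "y = x((1, 1) := 0)"
    have y: "y (1, 1) = 0" by (simp add: y_def)
    have "pvalue y (psubst bi_inv p) = pvalue y (psubst bi_inv (free_part W10 p)) +
        pvalue y (bi_inv W10) * pvalue y (psubst bi_inv (quotient_part W10 p))"
      by (subst split_variable[of p W10]) (simp del: bi_inv.simps)
    then show "pvalue x (restrict (bi_inv W10) * restrict (psubst bi_inv (quotient_part W10 p))) = 0"
      using p(2)[of y, OF y] free[of y, OF y] by (simp add: pvalue_restrict y_def del: bi_inv.simps)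
  qed
  moreover have "restrict (bi_inv W10) \<noteq> 0"
  proof
    assume W0: "restrict (bi_inv W10) = 0"
    obtain x where x: "x (1, 1) = 0" "\<forall>v\<in>UNIV - {F1}. pvalue x (bi_inv v) =
        scalar v * (\<Prod>i<5. 1 ^ degrees i v) * poly (linear_factor v) 0"
      using hyperplane_point[of "\<lambda>_. 1" 0] by auto
    have "x((1, 1) := 0) = x" using x(1) by auto
    then have "pvalue x (bi_inv W10) = pvalue x (restrict (bi_inv W10))" by (simp only: pvalue_restrict)
    also have "\<dots> = 0" by (simp only: W0 pv.peval_0)
    finally show False using bspec[OF x(2), of W10] by (simp add: scalar_def linear_factor_def del: bi_inv.simps)
  qed
  ultimately have R0: "restrict (psubst bi_inv (quotient_part W10 p)) = 0" by (simp only: mpoly_mult_eq_0) blast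
  have "pvalue x (psubst bi_inv (quotient_part W10 p)) = 0" if "x (1, 1) = 0" for x
  proof -
    have "x((1, 1) := 0) = x" using that by auto
    then have "pvalue x (psubst bi_inv (quotient_part W10 p)) = pvalue x (restrict (psubst bi_inv (quotient_part W10 p)))"
      by (simp only: pvalue_restrict)
    then show ?thesis by (simp only: R0 pv.peval_0)
  qed
  then show "quotient_part W10 p \<in> relation_ideal (UNIV - {F1})"
    using quotient_part_polys[OF p(1), of W10] by (simp add: relation_ideal_iff)
qed

text \<open>Formal sense of "does not involve \<open>W10\<close>": the ideal is generated by its
  members free of \<open>W10\<close>. Induction on the degree in \<open>W10\<close>, splitting off
  the free part each time.\<close>

lemma relation_ideal_without_W10:
  "relation_ideal (UNIV - {F1}) =
     ideal_generated (UNIV - {F1}) (relation_ideal (UNIV - {F1}) \<inter> polys (set gens14))"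
  (is "?I = ?J")
proof (intro equalityI subsetI)
  fix p assume "p \<in> ?J"
  then obtain F q where F: "F \<subseteq> ?I \<inter> polys (set gens14)" "\<forall>g\<in>F. q g \<in> polys (UNIV - {F1})" "p = (\<Sum>g\<in>F. q g * g)"
    unfolding ideal_generated_def by blast
  show "p \<in> ?I" unfolding F(3) by (intro relation_ideal_sum relation_ideal_mult) (use F(1,2) in auto)
next
  have "p \<in> ?J" if "p \<in> ?I" "\<forall>t\<in>keys p. lookup t W10 < n" for p n
    using that
  proof (induction n arbitrary: p)
    case 0
    then have "keys p = {}" by auto
    then have "p = 0" by (metis poly_mapping_eqI lookup_zero in_keys_iff empty_iff)
    then show ?case by (simp add: ideal_generated_0)
  next
    case (Suc n)
    note split = relation_ideal_split_W10[OF Suc.prems(1)]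
    have "\<forall>t\<in>keys (quotient_part W10 p). lookup t W10 < n"
    proof
      fix t assume t: "t \<in> keys (quotient_part W10 p)"
      obtain s where s: "s \<in> keys p" "lookup s W10 > 0" "t = s - single W10 1"
        using subsetD[OF keys_quotient_part t] by blast
      then have "lookup s W10 < Suc n" using Suc.prems(2) by blast
      then show "lookup t W10 < n" using s(2,3) by (simp add: lookup_minus)
    qed
    then have q: "quotient_part W10 p \<in> ?J" by (rule Suc.IH[OF split(2)])
    have "1 * free_part W10 p \<in> ?J" by (rule ideal_generatedI[OF split(1)]) simp
    moreover have "Var W10 * quotient_part W10 p \<in> ?J" by (rule ideal_generated_mult[OF q]) simp
    ultimately show ?case
      using split_variable[of p W10] ideal_generated_add by (metis mult_1)
  qed
  moreover have "\<forall>t\<in>keys p. lookup t W10 < Suc (\<Sum>t\<in>keys p. lookup t W10)"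
    for p :: "gen mpoly"
    by (auto simp: less_Suc_eq_le intro!: member_le_sum)
  ultimately show "p \<in> ?J" if "p \<in> ?I" for p using that by blast
qed

section \<open>Leading monomials and reducedness\<close>

definition reduced_leads :: bool where
  "reduced_leads \<longleftrightarrow> list_all (\<lambda>r. list_all (\<lambda>r'.
     (snd (hd r) = snd (hd r') \<or> list_ex (\<lambda>v. count_list (snd (hd r)) v < count_list (snd (hd r')) v) (snd (hd r'))) \<and>
     list_all (\<lambda>(k, us). list_ex (\<lambda>v. count_list us v < count_list (snd (hd r')) v) (snd (hd r'))) (tl r))
     relations) relations"

text \<open>Non-divisibility by a lead is witnessed by one variable with too small an exponent,
  which makes reducedness a finite test on lists that can be evaluated.\<close>

lemma reduced_leads: reduced_leads
  by code_simp

lemma distinct_leads: "distinct (map (\<lambda>r. snd (hd r)) relations)"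
  by code_simp

lemma tail_not_divisible:
  assumes "r \<in> set relations" "r' \<in> set relations" "t \<in> monom_of ` snd ` set (tl r)"
  shows "\<not> (\<exists>\<gamma>. t = first_monom r' + \<gamma>)"
proof -
  obtain k us where us: "(k, us) \<in> set (tl r)" "t = monom_of us" using assms(3) by auto
  have "\<exists>v\<in>set (snd (hd r')). count_list us v < count_list (snd (hd r')) v"
    using reduced_leads assms(1,2) us(1) unfolding reduced_leads_def list_all_iff list_ex_iff by fastforce
  then show ?thesis
    unfolding first_monom_eq first_monom_dvd_iff us(2) by (auto simp: lookup_monom_of not_le)
qed

lemma lead_not_divisible:
  assumes "r \<in> set relations" "r' \<in> set relations" "r \<noteq> r'"
  shows "\<not> (\<exists>\<gamma>. first_monom r = first_monom r' + \<gamma>)"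
proof -
  have "snd (hd r) \<noteq> snd (hd r')"
    using distinct_leads assms by (auto simp: distinct_map inj_on_def)
  then have "\<exists>v\<in>set (snd (hd r')). count_list (snd (hd r)) v < count_list (snd (hd r')) v"
    using reduced_leads assms(1,2) unfolding reduced_leads_def list_all_iff list_ex_iff by fastforce
  then show ?thesis
    unfolding first_monom_eq first_monom_dvd_iff by (auto simp: lookup_monom_of not_le)
qed

text \<open>If the leading monomial of a relation \<open>f\<close> were normal, the normal form of \<open>f\<close> would be a nonzero
  relation between normal monomials.\<close>

lemma lead_divisible:
  assumes f: "f \<in> relation_ideal (set gens14)" and t: "t \<in> keys f"
    "\<And>s. s \<in> keys f \<Longrightarrow> s \<noteq> t \<Longrightarrow> lex14 s t"
  shows "\<exists>r\<in>set relations. \<exists>\<gamma>. t = first_monom r + \<gamma>"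
proof (rule ccontr)
  assume not: "\<not> ?thesis"
  have "nf.normal t"
  proof -
    have "\<not> (\<exists>l\<in>fst ` gen_rules. \<exists>\<gamma>. t = l + \<gamma>)" using not by (simp add: fst_gen_rules)
    then show ?thesis by (force simp: nf.normal_def)
  qed
  have f14: "lookup s F1 = 0" if "s \<in> keys f" for s
  proof -
    have "keys s \<subseteq> set gens14" using f that by (auto simp: relation_ideal_def polys_keys)
    then show ?thesis by (auto simp: set_gens14 in_keys_iff)
  qed
  define c where "c = lookup f t"
  define f' where "f' = f - single t c"
  have f': "s \<in> keys f \<and> s \<noteq> t" if "s \<in> keys f'" for s
    using that by (auto simp: f'_def c_def in_keys_iff lookup_minus lookup_single when_def split: if_splits)
  obtain N where N: "keys N \<subseteq> {u. nf.normal u \<and> (\<exists>s\<in>keys f'. gen_order s u)}"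
    "psubst bi_inv N = psubst bi_inv f'"
    using nf.reduce[of f'] by auto
  \<comment> \<open>Terms of \<open>N\<close> come from monomials lexicographically below
    \<open>t\<close>. Reduction either lowers them further or raises the exponent of
    \<open>F1\<close>, which is 0 in \<open>t\<close>.\<close>
  have "t \<notin> keys N"
  proof
    assume "t \<in> keys N"
    then obtain s where s: "s \<in> keys f'" "gen_order s t" using N(1) by blast
    have "lex14 s t" using t(2) f'[OF s(1)] by blast
    moreover have "t = s \<or> lex14 t s"
      using s(2) f14[of s] f14[OF t(1)] f'[OF s(1)] by (simp add: gen_order_def)
    ultimately show False using lex_less_trans lex_less_irrefl by blast
  qed
  define M where "M = single t c + N"
  have "keys M \<subseteq> keys (single t c) \<union> keys N"
    unfolding M_def by (rule Poly_Mapping.keys_add)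
  then have M_normal: "keys M \<subseteq> {u. nf.normal u}"
    using N(1) \<open>nf.normal t\<close> by (auto split: if_splits)
  have "psubst bi_inv M = psubst bi_inv (single t c + f')"
    by (simp only: M_def ps.peval_add N(2))
  then have "psubst bi_inv M = psubst bi_inv f" by (simp add: f'_def)
  then have "M = Var F1 * quotient_part F1 M"
    using f by (intro nd.free_part_vanishes[OF M_normal]) (simp add: relation_ideal_iff)
  then have "free_part F1 M = 0" using split_variable[of M F1] by simp
  then have "lookup M t = 0"
    using lookup_free_part[of t F1 M] f14[OF t(1)] by simp
  moreover have "lookup M t = c"
    using \<open>t \<notin> keys N\<close> by (simp add: M_def lookup_add in_keys_iff)
  ultimately show False using t(1) by (simp add: c_def in_keys_iff)
qed

lemma normalized_relation:
  assumes r: "r \<in> set relations"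
  defines "g \<equiv> normalize_lead lex14 (relation_poly r)"
  shows "keys g = keys (relation_poly r)" "lead_monom lex14 g = first_monom r"
    "lead_coef lex14 g = 1" "g \<noteq> 0" "lead_term lex14 g = single (first_monom r) 1"
    "g \<in> relation_ideal (set gens14)"
proof -
  note lead = relation_lead[OF r]
  have lc: "lead_coef lex14 (relation_poly r) = first_coeff r"
    by (simp add: lead_coef_def lead_monom_relation[OF r] lead(2))
  have g: "g = Const (inverse (first_coeff r)) * relation_poly r" by (simp add: g_def normalize_lead_def lc)
  have look: "lookup g t = inverse (first_coeff r) * lookup (relation_poly r) t" for t
    unfolding g by (rule lookup_Const_mult)
  show keys: "keys g = keys (relation_poly r)"
    using lead(1) by (auto simp: in_keys_iff look)
  have mem: "first_monom r \<in> keys (relation_poly r)" using lead(1,2) by (simp add: in_keys_iff)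
  show lm: "lead_monom lex14 g = first_monom r"
    by (rule lead_monomI) (use keys mem lead(4) in auto)
  show lc1: "lead_coef lex14 g = 1" using lead(1) by (simp add: lead_coef_def lm look lead(2))
  show "g \<noteq> 0" using keys mem by auto
  show "lead_term lex14 g = single (first_monom r) 1" by (simp add: lead_term_def lm lc1)
  obtain c vs where cv: "(r, (c, vs)) \<in> set (zip relations lifts)" using relation_lift_exists[OF r] by force
  have "pvalue x (psubst bi_inv (relation_poly r)) = 0" if "x (1, 1) = 0" for x
    unfolding lifts_correct[OF cv] using that by simp
  then have "relation_poly r \<in> relation_ideal (set gens14)" using lead(5) by (simp add: relation_ideal_iff)
  then show "g \<in> relation_ideal (set gens14)" unfolding g by (rule relation_ideal_mult) simp
qed

text \<open>By \<open>lead_divisible\<close> every leading monomial of the ideal is a multiple of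
  one of the 41, which is the inclusion of leading ideals that matters. Membership of a monomial in
  a monomial ideal is divisibility, so reducedness follows from the test on lists.\<close>

lemma relations_reduced_groebner_basis:
  "reduced_groebner_basis (set gens14) lex14 (relation_ideal (set gens14))
     ((\<lambda>r. normalize_lead lex14 (relation_poly r)) ` set relations)"
proof -
  let ?g = "\<lambda>r. normalize_lead lex14 (relation_poly r)"
  let ?G = "?g ` set relations" and ?X = "set gens14"
  let ?I = "relation_ideal ?X"
  have "?G \<subseteq> ?I" using normalized_relation(6) by blast
  have "ideal_generated ?X (lead_term lex14 ` (?G - {0})) \<subseteq> ideal_generated ?X (lead_term lex14 ` (?I - {0}))"
  proof (rule ideal_generated_subset)
    fix h assume "h \<in> lead_term lex14 ` (?G - {0})"
    then have "h \<in> lead_term lex14 ` (?I - {0})" using \<open>?G \<subseteq> ?I\<close> by blast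
    then have "1 * h \<in> ideal_generated ?X (lead_term lex14 ` (?I - {0}))" by (rule ideal_generatedI) simp
    then show "h \<in> ideal_generated ?X (lead_term lex14 ` (?I - {0}))" by simp
  qed
  moreover have "ideal_generated ?X (lead_term lex14 ` (?I - {0})) \<subseteq> ideal_generated ?X (lead_term lex14 ` (?G - {0}))"
  proof (rule ideal_generated_subset)
    fix h assume "h \<in> lead_term lex14 ` (?I - {0})"
    then obtain f where f: "f \<in> ?I" "f \<noteq> 0" "h = lead_term lex14 f" by blast
    have f_polys: "f \<in> polys ?X" using f(1) by (simp add: relation_ideal_def)
    have "\<exists>t\<in>keys f. \<forall>s\<in>keys f. s \<noteq> t \<longrightarrow> lex14 s t"
      using f(2) f_polys by (intro lex_max_exists) (auto simp: polys_keys)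
    then obtain t where t: "t \<in> keys f" "\<And>s. s \<in> keys f \<Longrightarrow> s \<noteq> t \<Longrightarrow> lex14 s t" by blast
    have lm: "lead_monom lex14 f = t" by (rule lead_monomI) (use t in auto)
    obtain r \<gamma> where r: "r \<in> set relations" "t = first_monom r + \<gamma>" using lead_divisible[OF f(1) t] by blast
    have "keys t \<subseteq> ?X" using f_polys t(1) by (auto simp: polys_keys)
    then have "keys \<gamma> \<subseteq> ?X" by (simp add: r(2) keys_monom_add)
    have "lead_term lex14 (?g r) \<in> lead_term lex14 ` (?G - {0})"
      using r(1) normalized_relation(4)[OF r(1)] by blast
    then have "single \<gamma> (lead_coef lex14 f) * lead_term lex14 (?g r) \<in>
        ideal_generated ?X (lead_term lex14 ` (?G - {0}))"
      by (rule ideal_generatedI) (simp add: single_polys \<open>keys \<gamma> \<subseteq> ?X\<close>)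
    moreover have "h = single \<gamma> (lead_coef lex14 f) * lead_term lex14 (?g r)"
      by (simp add: f(3) lead_term_def[of _ f] lm r(2) normalized_relation(5)[OF r(1)] mult_single add.commute)
    ultimately show "h \<in> ideal_generated ?X (lead_term lex14 ` (?G - {0}))" by simp
  qed
  ultimately have gb: "groebner_basis ?X lex14 ?I ?G"
    using \<open>?G \<subseteq> ?I\<close> by (simp add: groebner_basis_def)
  have reduced: "single t 1 \<notin> ideal_generated ?X (lead_term lex14 ` (?G - {?g r}))"
    if r: "r \<in> set relations" and t: "t \<in> keys (?g r)" for r t
  proof
    assume "single t 1 \<in> ideal_generated ?X (lead_term lex14 ` (?G - {?g r}))"
    then have "\<exists>m\<in>first_monom ` (set relations - {r}). \<exists>\<gamma>. t = m + \<gamma>"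
    proof (rule monomial_in_monomial_ideal)
      fix h assume "h \<in> lead_term lex14 ` (?G - {?g r})"
      then obtain r' where r': "r' \<in> set relations" "?g r' \<noteq> ?g r" "h = lead_term lex14 (?g r')" by blast
      then have "r' \<noteq> r" by blast
      then show "\<exists>m c. h = single m c \<and> m \<in> first_monom ` (set relations - {r})"
        using r' normalized_relation(5)[OF r'(1)] by blast
    qed
    then obtain r' \<gamma> where r': "r' \<in> set relations" "r \<noteq> r'" "t = first_monom r' + \<gamma>" by blast
    have "t = first_monom r \<or> t \<in> monom_of ` snd ` set (tl r)"
      using relation_lead(3)[OF r] t normalized_relation(1)[OF r] by blast
    then show False
    proof
      assume "t = first_monom r"
      then show False using lead_not_divisible[OF r r'(1,2)] r'(3) by blast
    next
      assume "t \<in> monom_of ` snd ` set (tl r)"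
      then show False using tail_not_divisible[OF r r'(1)] r'(3) by blast
    qed
  qed
  show ?thesis
    unfolding reduced_groebner_basis_def
  proof (intro conjI gb ballI)
    fix g assume "g \<in> ?G"
    then obtain r where r: "r \<in> set relations" "g = ?g r" by blast
    show "g \<noteq> 0" "lead_coef lex14 g = 1"
      unfolding r(2) by (rule normalized_relation[OF r(1)])+
    show "single t 1 \<notin> ideal_generated ?X (lead_term lex14 ` (?G - {g}))"
      if "t \<in> keys g" for t
      using reduced[OF r(1), of t] that unfolding r(2) by blast
  qed
qed

theorem mainTheorem10:
  shows
    "\<comment> \<open>(i)\<close>
     ((\<forall>v. bi_inv v \<in> bi_invariants 4 (weight v)) \<and>
      mutually_independent bi_inv \<and>
      UE 4 = generated_algebra bi_inv UNIV) \<and>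
     \<comment> \<open>(ii)\<close>
     (relation_ideal (UNIV - {F1}) =
        ideal_generated (UNIV - {F1}) (relation_ideal (UNIV - {F1}) \<inter> polys (set gens14)) \<and>
      reduced_groebner_basis (set gens14) lex14
        (relation_ideal (UNIV - {F1}) \<inter> polys (set gens14))
        ((\<lambda>r. normalize_lead lex14 (relation_poly r)) ` set relations) \<and>
      (\<forall>r\<in>set relations. lead_monom lex14 (relation_poly r) = first_monom r)) \<and>
     \<comment> \<open>(iii)\<close>
     unique_normal_form 4 normal_exponents \<and>
     \<comment> \<open>(iv)\<close>
     (UE 3 = generated_algebra bi_inv (UNIV - {W10}) \<and>
      relation_ideal (set gens14) = relation_ideal (UNIV - {F1}) \<inter> polys (set gens14) \<and>
      reduced_groebner_basis (set gens14) lex14 (relation_ideal (set gens14))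
        ((\<lambda>r. normalize_lead lex14 (relation_poly r)) ` set relations) \<and>
      unique_normal_form 3 normal_exponents_without_W10)"
proof -
  have eq: "relation_ideal (set gens14) = relation_ideal (UNIV - {F1}) \<inter> polys (set gens14)"
    by (rule relation_ideal_mono) (auto simp: set_gens14)
  show ?thesis
    unfolding eq[symmetric]
    by (intro conjI allI ballI bi_inv_in_bi_invariants bi_inv_mutually_independent UE_4 UE_3
        relation_ideal_without_W10[folded eq] relations_reduced_groebner_basis lead_monom_relation
        unique_normal_form_4 unique_normal_form_3 refl)
qed

end
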